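(* Let $k\in\mathbb{N}_0$ and suppose $h\in C^{k,k}(\overline\Theta\times\overline\Theta)$ is positive definite. Let $\{(\lambda_{j,k},e_{j,k})\}_j$ denote the eigensystem of the associated kernel operator $T_{h,k}\in HS(H^k)$. Then $T_{h,k}$ is also compact as an operator on $H_0^k(\Theta):=\{f\in C^k(\Theta)\mid\|f\|_{H^k}<\infty\}$ (equipped with the norm $\|\cdot\|_{H^k}$), $e_{j,k}\in C^k(\overline\Theta)$ for all $j$, and for all $|\alpha|,|\beta|\le k$, $$\lim_{m\to\infty}\ \sup_{x,y\in\overline\Theta}\Big|\partial^{[\alpha,\beta]}h(x,y)-\sum_{j\le m}\lambda_{j,k}\,e_{j,k}^{[\alpha]}(x)\,e_{j,k}^{[\beta]}(y)\Big|=0.$$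
   Context: $d\in\mathbb{N}$ and $\Theta\subset\mathbb{R}^d$ is a bounded domain, meaning a bounded open subset. All functions are real-valued; $\alpha,\beta\in\mathbb{N}_0^d$ are multi-indices. $f^{(\alpha)}$ is the weak and $f^{[\alpha]}$ the classical derivative. $\partial^{[\alpha,\beta]}h$ is the classical mixed derivative of a kernel $h$ on $\Theta\times\Theta$, of order $\alpha$ in the first variable and $\beta$ in the second. $C^k(\overline\Theta)$ is the space of $f\in C^k(\Theta)$ such that $f^{[\alpha]}$ is uniformly continuous on $\Theta$ for $|\alpha|\le k$. $C^{k,k}(\overline\Theta\times\overline\Theta)$ is the class of uniformly continuous kernels $h\colon\Theta\times\Theta\to\mathbb{R}$ whose mixed partial derivatives $\partial^{[\alpha,\beta]}h$ exist and are uniformly continuous on $\Theta\times\Theta$ for $|\alpha|,|\beta|\le k$. Uniformly continuous functions are identified with their continuous extensions to the closure. A kernel $h$ is positive definite if it is symmetric and $\sum_{i,j\le n}c_i\,h(x_i,x_j)\,c_j\ge0$ for all $n\in\mathbb{N}$, $c_i\in\mathbb{R}$, $x_i\in\Theta$. $H^k(\Theta)$ is the $L^2$-based Sobolev space with inner product $\langle f,g\rangle_{H^k}=\sum_{|\alpha|\le k}\langle f^{(\alpha)},g^{(\alpha)}\rangle_{L^2}$. The kernel operator of order $k$ associated with $h$ is the self-adjoint Hilbert-Schmidt operator $T_{h,k}\colon H^k(\Theta)\to H^k(\Theta)$, $$[T_{h,k}f](y)=\int_\Theta\sum_{|\alpha|\le k}\partial^{[\alpha,0]}h(x,y)\,f^{(\alpha)}(x)\,dx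 .$$ Its eigensystem $\{(\lambda_{j,k},e_{j,k})\}_j$ consists of the non-zero eigenvalues, counted with multiplicity and in order of decreasing absolute value, with corresponding $H^k$-orthonormal eigenfunctions. The index $j$ runs over $\mathbb{N}$, or over $\{1,\dots,N\}$ if $N=\mathrm{rank}(T_{h,k})<\infty$; sums over $j$ are over this index set. *)

theory Defs
  imports "HOL-Analysis.Analysis" "HOL-Library.Multiset"
begin

section \<open>Classical derivatives\<close>

definition dir_deriv :: "'a::real_normed_vector \<Rightarrow> ('a \<Rightarrow> real) \<Rightarrow> 'a \<Rightarrow> real" where
  "dir_deriv v f x = deriv (\<lambda>t. f (x + t *\<^sub>R v)) 0"

text \<open>The last direction of the list is differentiated first.\<close>

definition iter_deriv :: "'a::real_normed_vector list \<Rightarrow> ('a \<Rightarrow> real) \<Rightarrow> 'a \<Rightarrow> real" where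
  "iter_deriv vs f = foldr dir_deriv vs f"

primrec iter_deriv_exists_on ::
  "'a::real_normed_vector set \<Rightarrow> 'a list \<Rightarrow> ('a \<Rightarrow> real) \<Rightarrow> bool" where
  "iter_deriv_exists_on S [] f \<longleftrightarrow> True"
| "iter_deriv_exists_on S (v # vs) f \<longleftrightarrow>
     iter_deriv_exists_on S vs f \<and>
     (\<forall>x\<in>S. (\<lambda>t::real. iter_deriv vs f (x + t *\<^sub>R v)) differentiable (at 0))"

type_synonym 'n multi_index = "'n \<Rightarrow> nat"

definition mi_order :: "'n::finite multi_index \<Rightarrow> nat" where
  "mi_order \<alpha> = (\<Sum>i\<in>UNIV. \<alpha> i)"

definition mi_upto :: "nat \<Rightarrow> ('n::finite) multi_index set" where
  "mi_upto k = {\<alpha>. mi_order \<alpha> \<le> k}"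

text \<open>
  A list in which the coordinate \<open>i\<close> occurs \<open>\<alpha> i\<close> times. It fixes an order of differentiation;
  for the functions considered below all partial derivatives of the relevant orders are continuous,
  so by Schwarz's theorem the order does not matter.
\<close>

definition mi_list :: "'n::finite multi_index \<Rightarrow> 'n list" where
  "mi_list \<alpha> = (SOME is. \<forall>i. count_list is i = \<alpha> i)"

lemma count_list_mi_list: "count_list (mi_list \<alpha>) i = \<alpha> i"
proof -
  have "finite {i. 0 < \<alpha> i}"
    by simp
  then have "count (Abs_multiset \<alpha>) = \<alpha>"
    by (simp add: count_Abs_multiset)
  moreover obtain xs where "mset xs = Abs_multiset \<alpha>"
    using ex_mset by blast
  ultimately have "\<forall>i. count_list xs i = \<alpha> i"
    by (metis count_mset)
  then have "\<forall>i. count_list (mi_list \<alpha>) i = \<alpha> i"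
    unfolding mi_list_def by (rule someI)
  then show ?thesis
    by simp
qed

lemma finite_mi_upto: "finite (mi_upto k :: ('n::finite) multi_index set)"
proof (rule finite_subset)
  show "mi_upto k \<subseteq> (PiE UNIV (\<lambda>_. {..k}) :: ('n \<Rightarrow> nat) set)"
  proof
    fix \<alpha> :: "'n \<Rightarrow> nat" assume "\<alpha> \<in> mi_upto k"
    then have "(\<Sum>i\<in>UNIV. \<alpha> i) \<le> k"
      by (simp add: mi_upto_def mi_order_def)
    then have "\<alpha> i \<le> k" for i
      using member_le_sum[of i UNIV \<alpha>] by simp
    then show "\<alpha> \<in> PiE UNIV (\<lambda>_. {..k})"
      by auto
  qed
qed (auto intro: finite_PiE)

definition class_deriv :: "'n::finite multi_index \<Rightarrow> (real^'n \<Rightarrow> real) \<Rightarrow> real^'n \<Rightarrow> real" where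
  "class_deriv \<alpha> f = iter_deriv (map (\<lambda>i. axis i 1) (mi_list \<alpha>)) f"

definition Ck :: "(real^'n::finite) set \<Rightarrow> nat \<Rightarrow> (real^'n \<Rightarrow> real) set" where
  "Ck \<Theta> k = {f. \<forall>is. length is \<le> k \<longrightarrow>
     iter_deriv_exists_on \<Theta> (map (\<lambda>i. axis i 1) is) f \<and>
     continuous_on \<Theta> (iter_deriv (map (\<lambda>i. axis i 1) is) f)}"

text \<open>The space usually written \<open>C\<^sup>k\<close> of the closure of \<open>\<Theta>\<close>; its elements are functions on \<open>\<Theta>\<close>.\<close>

definition Ck_closure :: "(real^'n::finite) set \<Rightarrow> nat \<Rightarrow> (real^'n \<Rightarrow> real) set" where
  "Ck_closure \<Theta> k =
     {f \<in> Ck \<Theta> k. \<forall>\<alpha>\<in>mi_upto k. uniformly_continuous_on \<Theta> (class_deriv \<alpha> f)}"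

text \<open>The continuous extension to the closure, for uniformly continuous \<open>f\<close>.\<close>

definition cont_ext :: "'a::metric_space set \<Rightarrow> ('a \<Rightarrow> real) \<Rightarrow> 'a \<Rightarrow> real" where
  "cont_ext S f x = (if x \<in> S then f x else Lim (at x within S) f)"

section \<open>Kernels\<close>

text \<open>\<open>Inl i\<close> stands for the \<open>i\<close>-th coordinate of the first variable, \<open>Inr i\<close> for that of the second.\<close>

primrec kernel_dir :: "'n::finite + 'n \<Rightarrow> (real^'n) \<times> (real^'n)" where
  "kernel_dir (Inl i) = (axis i 1, 0)"
| "kernel_dir (Inr i) = (0, axis i 1)"

definition kernel_deriv ::
  "'n::finite multi_index \<Rightarrow> 'n multi_index \<Rightarrow> ((real^'n) \<times> (real^'n) \<Rightarrow> real)
     \<Rightarrow> (real^'n) \<times> (real^'n) \<Rightarrow> real" where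
  "kernel_deriv \<alpha> \<beta> h =
     iter_deriv (map kernel_dir (map Inl (mi_list \<alpha>) @ map Inr (mi_list \<beta>))) h"

text \<open>
  At most \<open>k\<close> derivatives in each of the two variables, in every order of differentiation
  (equivalently, by Schwarz's theorem, in one fixed order).
\<close>

definition Ckk_closure ::
  "(real^'n::finite) set \<Rightarrow> nat \<Rightarrow> ((real^'n) \<times> (real^'n) \<Rightarrow> real) set" where
  "Ckk_closure \<Theta> k = {h. \<forall>ws.
     length (filter isl ws) \<le> k \<and> length (filter (\<lambda>w. \<not> isl w) ws) \<le> k \<longrightarrow>
       iter_deriv_exists_on (\<Theta> \<times> \<Theta>) (map kernel_dir ws) h \<and>
       uniformly_continuous_on (\<Theta> \<times> \<Theta>) (iter_deriv (map kernel_dir ws) h)}"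

definition positive_definite_kernel :: "'a set \<Rightarrow> ('a \<times> 'a \<Rightarrow> real) \<Rightarrow> bool" where
  "positive_definite_kernel S h \<longleftrightarrow>
     (\<forall>x\<in>S. \<forall>y\<in>S. h (x, y) = h (y, x)) \<and>
     (\<forall>(n::nat) (c :: nat \<Rightarrow> real) x. (\<forall>i<n. x i \<in> S) \<longrightarrow>
        0 \<le> (\<Sum>i<n. \<Sum>j<n. c i * h (x i, x j) * c j))"

section \<open>Weak derivatives and Sobolev spaces\<close>

definition test_functions :: "(real^'n::finite) set \<Rightarrow> (real^'n \<Rightarrow> real) set" where
  "test_functions \<Theta> = {\<phi>. (\<forall>k. \<phi> \<in> Ck UNIV k) \<and>
     compact (closure {x. \<phi> x \<noteq> 0}) \<and> closure {x. \<phi> x \<noteq> 0} \<subseteq> \<Theta>}"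

definition locally_integrable :: "(real^'n::finite) set \<Rightarrow> (real^'n \<Rightarrow> real) \<Rightarrow> bool" where
  "locally_integrable \<Theta> f \<longleftrightarrow>
     (\<forall>K. compact K \<and> K \<subseteq> \<Theta> \<longrightarrow> integrable (lebesgue_on K) f)"

definition has_weak_deriv ::
  "(real^'n::finite) set \<Rightarrow> 'n multi_index \<Rightarrow> (real^'n \<Rightarrow> real) \<Rightarrow> (real^'n \<Rightarrow> real) \<Rightarrow> bool" where
  "has_weak_deriv \<Theta> \<alpha> f g \<longleftrightarrow>
     locally_integrable \<Theta> f \<and> locally_integrable \<Theta> g \<and>
     (\<forall>\<phi>\<in>test_functions \<Theta>.
        integral\<^sup>L (lebesgue_on \<Theta>) (\<lambda>x. f x * class_deriv \<alpha> \<phi> x) =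
        (-1) ^ mi_order \<alpha> * integral\<^sup>L (lebesgue_on \<Theta>) (\<lambda>x. g x * \<phi> x))"

text \<open>
  Weak derivatives are unique only up to null sets; \<open>weak_deriv\<close> picks a representative. It is
  used only under integrals, which do not depend on the choice.
\<close>

definition weak_deriv ::
  "(real^'n::finite) set \<Rightarrow> 'n multi_index \<Rightarrow> (real^'n \<Rightarrow> real) \<Rightarrow> real^'n \<Rightarrow> real" where
  "weak_deriv \<Theta> \<alpha> f = (SOME g. has_weak_deriv \<Theta> \<alpha> f g)"

definition L2 :: "(real^'n::finite) set \<Rightarrow> (real^'n \<Rightarrow> real) set" where
  "L2 \<Theta> = {f. f \<in> borel_measurable (lebesgue_on \<Theta>) \<and>
     integrable (lebesgue_on \<Theta>) (\<lambda>x. (f x)\<^sup>2)}"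

definition inner_L2 ::
  "(real^'n::finite) set \<Rightarrow> (real^'n \<Rightarrow> real) \<Rightarrow> (real^'n \<Rightarrow> real) \<Rightarrow> real" where
  "inner_L2 \<Theta> f g = integral\<^sup>L (lebesgue_on \<Theta>) (\<lambda>x. f x * g x)"

text \<open>
  The elements of \<open>Hk \<Theta> k\<close> are functions rather than classes modulo equality almost everywhere;
  equality in the Sobolev space is equality almost everywhere with respect to \<open>lebesgue_on \<Theta>\<close>.
\<close>

definition Hk :: "(real^'n::finite) set \<Rightarrow> nat \<Rightarrow> (real^'n \<Rightarrow> real) set" where
  "Hk \<Theta> k = {f \<in> L2 \<Theta>. \<forall>\<alpha>\<in>mi_upto k. \<exists>g\<in>L2 \<Theta>. has_weak_deriv \<Theta> \<alpha> f g}"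

definition inner_Hk ::
  "(real^'n::finite) set \<Rightarrow> nat \<Rightarrow> (real^'n \<Rightarrow> real) \<Rightarrow> (real^'n \<Rightarrow> real) \<Rightarrow> real" where
  "inner_Hk \<Theta> k f g = (\<Sum>\<alpha>\<in>mi_upto k. inner_L2 \<Theta> (weak_deriv \<Theta> \<alpha> f) (weak_deriv \<Theta> \<alpha> g))"

definition norm_Hk :: "(real^'n::finite) set \<Rightarrow> nat \<Rightarrow> (real^'n \<Rightarrow> real) \<Rightarrow> real" where
  "norm_Hk \<Theta> k f = sqrt (inner_Hk \<Theta> k f f)"

text \<open>
  \<open>norm_Hk\<close> is real-valued (a divergent integral is 0), so finiteness of the norm of a
  function in \<open>C\<^sup>k\<close> is expressed by membership in \<open>Hk\<close>.
\<close>

definition H0k :: "(real^'n::finite) set \<Rightarrow> nat \<Rightarrow> (real^'n \<Rightarrow> real) set" where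
  "H0k \<Theta> k = {f \<in> Ck \<Theta> k. f \<in> Hk \<Theta> k}"

section \<open>Kernel operators\<close>

definition kernel_op ::
  "(real^'n::finite) set \<Rightarrow> nat \<Rightarrow> ((real^'n) \<times> (real^'n) \<Rightarrow> real)
     \<Rightarrow> (real^'n \<Rightarrow> real) \<Rightarrow> real^'n \<Rightarrow> real" where
  "kernel_op \<Theta> k h f y =
     integral\<^sup>L (lebesgue_on \<Theta>)
       (\<lambda>x. \<Sum>\<alpha>\<in>mi_upto k. kernel_deriv \<alpha> (\<lambda>_. 0) h (x, y) * weak_deriv \<Theta> \<alpha> f x)"

text \<open>
  A compact linear operator on a normed space \<open>V\<close> of functions on \<open>S\<close>. Functions in \<open>V\<close> agreeing
  on \<open>S\<close> are the same element of the space, hence linearity is required on \<open>S\<close> only.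
\<close>

definition compact_operator_on ::
  "'a set \<Rightarrow> ('a \<Rightarrow> real) set \<Rightarrow> (('a \<Rightarrow> real) \<Rightarrow> real) \<Rightarrow> (('a \<Rightarrow> real) \<Rightarrow> 'a \<Rightarrow> real) \<Rightarrow> bool" where
  "compact_operator_on S V N T \<longleftrightarrow>
     (\<forall>f\<in>V. T f \<in> V) \<and>
     (\<forall>f\<in>V. \<forall>g\<in>V. \<forall>a b. \<forall>y\<in>S. T (\<lambda>x. a * f x + b * g x) y = a * T f y + b * T g y) \<and>
     (\<forall>f :: nat \<Rightarrow> 'a \<Rightarrow> real. (\<forall>n. f n \<in> V) \<and> (\<exists>B. \<forall>n. N (f n) \<le> B) \<longrightarrow>
        (\<exists>r g. strict_mono r \<and> g \<in> V \<and> (\<lambda>n. N (\<lambda>x. T (f (r n)) x - g x)) \<longlonglongrightarrow> 0))"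

definition eigenfunction ::
  "(real^'n::finite) set \<Rightarrow> nat \<Rightarrow> ((real^'n) \<times> (real^'n) \<Rightarrow> real) \<Rightarrow> real
     \<Rightarrow> (real^'n \<Rightarrow> real) \<Rightarrow> bool" where
  "eigenfunction \<Theta> k h \<mu> f \<longleftrightarrow>
     f \<in> Hk \<Theta> k \<and> (AE x in lebesgue_on \<Theta>. kernel_op \<Theta> k h f x = \<mu> * f x)"

text \<open>
  The last clause says that the \<open>e j\<close> with \<open>lam j = \<mu>\<close> span the eigenspace of every \<open>\<mu> \<noteq> 0\<close>. With
  orthonormality this means that every non-zero eigenvalue occurs in \<open>lam\<close> as often as its
  multiplicity, so \<open>J\<close> has as many elements as the rank of the operator. The zero
  function counts as an \<open>eigenfunction\<close> here; it does not occur among the \<open>e j\<close>.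
\<close>

definition eigensystem ::
  "(real^'n::finite) set \<Rightarrow> nat \<Rightarrow> ((real^'n) \<times> (real^'n) \<Rightarrow> real) \<Rightarrow> nat set
     \<Rightarrow> (nat \<Rightarrow> real) \<Rightarrow> (nat \<Rightarrow> real^'n \<Rightarrow> real) \<Rightarrow> bool" where
  "eigensystem \<Theta> k h J lam e \<longleftrightarrow>
     (J = {1..} \<or> (\<exists>N. J = {1..N})) \<and>
     (\<forall>j\<in>J. lam j \<noteq> 0 \<and> eigenfunction \<Theta> k h (lam j) (e j)) \<and>
     (\<forall>i\<in>J. \<forall>j\<in>J. inner_Hk \<Theta> k (e i) (e j) = (if i = j then 1 else 0)) \<and>
     (\<forall>i\<in>J. \<forall>j\<in>J. i \<le> j \<longrightarrow> \<bar>lam j\<bar> \<le> \<bar>lam i\<bar>) \<and>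
     (\<forall>\<mu> f. \<mu> \<noteq> 0 \<and> eigenfunction \<Theta> k h \<mu> f \<longrightarrow>
        finite {j\<in>J. lam j = \<mu>} \<and>
        (\<exists>c. AE x in lebesgue_on \<Theta>. f x = (\<Sum>j\<in>{j\<in>J. lam j = \<mu>}. c j * e j x)))"

end

theory Submission
  imports Defs "HOL-Complex_Analysis.Great_Picard"
begin

text \<open>
  The map sending \<open>f\<close> to the family of its weak derivatives of order at most \<open>k\<close> embeds \<open>H\<^sup>k\<close>
  isometrically into \<open>L\<^sup>2\<close> over \<open>{\<alpha>. \<bar>\<alpha>\<bar> \<le> k} \<times> \<Theta>\<close>. It turns the kernel operator of order \<open>k\<close>
  into the ordinary integral operator with the matrix-valued kernel \<open>\<partial>\<^sup>[\<^sup>\<alpha>\<^sup>,\<^sup>\<beta>\<^sup>]h\<close>, whose range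
  consists of derivative families of \<open>C\<^sup>k\<close> functions, so that both operators have the same eigensystem.
  The matrix-valued kernel is positive semidefinite, because difference quotients approximate its
  quadratic forms by those of \<open>h\<close>; so the claim is Mercer's theorem for this kernel.

  A positive semidefinite kernel carries the pseudometric \<open>d(x,y)\<^sup>2 = K(x,x) - 2K(x,y) + K(y,y)\<close>,
  and Mercer's theorem needs only that it is totally bounded and that its balls have positive measure.
  The remainders \<open>R\<^sub>m\<close> of the expansion
  are again positive semidefinite, and \<open>\<surd>R\<^sub>m(x,x)\<close> is 1-Lipschitz for \<open>d\<close>, uniformly in \<open>m\<close>. The
  pointwise limit of the \<open>R\<^sub>m\<close> has no eigenfunction to a non-zero eigenvalue, so it vanishes;
  a finite net then makes the convergence uniform.
\<close>

section \<open>Finite quadratic forms of kernels\<close>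

text \<open>The main obstacle is that the pointwise limit of the remainders is not known to be
  continuous, while the spectral argument has to be applied to exactly this kernel. Conditions
  phrased by the pseudometric survive the limit, because subtracting a positive semidefinite kernel
  can only decrease \<open>kdist2\<close>. The only spectral input is that a non-zero quadratic form
  has an eigenfunction to a positive eigenvalue. Joint measurability is not assumed, so integrals
  against the kernel are treated as limits of finite quadratic forms, and symmetry, positivity and
  Cauchy-Schwarz pass to the limit.

  The second obstacle is that eigenfunctions and weak derivatives are given only up to null sets,
  while the expansion concerns every point. The operator itself supplies the representatives: an
  eigenfunction is its own image divided by the eigenvalue, and images are smooth everywhere.
  Identifying their classical derivatives with the weak ones takes integration by parts and
  uniqueness of weak derivatives.\<close>

lemma discriminant_nonpos:
  fixes a b c :: real
  assumes nonneg: "\<And>t. 0 \<le> a + 2 * t * b + t\<^sup>2 * c" and "0 \<le> c"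
  shows "b\<^sup>2 \<le> a * c"
proof (cases "c = 0")
  case True
  have "b = 0"
  proof (rule ccontr)
    assume "b \<noteq> 0"
    then show False
      \<comment> \<open>At this \<open>t\<close> the affine function \<open>a + 2 * t * b\<close>
        has the value -1.\<close>
      using nonneg[of "- (a + 1) / (2 * b)"] True by (simp add: field_simps)
  qed
  then show ?thesis
    using True by simp
next
  case False
  then show ?thesis
    using nonneg[of "- b / c"] \<open>0 \<le> c\<close> by (simp add: field_simps power2_eq_square)
qed

text \<open>A list of pairs is a formal combination of point masses. Points may be repeated, so
  concatenation is addition and no normal form is needed.\<close>

definition kform :: "('a \<Rightarrow> 'a \<Rightarrow> real) \<Rightarrow> (real \<times> 'a) list \<Rightarrow> (real \<times> 'a) list \<Rightarrow> real" where
  "kform K xs ys = (\<Sum>p\<leftarrow>xs. \<Sum>q\<leftarrow>ys. fst p * fst q * K (snd p) (snd q))"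

definition psd_on :: "'a set \<Rightarrow> ('a \<Rightarrow> 'a \<Rightarrow> real) \<Rightarrow> bool" where
  "psd_on S K \<longleftrightarrow> (\<forall>x\<in>S. \<forall>y\<in>S. K x y = K y x) \<and>
     (\<forall>xs. snd ` set xs \<subseteq> S \<longrightarrow> 0 \<le> kform K xs xs)"

text \<open>The value of the quadratic form of \<open>K\<close> on the difference of the point
  masses at \<open>x\<close> and \<open>y\<close>, that is, a squared seminorm. All Lipschitz
  estimates below are Cauchy-Schwarz for this form.\<close>

definition kdist2 :: "('a \<Rightarrow> 'a \<Rightarrow> real) \<Rightarrow> 'a \<Rightarrow> 'a \<Rightarrow> real" where
  "kdist2 K x y = K x x - 2 * K x y + K y y"

lemma kform_Nil [simp]: "kform K [] ys = 0" "kform K xs [] = 0"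
  by (simp_all add: kform_def)

lemma kform_append_left: "kform K (xs @ xs') ys = kform K xs ys + kform K xs' ys"
  by (simp add: kform_def)

lemma kform_append_right: "kform K xs (ys @ ys') = kform K xs ys + kform K xs ys'"
  by (simp add: kform_def sum_list_addf)

lemma kform_Cons_left: "kform K (p # xs) ys = kform K [p] ys + kform K xs ys"
  by (simp add: kform_def)

lemma kform_Cons_right: "kform K xs (q # ys) = kform K xs [q] + kform K xs ys"
  by (simp add: kform_def sum_list_addf)

lemma kform_single [simp]: "kform K [(c, x)] [(d, y)] = c * d * K x y"
  by (simp add: kform_def)

lemma kform_scale_left: "kform K (map (map_prod ((*) t) id) xs) ys = t * kform K xs ys"
  by (simp add: kform_def comp_def sum_list_const_mult[symmetric] mult.assoc)

lemma kform_commute: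
  assumes "\<And>x y. x \<in> snd ` set xs \<Longrightarrow> y \<in> snd ` set ys \<Longrightarrow> K x y = K y x"
  shows "kform K xs ys = kform K ys xs"
  using assms
proof (induction xs)
  case (Cons p xs)
  have "kform K [p] ys = kform K ys [p]"
    using Cons.prems by (auto simp: kform_def mult.commute intro!: arg_cong[where f=sum_list])
  moreover have "kform K xs ys = kform K ys xs"
    using Cons by auto
  ultimately show ?case
    by (simp add: kform_Cons_left[of K p xs] kform_Cons_right[of K ys p xs])
qed simp

lemma kform_upt:
  "kform K (map (\<lambda>i. (c i, x i)) [0..<n]) (map (\<lambda>i. (d i, y i)) [0..<m]) =
     (\<Sum>i<n. \<Sum>j<m. c i * d j * K (x i) (y j))"
  by (simp add: kform_def comp_def interv_sum_list_conv_sum_set_nat atLeast0LessThan)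

lemma tendsto_sum_list:
  fixes f :: "'b \<Rightarrow> 'a \<Rightarrow> real"
  assumes "\<And>x. x \<in> set xs \<Longrightarrow> ((\<lambda>n. f n x) \<longlongrightarrow> g x) F"
  shows "((\<lambda>n. \<Sum>x\<leftarrow>xs. f n x) \<longlongrightarrow> (\<Sum>x\<leftarrow>xs. g x)) F"
  using assms by (induction xs) (auto intro!: tendsto_add)

lemma tendsto_kform:
  assumes "\<And>x y. x \<in> snd ` set xs \<Longrightarrow> y \<in> snd ` set ys \<Longrightarrow> ((\<lambda>n. K n x y) \<longlongrightarrow> R x y) F"
  shows "((\<lambda>n. kform (K n) xs ys) \<longlongrightarrow> kform R xs ys) F"
  unfolding kform_def
  by (intro tendsto_sum_list tendsto_mult tendsto_const assms) auto

lemma psd_onD_sym: "psd_on S K \<Longrightarrow> x \<in> S \<Longrightarrow> y \<in> S \<Longrightarrow> K x y = K y x"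
  by (auto simp: psd_on_def)

lemma psd_onD_nonneg: "psd_on S K \<Longrightarrow> snd ` set xs \<subseteq> S \<Longrightarrow> 0 \<le> kform K xs xs"
  by (auto simp: psd_on_def)

lemma psd_on_limit:
  assumes psd: "\<And>n. psd_on S (K n)"
    and lim: "\<And>x y. x \<in> S \<Longrightarrow> y \<in> S \<Longrightarrow> (\<lambda>n::nat. K n x y) \<longlonglongrightarrow> R x y"
  shows "psd_on S R"
  unfolding psd_on_def
proof (intro conjI ballI allI impI)
  fix x y assume "x \<in> S" "y \<in> S"
  then show "R x y = R y x"
    using LIMSEQ_unique[OF lim[of x y]] lim[of y x] psd_onD_sym[OF psd, of x y] by simp
next
  fix xs :: "(real \<times> 'a) list" assume "snd ` set xs \<subseteq> S"
  then have "(\<lambda>n. kform (K n) xs xs) \<longlonglongrightarrow> kform R xs xs"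
    by (intro tendsto_kform lim) auto
  moreover have "0 \<le> kform (K n) xs xs" for n
    using psd_onD_nonneg[OF psd] \<open>snd ` set xs \<subseteq> S\<close> .
  ultimately show "0 \<le> kform R xs xs"
    by (auto intro!: LIMSEQ_le_const)
qed

text \<open>The discriminant argument for the form on the formal sum of \<open>xs\<close> and
  \<open>t\<close> times \<open>ys\<close>, expanded by bilinearity.\<close>

lemma psd_on_Cauchy_Schwarz:
  assumes psd: "psd_on S K" and "snd ` set xs \<subseteq> S" "snd ` set ys \<subseteq> S"
  shows "(kform K xs ys)\<^sup>2 \<le> kform K xs xs * kform K ys ys"
proof (rule discriminant_nonpos)
  show "0 \<le> kform K ys ys"
    using assms by (intro psd_onD_nonneg)
  fix t
  let ?t = "map (map_prod ((*) t) id) ys"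
  have sym: "kform K us vs = kform K vs us"
    if "snd ` set us \<subseteq> S" "snd ` set vs \<subseteq> S" for us vs
    by (rule kform_commute) (use that psd_onD_sym[OF psd] in blast)
  have t: "snd ` set ?t \<subseteq> S"
    using assms by auto
  have "0 \<le> kform K (xs @ ?t) (xs @ ?t)"
    using assms t by (intro psd_onD_nonneg[OF psd]) (auto simp: image_Un)
  also have "\<dots> = kform K xs xs + 2 * t * kform K xs ys + t\<^sup>2 * kform K ys ys"
    using sym[OF assms(2,3)] sym[OF assms(2) t] sym[OF assms(3) t]
    by (simp add: kform_append_left kform_append_right kform_scale_left power2_eq_square)
  finally show "0 \<le> kform K xs xs + 2 * t * kform K xs ys + t\<^sup>2 * kform K ys ys" .
qed

lemma psd_on_diag_nonneg: "psd_on S K \<Longrightarrow> x \<in> S \<Longrightarrow> 0 \<le> K x x"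
  using psd_onD_nonneg[of S K "[(1, x)]"] by simp

lemma psd_on_square_le: "psd_on S K \<Longrightarrow> x \<in> S \<Longrightarrow> y \<in> S \<Longrightarrow> (K x y)\<^sup>2 \<le> K x x * K y y"
  using psd_on_Cauchy_Schwarz[of S K "[(1, x)]" "[(1, y)]"] by simp

lemma psd_on_abs_le:
  "psd_on S K \<Longrightarrow> x \<in> S \<Longrightarrow> y \<in> S \<Longrightarrow> \<bar>K x y\<bar> \<le> sqrt (K x x) * sqrt (K y y)"
  using real_sqrt_le_mono[OF psd_on_square_le, of S K x y] by (simp add: real_sqrt_mult)

lemma kform_kdist2:
  assumes "K x y = K y x"
  shows "kform K [(1, x), (-1, y)] [(1, x), (-1, y)] = kdist2 K x y"
  using assms by (simp add: kform_def kdist2_def)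

lemma kdist2_nonneg:
  assumes "psd_on S K" "x \<in> S" "y \<in> S"
  shows "0 \<le> kdist2 K x y"
  using psd_onD_nonneg[OF assms(1), of "[(1, x), (-1, y)]"] assms
  by (simp add: kform_kdist2[where K=K, OF psd_onD_sym[OF assms]])

text \<open>Cauchy-Schwarz between the difference of two point masses and a third point mass. It
  makes the sections of \<open>K\<close> Lipschitz for the pseudometric.\<close>

lemma psd_on_diff_le:
  assumes "psd_on S K" "x \<in> S" "y \<in> S" "z \<in> S"
  shows "\<bar>K x z - K y z\<bar> \<le> sqrt (kdist2 K x y) * sqrt (K z z)"
proof -
  have "(K x z - K y z)\<^sup>2 \<le> kdist2 K x y * K z z"
    using psd_on_Cauchy_Schwarz[OF assms(1), of "[(1, x), (-1, y)]" "[(1, z)]"] assms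
    by (simp add: kform_kdist2[where K=K, OF psd_onD_sym[OF assms(1-3)]]) (simp add: kform_def)
  from real_sqrt_le_mono[OF this] show ?thesis
    by (simp add: real_sqrt_mult)
qed

text \<open>The reverse triangle inequality for the seminorm of point masses. Through it a finite
  net controls the whole diagonal.\<close>

lemma psd_on_sqrt_diag_diff_le:
  assumes "psd_on S K" "x \<in> S" "y \<in> S"
  shows "\<bar>sqrt (K x x) - sqrt (K y y)\<bar> \<le> sqrt (kdist2 K x y)"
proof -
  have "(sqrt (K x x) - sqrt (K y y))\<^sup>2 = K x x - 2 * (sqrt (K x x) * sqrt (K y y)) + K y y"
    using psd_on_diag_nonneg[OF assms(1,2)] psd_on_diag_nonneg[OF assms(1,3)]
    by (simp add: power2_diff)
  also have "\<dots> \<le> kdist2 K x y"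
    using psd_on_abs_le[OF assms] by (simp add: kdist2_def)
  finally show ?thesis
    using real_sqrt_le_mono by fastforce
qed

section \<open>Integral operators of totally bounded kernels\<close>

lemma abs_integral_le:
  fixes f :: "'a \<Rightarrow> real"
  assumes "integrable M f" "integrable M g" "\<And>x. x \<in> space M \<Longrightarrow> \<bar>f x\<bar> \<le> g x"
  shows "\<bar>\<integral>x. f x \<partial>M\<bar> \<le> (\<integral>x. g x \<partial>M)"
  by (rule order_trans[OF integral_abs_bound integral_mono]) (use assms in auto)

lemma integrable_mult_bounded:
  fixes f u :: "'a \<Rightarrow> real"
  assumes f: "integrable M f" and u: "u \<in> borel_measurable M"
    and C: "\<And>x. x \<in> space M \<Longrightarrow> \<bar>u x\<bar> \<le> C"
  shows "integrable M (\<lambda>x. f x * u x)"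
proof (rule Bochner_Integration.integrable_bound)
  show "integrable M (\<lambda>x. C * f x)"
    using f by simp
  show "AE x in M. norm (f x * u x) \<le> norm (C * f x)"
  proof (rule AE_I2)
    fix x assume x: "x \<in> space M"
    have "\<bar>u x\<bar> * \<bar>f x\<bar> \<le> C * \<bar>f x\<bar>"
      by (rule mult_right_mono[OF C[OF x] abs_ge_zero])
    moreover have "0 \<le> C"
      using C[OF x] by linarith
    ultimately show "norm (f x * u x) \<le> norm (C * f x)"
      by (simp add: abs_mult mult.commute)
  qed
qed (use f u in measurable)

definition sqint :: "'a measure \<Rightarrow> ('a \<Rightarrow> real) set" where
  "sqint M = {f \<in> borel_measurable M. integrable M (\<lambda>x. (f x)\<^sup>2)}"

lemma sqint_measurable: "f \<in> sqint M \<Longrightarrow> f \<in> borel_measurable M"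
  and sqint_integrable_square: "f \<in> sqint M \<Longrightarrow> integrable M (\<lambda>x. (f x)\<^sup>2)"
  by (auto simp: sqint_def)

lemma sqint_integrable_mult:
  assumes "f \<in> sqint M" "g \<in> sqint M"
  shows "integrable M (\<lambda>x. f x * g x)"
proof (rule Bochner_Integration.integrable_bound)
  show "integrable M (\<lambda>x. (f x)\<^sup>2 + (g x)\<^sup>2)"
    using assms by (simp add: sqint_integrable_square)
  have "\<bar>a * b\<bar> \<le> a\<^sup>2 + b\<^sup>2" for a b :: real
    using sum_squares_bound[of "\<bar>a\<bar>" "\<bar>b\<bar>"] abs_ge_zero[of "a * b"] unfolding abs_mult power2_abs by linarith
  then show "AE x in M. norm (f x * g x) \<le> norm ((f x)\<^sup>2 + (g x)\<^sup>2)"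
    by simp
qed (use assms[THEN sqint_measurable] in measurable)

lemma sqint_add:
  assumes "f \<in> sqint M" "g \<in> sqint M"
  shows "(\<lambda>x. f x + g x) \<in> sqint M"
proof -
  have "(\<lambda>x. (f x + g x)\<^sup>2) = (\<lambda>x. (f x)\<^sup>2 + (g x)\<^sup>2 + 2 * (f x * g x))"
    by (simp add: power2_sum mult.assoc)
  then show ?thesis
    using assms sqint_integrable_mult[OF assms] by (auto simp: sqint_def)
qed

lemma sqint_cmult: "f \<in> sqint M \<Longrightarrow> (\<lambda>x. c * f x) \<in> sqint M"
  by (auto simp: sqint_def power_mult_distrib)

lemma sqint_zero: "(\<lambda>x. 0) \<in> sqint M"
  by (simp add: sqint_def)

lemma sqint_sum:
  "(\<And>i. i \<in> I \<Longrightarrow> f i \<in> sqint M) \<Longrightarrow> (\<lambda>x. \<Sum>i\<in>I. c i * f i x) \<in> sqint M"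
  by (induction I rule: infinite_finite_induct) (auto intro!: sqint_add sqint_cmult sqint_zero)

lemma sqint_Cauchy_Schwarz:
  assumes "f \<in> sqint M" "g \<in> sqint M"
  shows "(\<integral>x. f x * g x \<partial>M)\<^sup>2 \<le> (\<integral>x. (f x)\<^sup>2 \<partial>M) * (\<integral>x. (g x)\<^sup>2 \<partial>M)"
proof (rule discriminant_nonpos)
  fix t
  note int = sqint_integrable_mult[OF assms] assms[THEN sqint_integrable_square]
  have "(\<integral>x. (f x + t * g x)\<^sup>2 \<partial>M) =
      (\<integral>x. (f x)\<^sup>2 + 2 * t * (f x * g x) + t\<^sup>2 * (g x)\<^sup>2 \<partial>M)"
    by (simp add: power2_sum power_mult_distrib algebra_simps)
  also have "\<dots> = (\<integral>x. (f x)\<^sup>2 \<partial>M) + 2 * t * (\<integral>x. f x * g x \<partial>M) + t\<^sup>2 * (\<integral>x. (g x)\<^sup>2 \<partial>M)"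
    using int by simp
  finally have *: "(\<integral>x. (f x + t * g x)\<^sup>2 \<partial>M) = (\<integral>x. (f x)\<^sup>2 \<partial>M) + 2 * t * (\<integral>x. f x * g x \<partial>M) + t\<^sup>2 * (\<integral>x. (g x)\<^sup>2 \<partial>M)" .
  show "0 \<le> (\<integral>x. (f x)\<^sup>2 \<partial>M) + 2 * t * (\<integral>x. f x * g x \<partial>M) + t\<^sup>2 * (\<integral>x. (g x)\<^sup>2 \<partial>M)"
    unfolding *[symmetric] by (rule integral_nonneg_AE) simp
qed simp

lemma (in finite_measure) sqint_integrable:
  assumes "f \<in> sqint M"
  shows "integrable M f"
  using sqint_integrable_mult[OF assms, of "\<lambda>_. 1"] by (simp add: sqint_def)

text \<open>The crude bound \<open>\<bar>a\<bar> \<le> 1 + a^2\<close> suffices: the compactness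
  argument only needs that sets bounded in L^2 are bounded in L^1.\<close>

lemma (in finite_measure) sqint_L1_le:
  assumes "f \<in> sqint M"
  shows "(\<integral>x. \<bar>f x\<bar> \<partial>M) \<le> measure M (space M) + (\<integral>x. (f x)\<^sup>2 \<partial>M)"
proof -
  have *: "\<bar>a\<bar> \<le> 1 + a\<^sup>2" for a :: real
    using sum_squares_bound[of 1 "\<bar>a\<bar>"] abs_ge_zero[of a] unfolding power2_abs by simp
  have "(\<integral>x. \<bar>f x\<bar> \<partial>M) \<le> (\<integral>x. 1 + (f x)\<^sup>2 \<partial>M)"
    using sqint_integrable[OF assms] sqint_integrable_square[OF assms]
    by (intro integral_mono * ) auto
  also have "\<dots> = measure M (space M) + (\<integral>x. (f x)\<^sup>2 \<partial>M)"
    using sqint_integrable_square[OF assms] by simp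
  finally show ?thesis .
qed

lemma (in finite_measure) sqint_bounded:
  assumes "f \<in> borel_measurable M" and C: "\<And>x. x \<in> space M \<Longrightarrow> \<bar>f x\<bar> \<le> C"
  shows "f \<in> sqint M"
proof -
  have "integrable M (\<lambda>x. (f x)\<^sup>2)"
  proof (rule integrable_const_bound[where B="C\<^sup>2"])
    show "AE x in M. norm ((f x)\<^sup>2) \<le> C\<^sup>2"
      using C power_mono[of "\<bar>f _\<bar>" C 2] by (intro AE_I2) simp
  qed (use assms in measurable)
  then show ?thesis
    using assms by (simp add: sqint_def)
qed

text \<open>Total boundedness for \<open>kdist2\<close> stands in for a compact space and a
  continuous kernel. Measurability of the sections and of the diagonal makes every
  \<open>kdist2\<close> ball around a point measurable. All these properties pass to the limit of
  the remainders.\<close>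

locale mercer_kernel = finite_measure M for M :: "'a measure" +
  fixes K :: "'a \<Rightarrow> 'a \<Rightarrow> real"
  assumes psd: "psd_on (space M) K"
    and measurable_section: "y \<in> space M \<Longrightarrow> (\<lambda>x. K x y) \<in> borel_measurable M"
    and measurable_diag: "(\<lambda>x. K x x) \<in> borel_measurable M"
    and totally_bounded: "0 < \<epsilon> \<Longrightarrow>
      \<exists>F. finite F \<and> F \<subseteq> space M \<and> (\<forall>x\<in>space M. \<exists>y\<in>F. kdist2 K x y < \<epsilon>)"
begin

definition kop :: "('a \<Rightarrow> real) \<Rightarrow> 'a \<Rightarrow> real" where
  "kop f x = (\<integral>y. K x y * f y \<partial>M)"

lemma bounded_diag: "\<exists>C>0. \<forall>x\<in>space M. K x x \<le> C"
proof -
  obtain F where F: "finite F" "F \<subseteq> space M" "\<forall>x\<in>space M. \<exists>y\<in>F. kdist2 K x y < 1"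
    using totally_bounded[OF zero_less_one] by blast
  \<comment> \<open>The sum bounds the maximum over the net and makes sense for an empty net; the 1
    is the radius of the net and keeps \<open>B\<close> positive.\<close>
  define B where "B = (\<Sum>y\<in>F. sqrt (K y y)) + 1"
  have nonneg: "0 \<le> (\<Sum>y\<in>F. sqrt (K y y))"
    using F(2) by (intro sum_nonneg real_sqrt_ge_zero psd_on_diag_nonneg[OF psd]) blast
  have "K x x \<le> B\<^sup>2" if x: "x \<in> space M" for x
  proof -
    obtain y where y: "y \<in> F" "kdist2 K x y < 1"
      using F(3) x by blast
    have "sqrt (K x x) \<le> sqrt (K y y) + sqrt (kdist2 K x y)"
      using psd_on_sqrt_diag_diff_le[OF psd x subsetD[OF F(2) y(1)]] by linarith
    also have "\<dots> \<le> sqrt (K y y) + 1"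
      using y by simp
    also have "\<dots> \<le> B"
      unfolding B_def
      using F(2)
      by (intro add_right_mono member_le_sum y(1) F(1) real_sqrt_ge_zero psd_on_diag_nonneg[OF psd]) blast
    finally have "sqrt (K x x) \<le> B" .
    then have "(sqrt (K x x))\<^sup>2 \<le> B\<^sup>2"
      by (rule power_mono) (rule real_sqrt_ge_zero[OF psd_on_diag_nonneg[OF psd x]])
    then show ?thesis
      by (simp only: real_sqrt_pow2[OF psd_on_diag_nonneg[OF psd x]])
  qed
  moreover have "0 < B\<^sup>2"
    using nonneg unfolding B_def by (intro zero_less_power) linarith
  ultimately show ?thesis
    by (intro exI[of _ "B\<^sup>2"]) simp
qed

text \<open>Positivity is required so that its root can stand in denominators even when the diagonal
  vanishes.\<close>

definition kbound :: real where
  "kbound = (SOME C. 0 < C \<and> (\<forall>x\<in>space M. K x x \<le> C))"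

lemma kbound_pos: "0 < kbound" and diag_le_kbound: "x \<in> space M \<Longrightarrow> K x x \<le> kbound"
  using someI_ex[OF bounded_diag, folded kbound_def] by simp_all

lemma sqrt_diag_le: "x \<in> space M \<Longrightarrow> sqrt (K x x) \<le> sqrt kbound"
  by (simp add: diag_le_kbound)

lemma abs_le_kbound:
  assumes "x \<in> space M" "y \<in> space M"
  shows "\<bar>K x y\<bar> \<le> kbound"
proof -
  have "\<bar>K x y\<bar> \<le> sqrt (K x x) * sqrt (K y y)"
    by (rule psd_on_abs_le[OF psd assms])
  also have "\<dots> \<le> sqrt kbound * sqrt kbound"
    using assms kbound_pos psd_on_diag_nonneg[OF psd] by (intro mult_mono sqrt_diag_le) auto
  finally show ?thesis
    using kbound_pos by simp
qed

lemma section_diff_le: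
  assumes "x \<in> space M" "y \<in> space M" "z \<in> space M"
  shows "\<bar>K x z - K y z\<bar> \<le> sqrt (kdist2 K x y) * sqrt kbound"
proof -
  have "sqrt (kdist2 K x y) * sqrt (K z z) \<le> sqrt (kdist2 K x y) * sqrt kbound"
    using assms kdist2_nonneg[OF psd] by (intro mult_left_mono sqrt_diag_le) auto
  then show ?thesis
    using psd_on_diff_le[OF psd assms] by linarith
qed

lemma measurable_section' [measurable]:
  assumes "x \<in> space M"
  shows "K x \<in> borel_measurable M"
  using measurable_section[OF assms] psd_onD_sym[OF psd assms]
  by (subst measurable_cong[of M _ "\<lambda>y. K y x"]) auto

lemma integrable_section_mult:
  assumes "integrable M f" "x \<in> space M"
  shows "integrable M (\<lambda>y. K x y * f y)"
proof (rule Bochner_Integration.integrable_bound)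
  show "integrable M (\<lambda>y. kbound * f y)"
    using assms by simp
  show "(\<lambda>y. K x y * f y) \<in> borel_measurable M"
    using assms by measurable
  show "AE y in M. norm (K x y * f y) \<le> norm (kbound * f y)"
    using assms(2) kbound_pos by (intro AE_I2) (simp add: abs_mult mult_right_mono abs_le_kbound)
qed

text \<open>Images of an L^1-bounded family are Lipschitz for the pseudometric with a common
  constant. This is the equicontinuity behind the compactness of the operator.\<close>

lemma kop_diff_le:
  assumes "integrable M f" "x \<in> space M" "y \<in> space M"
  shows "\<bar>kop f x - kop f y\<bar> \<le> sqrt (kdist2 K x y) * sqrt kbound * (\<integral>z. \<bar>f z\<bar> \<partial>M)"
proof -
  have "\<bar>kop f x - kop f y\<bar> = \<bar>\<integral>z. (K x z - K y z) * f z \<partial>M\<bar>"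
    unfolding kop_def left_diff_distrib
    by (simp add: Bochner_Integration.integral_diff integrable_section_mult assms)
  also have "\<dots> \<le> (\<integral>z. sqrt (kdist2 K x y) * sqrt kbound * \<bar>f z\<bar> \<partial>M)"
  proof (rule abs_integral_le)
    show "integrable M (\<lambda>z. (K x z - K y z) * f z)"
      unfolding left_diff_distrib
      by (intro Bochner_Integration.integrable_diff integrable_section_mult assms)
    show "integrable M (\<lambda>z. sqrt (kdist2 K x y) * sqrt kbound * \<bar>f z\<bar>)"
      using assms by simp
    show "\<bar>(K x z - K y z) * f z\<bar> \<le> sqrt (kdist2 K x y) * sqrt kbound * \<bar>f z\<bar>"
      if "z \<in> space M" for z
      unfolding abs_mult by (rule mult_right_mono[OF section_diff_le[OF assms(2,3) that] abs_ge_zero])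
  qed
  finally show ?thesis
    by simp
qed

lemma abs_kop_le:
  assumes "integrable M f" "x \<in> space M"
  shows "\<bar>kop f x\<bar> \<le> kbound * (\<integral>z. \<bar>f z\<bar> \<partial>M)"
proof -
  have "\<bar>kop f x\<bar> \<le> (\<integral>z. kbound * \<bar>f z\<bar> \<partial>M)"
    unfolding kop_def
  proof (rule abs_integral_le)
    show "\<bar>K x z * f z\<bar> \<le> kbound * \<bar>f z\<bar>" if "z \<in> space M" for z
      unfolding abs_mult by (rule mult_right_mono[OF abs_le_kbound[OF assms(2) that] abs_ge_zero])
  qed (use assms integrable_section_mult[OF assms] in simp_all)
  then show ?thesis
    by simp
qed

section \<open>Discretization of integrals against the kernel\<close>

lemma partition:
  assumes "0 < \<epsilon>"
  obtains idx :: "'a \<Rightarrow> nat" and n :: nat and p :: "nat \<Rightarrow> 'a"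
  where "idx \<in> measurable M (count_space UNIV)"
    and "\<forall>i<n. p i \<in> space M"
    and "\<forall>x\<in>space M. idx x < n \<and> kdist2 K x (p (idx x)) < \<epsilon>"
proof -
  obtain F where F: "finite F" "F \<subseteq> space M" "\<forall>x\<in>space M. \<exists>y\<in>F. kdist2 K x y < \<epsilon>"
    using totally_bounded[OF assms] by blast
  obtain n :: nat and p where p: "F = p ` {i. i < n}"
    using finite_imp_nat_seg_image_inj_on[OF F(1)] by blast
  \<comment> \<open>Taking the first net point within the radius makes the overlapping balls
    disjoint; the cells are measurable because the balls are.\<close>
  define idx where "idx x = (LEAST i. i < n \<and> kdist2 K x (p i) < \<epsilon>)" for x
  have "Measurable.pred M (\<lambda>x. i < n \<and> kdist2 K x (p i) < \<epsilon>)" for i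
  proof (cases "i < n")
    case True
    then have "p i \<in> space M"
      using F p by blast
    note [measurable] = measurable_section[OF this] measurable_diag
    show ?thesis
      unfolding kdist2_def by measurable
  qed simp
  then have 1: "idx \<in> measurable M (count_space UNIV)"
    unfolding idx_def by measurable
  have 2: "idx x < n \<and> kdist2 K x (p (idx x)) < \<epsilon>" if "x \<in> space M" for x
  proof -
    have "\<exists>i. i < n \<and> kdist2 K x (p i) < \<epsilon>"
      using F(3) that p by auto
    then show ?thesis
      unfolding idx_def by (rule LeastI_ex)
  qed
  show ?thesis
    by (rule that[of idx n p, OF 1]) (use 2 F(2) p in auto)
qed

text \<open>
  A finite partition into sets of small diameter replaces \<open>f dM\<close> by a finite combination of point
  masses, uniformly well for the kernel.
\<close>

lemma discretization_step:
  assumes "0 < \<delta>"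
  shows "\<exists>L :: ('a \<Rightarrow> real) \<Rightarrow> (real \<times> 'a) list. (\<forall>f. snd ` set (L f) \<subseteq> space M) \<and>
    (\<forall>f z. integrable M f \<and> z \<in> space M \<longrightarrow>
      \<bar>kop f z - kform K [(1, z)] (L f)\<bar> \<le> \<delta> * (\<integral>x. \<bar>f x\<bar> \<partial>M)) \<and>
    (\<forall>f g. integrable M f \<and> integrable M g \<and> kop g \<in> borel_measurable M \<longrightarrow>
      \<bar>(\<integral>x. f x * kop g x \<partial>M) - kform K (L f) (L g)\<bar>
        \<le> \<delta> * (\<integral>x. \<bar>f x\<bar> \<partial>M) * (\<integral>x. \<bar>g x\<bar> \<partial>M))"
proof -
  \<comment> \<open>Moving one argument of \<open>K\<close> to the centre of its cell then costs at
    most \<open>\<delta> / 2\<close>. The double integral needs two such moves, one per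
    argument.\<close>
  define \<epsilon> where "\<epsilon> = (\<delta> / (2 * sqrt kbound))\<^sup>2"
  have "0 < \<epsilon>"
    using assms kbound_pos by (simp add: \<epsilon>_def)
  have sqrt_\<epsilon>: "sqrt \<epsilon> * sqrt kbound = \<delta> / 2"
    using assms kbound_pos by (simp add: \<epsilon>_def real_sqrt_abs)
  obtain idx :: "'a \<Rightarrow> nat" and n p where idx [measurable]: "idx \<in> measurable M (count_space UNIV)"
    and part: "\<forall>i<n. p i \<in> space M"
      "\<forall>x\<in>space M. idx x < n \<and> kdist2 K x (p (idx x)) < \<epsilon>"
    by (rule partition[OF \<open>0 < \<epsilon>\<close>])
  have p: "p i \<in> space M" if "i < n" for i
    using part that by blast
  have idx_less: "idx x < n" and close: "kdist2 K x (p (idx x)) < \<epsilon>" if "x \<in> space M" for x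
    using part that by blast+
  \<comment> \<open>\<open>W f i\<close> is the mass of \<open>f dM\<close> on the cell with number
    \<open>i\<close>; \<open>L f\<close> concentrates it at the centre \<open>p i\<close>.\<close>
  define W where "W f i = (\<integral>x. indicator {i} (idx x) * f x \<partial>M)" for f :: "'a \<Rightarrow> real" and i
  define L where "L f = map (\<lambda>i. (W f i, p i)) [0..<n]" for f
  have p_idx: "p (idx x) \<in> space M" if "x \<in> space M" for x
    using p idx_less that by auto
  have int_idx: "integrable M (\<lambda>x. indicator {i} (idx x) * f x)" if "integrable M f" for f :: "'a \<Rightarrow> real" and i
    by (rule Bochner_Integration.integrable_bound[OF that])
      (use that in \<open>auto simp: indicator_def\<close>)
  have idx_sum: "a (idx x) * f x = (\<Sum>i<n. a i * (indicator {i} (idx x) * f x))"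
    if "x \<in> space M" for a f :: "_ \<Rightarrow> real" and x
  proof -
    have "(\<Sum>i<n. a i * (indicator {i} (idx x) * f x)) = (\<Sum>i<n. if idx x = i then a i * f x else 0)"
      by (intro sum.cong) (auto simp: indicator_def)
    then show ?thesis
      using idx_less[OF that] by simp
  qed
  have int_a: "integrable M (\<lambda>x. a (idx x) * f x)" if "integrable M f" for f :: "'a \<Rightarrow> real" and a
    using int_idx[OF that]
    by (subst Bochner_Integration.integrable_cong[OF refl idx_sum]) auto
  have integral_idx: "(\<integral>x. a (idx x) * f x \<partial>M) = (\<Sum>i<n. a i * W f i)"
    if "integrable M f" for f :: "'a \<Rightarrow> real" and a
    unfolding W_def using int_idx[OF that]
    by (subst Bochner_Integration.integral_cong[OF refl idx_sum]) auto
  have diff: "\<bar>K x z - K (p (idx x)) z\<bar> \<le> \<delta> / 2" if "x \<in> space M" "z \<in> space M" for x z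
  proof -
    have "\<bar>K x z - K (p (idx x)) z\<bar> \<le> sqrt (kdist2 K x (p (idx x))) * sqrt kbound"
      by (rule section_diff_le[OF that(1) p_idx[OF that(1)] that(2)])
    also have "\<dots> \<le> sqrt \<epsilon> * sqrt kbound"
      using close[OF that(1)] kbound_pos by (intro mult_right_mono) auto
    finally show ?thesis
      using sqrt_\<epsilon> by simp
  qed
  have kform_L1: "kform K [(1, z)] (L f) = (\<Sum>i<n. K z (p i) * W f i)" for f z
    by (simp add: L_def kform_def comp_def interv_sum_list_conv_sum_set_nat atLeast0LessThan mult.commute)
  have kop1: "\<bar>kop f z - (\<Sum>i<n. K z (p i) * W f i)\<bar> \<le> \<delta> / 2 * (\<integral>x. \<bar>f x\<bar> \<partial>M)"
    if f: "integrable M f" and z: "z \<in> space M" for f z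
  proof -
    have "kop f z - (\<Sum>i<n. K z (p i) * W f i) = (\<integral>x. (K z x - K z (p (idx x))) * f x \<partial>M)"
      unfolding kop_def integral_idx[OF f, symmetric]
      using integrable_section_mult[OF f z] int_a[OF f, of "\<lambda>i. K z (p i)"]
      by (subst Bochner_Integration.integral_diff[symmetric]) (auto simp: left_diff_distrib)
    also have "\<bar>\<dots>\<bar> \<le> (\<integral>x. \<delta> / 2 * \<bar>f x\<bar> \<partial>M)"
    proof (rule abs_integral_le)
      show "integrable M (\<lambda>x. (K z x - K z (p (idx x))) * f x)"
        using integrable_section_mult[OF f z] int_a[OF f, of "\<lambda>i. K z (p i)"] by (simp add: left_diff_distrib)
      fix x assume x: "x \<in> space M"
      have "\<bar>K z x - K z (p (idx x))\<bar> \<le> \<delta> / 2"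
        using diff[OF x z] psd_onD_sym[OF psd z x] psd_onD_sym[OF psd z p_idx[OF x]] by simp
      then show "\<bar>(K z x - K z (p (idx x))) * f x\<bar> \<le> \<delta> / 2 * \<bar>f x\<bar>"
        by (simp only: abs_mult) (rule mult_right_mono, auto)
    qed (use f in auto)
    finally show ?thesis
      by simp
  qed
  show ?thesis
  proof (intro exI[of _ L] conjI allI impI)
    show "snd ` set (L f) \<subseteq> space M" for f
      using p by (auto simp: L_def)
  next
    fix f :: "'a \<Rightarrow> real" and z assume "integrable M f \<and> z \<in> space M"
    moreover have "0 \<le> (\<integral>x. \<bar>f x\<bar> \<partial>M)"
      by simp
    then have "\<delta> / 2 * (\<integral>x. \<bar>f x\<bar> \<partial>M) \<le> \<delta> * (\<integral>x. \<bar>f x\<bar> \<partial>M)"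
      using assms by (intro mult_right_mono) auto
    ultimately show "\<bar>kop f z - kform K [(1, z)] (L f)\<bar> \<le> \<delta> * (\<integral>x. \<bar>f x\<bar> \<partial>M)"
      using kop1[of f z] unfolding kform_L1 by linarith
  next
    fix f g :: "'a \<Rightarrow> real" assume "integrable M f \<and> integrable M g \<and> kop g \<in> borel_measurable M"
    then have f: "integrable M f" and g: "integrable M g" and [measurable]: "kop g \<in> borel_measurable M"
      by auto
    define a where "a i = (\<Sum>j<n. K (p i) (p j) * W g j)" for i
    let ?G = "\<integral>x. \<bar>g x\<bar> \<partial>M"
    have bound: "\<bar>kop g x - a (idx x)\<bar> \<le> \<delta> * ?G" if x: "x \<in> space M" for x
    proof -
      have "\<bar>kop g x - kop g (p (idx x))\<bar> \<le> sqrt (kdist2 K x (p (idx x))) * sqrt kbound * ?G"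
        by (rule kop_diff_le[OF g x p_idx[OF x]])
      also have "\<dots> \<le> sqrt \<epsilon> * sqrt kbound * ?G"
        using close[OF x] kbound_pos by (intro mult_right_mono) auto
      also have "\<dots> = \<delta> / 2 * ?G"
        by (simp only: sqrt_\<epsilon>)
      finally show ?thesis
        using kop1[OF g p_idx[OF x]] unfolding a_def by linarith
    qed
    have int: "integrable M (\<lambda>x. f x * kop g x)"
      by (rule integrable_mult_bounded[OF f _ abs_kop_le[OF g]]) measurable
    have "(\<integral>x. f x * kop g x \<partial>M) - kform K (L f) (L g) =
        (\<integral>x. f x * kop g x \<partial>M) - (\<integral>x. a (idx x) * f x \<partial>M)"
      unfolding integral_idx[OF f] unfolding L_def kform_upt a_def
      by (simp add: sum_distrib_left sum_distrib_right mult_ac)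
    also have "\<dots> = (\<integral>x. (kop g x - a (idx x)) * f x \<partial>M)"
      using int int_a[OF f, of a]
      by (simp add: right_diff_distrib mult.commute[of _ "f _"])
    also have "\<bar>\<dots>\<bar> \<le> (\<integral>x. \<delta> * ?G * \<bar>f x\<bar> \<partial>M)"
    proof (rule abs_integral_le)
      show "integrable M (\<lambda>x. (kop g x - a (idx x)) * f x)"
        using int int_a[OF f, of a] by (simp add: right_diff_distrib mult.commute[of _ "f _"])
      show "\<bar>(kop g x - a (idx x)) * f x\<bar> \<le> \<delta> * ?G * \<bar>f x\<bar>" if "x \<in> space M" for x
        using bound[OF that] by (simp only: abs_mult) (rule mult_right_mono, auto)
    qed (use f in auto)
    finally show "\<bar>(\<integral>x. f x * kop g x \<partial>M) - kform K (L f) (L g)\<bar>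
        \<le> \<delta> * (\<integral>x. \<bar>f x\<bar> \<partial>M) * ?G"
      by (simp add: mult_ac)
  qed
qed

text \<open>The sequence \<open>L\<close> does not depend on the functions, so identities and
  inequalities between forms in several functions pass to the limit along one and the same
  sequence.\<close>

lemma discretization:
  obtains L :: "nat \<Rightarrow> ('a \<Rightarrow> real) \<Rightarrow> (real \<times> 'a) list"
  where "\<And>m f. snd ` set (L m f) \<subseteq> space M"
    and "\<And>f z. integrable M f \<Longrightarrow> z \<in> space M \<Longrightarrow> (\<lambda>m. kform K [(1, z)] (L m f)) \<longlonglongrightarrow> kop f z"
    and "\<And>f g. integrable M f \<Longrightarrow> integrable M g \<Longrightarrow> kop g \<in> borel_measurable M \<Longrightarrow>
      (\<lambda>m. kform K (L m f) (L m g)) \<longlonglongrightarrow> (\<integral>x. f x * kop g x \<partial>M)"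
proof -
  define P where "P m L \<longleftrightarrow> (\<forall>f. snd ` set (L f) \<subseteq> space M) \<and>
    (\<forall>f z. integrable M f \<and> z \<in> space M \<longrightarrow>
      \<bar>kop f z - kform K [(1, z)] (L f)\<bar> \<le> inverse (real (Suc m)) * (\<integral>x. \<bar>f x\<bar> \<partial>M)) \<and>
    (\<forall>f g. integrable M f \<and> integrable M g \<and> kop g \<in> borel_measurable M \<longrightarrow>
      \<bar>(\<integral>x. f x * kop g x \<partial>M) - kform K (L f) (L g)\<bar>
        \<le> inverse (real (Suc m)) * (\<integral>x. \<bar>f x\<bar> \<partial>M) * (\<integral>x. \<bar>g x\<bar> \<partial>M))"
    for m :: nat and L :: "('a \<Rightarrow> real) \<Rightarrow> (real \<times> 'a) list"
  have "\<forall>m. \<exists>L. P m L"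
    unfolding P_def by (intro allI discretization_step) simp
  then obtain L where "\<forall>m. P m (L m)"
    by (blast dest: choice)
  note L = this[unfolded P_def, THEN spec]
  have lim: "a \<longlonglongrightarrow> l" if "\<And>m. \<bar>l - a m\<bar> \<le> inverse (real (Suc m)) * C" for a :: "nat \<Rightarrow> real" and l C
  proof -
    have "(\<lambda>m. inverse (real (Suc m)) * C) \<longlonglongrightarrow> 0"
      using tendsto_mult_right[OF LIMSEQ_inverse_real_of_nat, of C] by simp
    then have "(\<lambda>m. a m - l) \<longlonglongrightarrow> 0"
      by (rule Lim_null_comparison[rotated]) (use that in \<open>auto simp: abs_minus_commute\<close>)
    then show ?thesis
      by (simp add: LIM_zero_iff)
  qed
  show ?thesis
  proof (rule that[of L])
    show "(\<lambda>m. kform K [(1, z)] (L m f)) \<longlonglongrightarrow> kop f z"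
      if "integrable M f" "z \<in> space M" for f z
      using L[THEN conjunct2, THEN conjunct1] that by (intro lim[where C="\<integral>x. \<bar>f x\<bar> \<partial>M"]) blast
    show "(\<lambda>m. kform K (L m f) (L m g)) \<longlonglongrightarrow> (\<integral>x. f x * kop g x \<partial>M)"
      if "integrable M f" "integrable M g" "kop g \<in> borel_measurable M" for f g
      using L[THEN conjunct2, THEN conjunct2] that
      by (intro lim[where C="(\<integral>x. \<bar>f x\<bar> \<partial>M) * (\<integral>x. \<bar>g x\<bar> \<partial>M)"]) (simp add: mult.assoc)
  qed (use L[THEN conjunct1] in blast)
qed

text \<open>Measurability of a parameter integral would normally come from joint measurability of
  the kernel. Here the discretization exhibits \<open>kop f\<close> as a pointwise limit of finite
  combinations of sections. Afterwards the discretization of the double integral holds for all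
  integrable functions.\<close>

lemma kop_measurable:
  assumes "integrable M f"
  shows "kop f \<in> borel_measurable M"
proof -
  obtain L where L: "\<And>m f. snd ` set (L m f) \<subseteq> space M"
    and lim: "\<And>f z. integrable M f \<Longrightarrow> z \<in> space M \<Longrightarrow>
      (\<lambda>m::nat. kform K [(1, z)] (L m f)) \<longlonglongrightarrow> kop f z"
    by (rule discretization) blast
  show ?thesis
  proof (rule borel_measurable_LIMSEQ_real)
    show "(\<lambda>m. kform K [(1, z)] (L m f)) \<longlonglongrightarrow> kop f z" if "z \<in> space M" for z
      by (rule lim[OF assms that])
    have "(\<lambda>z. kform K [(1, z)] ys) \<in> borel_measurable M" if "snd ` set ys \<subseteq> space M" for ys
      using that
    proof (induction ys)
      case (Cons q ys)
      then show ?case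
        by (auto simp: kform_Cons_right[of K _ q] kform_def
            intro!: borel_measurable_add borel_measurable_times measurable_section)
    qed simp
    then show "(\<lambda>z. kform K [(1, z)] (L m f)) \<in> borel_measurable M" for m
      using L by blast
  qed
qed

lemma integrable_mult_kop:
  "integrable M f \<Longrightarrow> integrable M g \<Longrightarrow> integrable M (\<lambda>x. f x * kop g x)"
  by (rule integrable_mult_bounded[OF _ kop_measurable abs_kop_le])

lemma sqint_kop: "integrable M f \<Longrightarrow> kop f \<in> sqint M"
  by (rule sqint_bounded[OF kop_measurable abs_kop_le])

definition kop_form :: "('a \<Rightarrow> real) \<Rightarrow> ('a \<Rightarrow> real) \<Rightarrow> real" where
  "kop_form f g = (\<integral>x. f x * kop g x \<partial>M)"

lemma discretization_full:
  obtains L :: "nat \<Rightarrow> ('a \<Rightarrow> real) \<Rightarrow> (real \<times> 'a) list"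
  where "\<forall>m f. snd ` set (L m f) \<subseteq> space M"
    and "\<forall>f xs. integrable M f \<longrightarrow> snd ` set xs \<subseteq> space M \<longrightarrow>
      (\<lambda>m. kform K xs (L m f)) \<longlonglongrightarrow> (\<Sum>q\<leftarrow>xs. fst q * kop f (snd q))"
    and "\<forall>f g. integrable M f \<longrightarrow> integrable M g \<longrightarrow>
      (\<lambda>m. kform K (L m f) (L m g)) \<longlonglongrightarrow> kop_form f g"
proof -
  obtain L where L: "\<And>m f. snd ` set (L m f) \<subseteq> space M"
    and lim: "\<And>f z. integrable M f \<Longrightarrow> z \<in> space M \<Longrightarrow>
      (\<lambda>m::nat. kform K [(1, z)] (L m f)) \<longlonglongrightarrow> kop f z"
    and lim2: "\<And>f g. integrable M f \<Longrightarrow> integrable M g \<Longrightarrow> kop g \<in> borel_measurable M \<Longrightarrow>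
      (\<lambda>m. kform K (L m f) (L m g)) \<longlonglongrightarrow> (\<integral>x. f x * kop g x \<partial>M)"
    by (rule discretization) blast
  have *: "(\<lambda>m. kform K xs (L m f)) = (\<lambda>m. \<Sum>q\<leftarrow>xs. fst q * kform K [(1, snd q)] (L m f))" for xs f
    by (simp add: kform_def sum_list_const_mult[symmetric] mult.assoc)
  have "(\<lambda>m. kform K xs (L m f)) \<longlonglongrightarrow> (\<Sum>q\<leftarrow>xs. fst q * kop f (snd q))"
    if "integrable M f" "snd ` set xs \<subseteq> space M" for f xs
    using that unfolding * by (intro tendsto_sum_list tendsto_mult tendsto_const lim) auto
  then show ?thesis
    using L lim2[OF _ _ kop_measurable, folded kop_form_def] by (intro that[of L]) simp_all
qed

text \<open>An exchange of the order of integration, obtained from the symmetry of the finite forms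
  instead of Fubini's theorem.\<close>

lemma kop_form_commute:
  assumes "integrable M f" "integrable M g"
  shows "kop_form f g = kop_form g f"
proof (rule discretization_full)
  fix L :: "nat \<Rightarrow> ('a \<Rightarrow> real) \<Rightarrow> (real \<times> 'a) list"
  assume L: "\<forall>m f. snd ` set (L m f) \<subseteq> space M"
    and lim: "\<forall>f g. integrable M f \<longrightarrow> integrable M g \<longrightarrow>
      (\<lambda>m. kform K (L m f) (L m g)) \<longlonglongrightarrow> kop_form f g"
  have "kform K (L m f) (L m g) = kform K (L m g) (L m f)" for m
    by (rule kform_commute, rule psd_onD_sym[OF psd]) (use L in blast)+
  then have "(\<lambda>m. kform K (L m f) (L m g)) \<longlonglongrightarrow> kop_form g f"
    using lim assms by simp
  moreover have "(\<lambda>m. kform K (L m f) (L m g)) \<longlonglongrightarrow> kop_form f g"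
    using lim assms by blast
  ultimately show ?thesis
    by (intro LIMSEQ_unique)
qed

lemma kop_form_Cauchy_Schwarz:
  assumes "integrable M f" "integrable M g"
  shows "(kop_form f g)\<^sup>2 \<le> kop_form f f * kop_form g g"
proof (rule discretization_full)
  fix L :: "nat \<Rightarrow> ('a \<Rightarrow> real) \<Rightarrow> (real \<times> 'a) list"
  assume L: "\<forall>m f. snd ` set (L m f) \<subseteq> space M"
    and lim: "\<forall>f g. integrable M f \<longrightarrow> integrable M g \<longrightarrow>
      (\<lambda>m. kform K (L m f) (L m g)) \<longlonglongrightarrow> kop_form f g"
  show ?thesis
  proof (rule LIMSEQ_le)
    show "(\<lambda>m. (kform K (L m f) (L m g))\<^sup>2) \<longlonglongrightarrow> (kop_form f g)\<^sup>2"
      using lim assms by (intro tendsto_power) blast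
    show "(\<lambda>m. kform K (L m f) (L m f) * kform K (L m g) (L m g)) \<longlonglongrightarrow> kop_form f f * kop_form g g"
      using lim assms by (intro tendsto_mult) blast+
    show "\<exists>N. \<forall>n\<ge>N. (kform K (L n f) (L n g))\<^sup>2 \<le> kform K (L n f) (L n f) * kform K (L n g) (L n g)"
      using L by (intro exI allI impI psd_on_Cauchy_Schwarz[OF psd]) blast+
  qed
qed

text \<open>Positivity on the sum of a combination of point masses and a density
  \<open>f dM\<close>: the value is the limit of the forms of \<open>xs @ L m f\<close>. A suitable
  density yields the positivity of the remainders of the expansion, and a single point mass yields
  pointwise bounds for \<open>kop\<close>.\<close>

lemma kform_kop_form_nonneg:
  assumes "integrable M f" "snd ` set xs \<subseteq> space M"
  shows "0 \<le> kform K xs xs + 2 * (\<Sum>q\<leftarrow>xs. fst q * kop f (snd q)) + kop_form f f"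
proof (rule discretization_full)
  fix L :: "nat \<Rightarrow> ('a \<Rightarrow> real) \<Rightarrow> (real \<times> 'a) list"
  assume L: "\<forall>m f. snd ` set (L m f) \<subseteq> space M"
    and lim1: "\<forall>f xs. integrable M f \<longrightarrow> snd ` set xs \<subseteq> space M \<longrightarrow>
      (\<lambda>m. kform K xs (L m f)) \<longlonglongrightarrow> (\<Sum>q\<leftarrow>xs. fst q * kop f (snd q))"
    and lim2: "\<forall>f g. integrable M f \<longrightarrow> integrable M g \<longrightarrow>
      (\<lambda>m. kform K (L m f) (L m g)) \<longlonglongrightarrow> kop_form f g"
  have sym: "kform K (L m f) xs = kform K xs (L m f)" for m
    by (rule kform_commute, rule psd_onD_sym[OF psd]) (use L assms in blast)+
  have "(\<lambda>m. kform K xs xs + 2 * kform K xs (L m f) + kform K (L m f) (L m f)) \<longlonglongrightarrow>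
      kform K xs xs + 2 * (\<Sum>q\<leftarrow>xs. fst q * kop f (snd q)) + kop_form f f"
    using lim1 lim2 assms by (intro tendsto_add tendsto_const tendsto_mult) blast+
  moreover have "0 \<le> kform K xs xs + 2 * kform K xs (L m f) + kform K (L m f) (L m f)" for m
  proof -
    have "snd ` set (xs @ L m f) \<subseteq> space M"
      using L assms by (simp add: image_Un)
    from psd_onD_nonneg[OF psd this] show ?thesis
      by (simp add: kform_append_left kform_append_right sym)
  qed
  ultimately show ?thesis
    by (intro LIMSEQ_le_const) blast+
qed

lemma kop_form_nonneg: "integrable M f \<Longrightarrow> 0 \<le> kop_form f f"
  using kform_kop_form_nonneg[of f "[]"] by simp

text \<open>Cauchy-Schwarz between a point mass and a density. It turns smallness of the quadratic
  form into smallness at every point, not just almost everywhere.\<close>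

lemma kop_square_le:
  assumes "integrable M f" "z \<in> space M"
  shows "(kop f z)\<^sup>2 \<le> K z z * kop_form f f"
proof (subst mult.commute, rule discriminant_nonpos)
  show "0 \<le> kop_form f f + 2 * t * kop f z + t\<^sup>2 * K z z" for t
    using kform_kop_form_nonneg[of f "[(t, z)]"] assms by (simp add: power2_eq_square ac_simps)
qed (rule psd_on_diag_nonneg[OF psd assms(2)])

section \<open>Compactness and existence of eigenfunctions\<close>

lemma kop_lincomb:
  assumes "integrable M f" "integrable M g" "z \<in> space M"
  shows "kop (\<lambda>x. a * f x + b * g x) z = a * kop f z + b * kop g z"
proof -
  have "kop (\<lambda>x. a * f x + b * g x) z = (\<integral>x. a * (K z x * f x) + b * (K z x * g x) \<partial>M)"
    by (simp add: kop_def distrib_left mult_ac)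
  then show ?thesis
    using integrable_section_mult[OF assms(1,3)] integrable_section_mult[OF assms(2,3)]
    by (simp add: kop_def)
qed

text \<open>The argument of Arzela and Ascoli. A diagonal subsequence converges on the countable
  union of finite nets of arbitrarily small radius, and the common Lipschitz bound extends the
  convergence uniformly to the whole space.\<close>

lemma kop_convergent_subsequence:
  assumes f: "\<And>n::nat. integrable M (f n)" and B: "\<And>n. (\<integral>x. \<bar>f n x\<bar> \<partial>M) \<le> B"
  obtains r g where "strict_mono r" "uniform_limit (space M) (\<lambda>n. kop (f (r n))) g sequentially"
proof -
  have "0 \<le> B"
    by (rule order_trans[OF _ B[of 0]]) simp
  define F where "F p = (SOME F. finite F \<and> F \<subseteq> space M \<and>
      (\<forall>x\<in>space M. \<exists>y\<in>F. kdist2 K x y < inverse (real (Suc p))))" for p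
  have F: "finite (F p) \<and> F p \<subseteq> space M \<and>
      (\<forall>x\<in>space M. \<exists>y\<in>F p. kdist2 K x y < inverse (real (Suc p)))" for p
    unfolding F_def by (rule someI_ex[OF totally_bounded]) simp
  obtain r :: "nat \<Rightarrow> nat" where r: "strict_mono r"
    and conv: "\<And>y. y \<in> (\<Union>p. F p) \<Longrightarrow> \<exists>l. (\<lambda>n. kop (f (r n)) y) \<longlonglongrightarrow> l"
  proof (rule function_convergent_subsequence[where f="\<lambda>n. kop (f n)" and S="\<Union>p. F p" and M="kbound * B"])
    show "countable (\<Union>p. F p)"
      using F by (intro countable_UN) (auto intro: countable_finite)
    show "norm (kop (f n) y) \<le> kbound * B" if "y \<in> (\<Union>p. F p)" for n y
    proof -
      have "y \<in> space M"
        using F that by blast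
      then have "\<bar>kop (f n) y\<bar> \<le> kbound * (\<integral>x. \<bar>f n x\<bar> \<partial>M)"
        by (rule abs_kop_le[OF f])
      also have "\<dots> \<le> kbound * B"
        using kbound_pos by (intro mult_left_mono B) simp
      finally show ?thesis
        by simp
    qed
  qed blast
  have "uniformly_Cauchy_on (space M) (\<lambda>n. kop (f (r n)))"
    unfolding uniformly_Cauchy_on_def
  proof (intro allI impI)
    fix e :: real assume "0 < e"
    \<comment> \<open>Moving to a net point at squared distance below \<open>\<eta>\<close> costs at
      most \<open>e / 4\<close>, so two moves and the comparison at the net point stay below
      \<open>e\<close>. The \<open>B + 1\<close> avoids a zero denominator.\<close>
    define \<eta> where "\<eta> = (e / (4 * sqrt kbound * (B + 1)))\<^sup>2"
    have "0 < \<eta>"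
      using \<open>0 < e\<close> kbound_pos \<open>0 \<le> B\<close> by (simp add: \<eta>_def)
    have "sqrt \<eta> = e / (4 * sqrt kbound * (B + 1))"
      using \<open>0 < e\<close> kbound_pos \<open>0 \<le> B\<close> by (simp add: \<eta>_def real_sqrt_abs)
    moreover have "e / (4 * s * b) * s * b = e / 4" if "s \<noteq> 0" "b \<noteq> 0" for s b
      using that by simp
    ultimately have sqrt_\<eta>: "sqrt \<eta> * sqrt kbound * (B + 1) = e / 4"
      using kbound_pos \<open>0 \<le> B\<close> by (metis add_nonneg_pos less_irrefl real_sqrt_gt_zero zero_less_one)
    obtain p where p: "inverse (real (Suc p)) < \<eta>"
      using reals_Archimedean[OF \<open>0 < \<eta>\<close>] by blast
    have "\<forall>y\<in>F p. \<exists>N. \<forall>m\<ge>N. \<forall>n\<ge>N. dist (kop (f (r m)) y) (kop (f (r n)) y) < e / 4"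
    proof
      fix y assume "y \<in> F p"
      then have "Cauchy (\<lambda>n. kop (f (r n)) y)"
        using conv by (auto intro: LIMSEQ_imp_Cauchy)
      then show "\<exists>N. \<forall>m\<ge>N. \<forall>n\<ge>N. dist (kop (f (r m)) y) (kop (f (r n)) y) < e / 4"
        using \<open>0 < e\<close> by (intro metric_CauchyD) auto
    qed
    then obtain N where N: "\<And>y m n. y \<in> F p \<Longrightarrow> N y \<le> m \<Longrightarrow> N y \<le> n \<Longrightarrow>
        dist (kop (f (r m)) y) (kop (f (r n)) y) < e / 4"
      by metis
    define N0 where "N0 = Max (insert 0 (N ` F p))"
    have N0: "N y \<le> N0" if "y \<in> F p" for y
      using that F unfolding N0_def by (intro Max_ge) auto
    show "\<exists>N0. \<forall>x\<in>space M. \<forall>m\<ge>N0. \<forall>n\<ge>N0. dist (kop (f (r m)) x) (kop (f (r n)) x) < e"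
    proof (intro exI[of _ N0] ballI allI impI)
      fix x m n assume x: "x \<in> space M" and mn: "N0 \<le> m" "N0 \<le> n"
      obtain y where y: "y \<in> F p" "kdist2 K x y < \<eta>"
        using F x p by (meson less_trans)
      then have yM: "y \<in> space M"
        using F by blast
      have close: "\<bar>kop (f i) x - kop (f i) y\<bar> \<le> e / 4" for i
      proof -
        have "\<bar>kop (f i) x - kop (f i) y\<bar> \<le> sqrt (kdist2 K x y) * sqrt kbound * (\<integral>z. \<bar>f i z\<bar> \<partial>M)"
          by (rule kop_diff_le[OF f x yM])
        also have "\<dots> \<le> sqrt \<eta> * sqrt kbound * (B + 1)"
          using y(2) B[of i] kbound_pos \<open>0 < \<eta>\<close> by (intro mult_mono) auto
        finally show ?thesis
          by (simp only: sqrt_\<eta>)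
      qed
      have "dist (kop (f (r m)) y) (kop (f (r n)) y) < e / 4"
        using N0[OF y(1)] mn by (intro N[OF y(1)]) auto
      then show "dist (kop (f (r m)) x) (kop (f (r n)) x) < e"
        using close[of "r m"] close[of "r n"] unfolding dist_real_def by linarith
    qed
  qed
  then obtain g where "uniform_limit (space M) (\<lambda>n. kop (f (r n))) g sequentially"
    using Cauchy_uniformly_convergent uniformly_convergent_on_def by blast
  with r show ?thesis
    by (rule that)
qed

lemma kop_form_le_L1:
  assumes "integrable M f"
  shows "kop_form f f \<le> kbound * (\<integral>x. \<bar>f x\<bar> \<partial>M) * (\<integral>x. \<bar>f x\<bar> \<partial>M)"
proof -
  have "kop_form f f \<le> \<bar>\<integral>x. f x * kop f x \<partial>M\<bar>"
    by (simp add: kop_form_def)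
  also have "\<dots> \<le> (\<integral>x. kbound * (\<integral>x. \<bar>f x\<bar> \<partial>M) * \<bar>f x\<bar> \<partial>M)"
  proof (rule abs_integral_le)
    show "\<bar>f x * kop f x\<bar> \<le> kbound * (\<integral>x. \<bar>f x\<bar> \<partial>M) * \<bar>f x\<bar>" if "x \<in> space M" for x
      unfolding abs_mult mult.commute[of "\<bar>f x\<bar>"]
      by (rule mult_right_mono[OF abs_kop_le[OF assms that] abs_ge_zero])
  qed (use assms integrable_mult_kop[OF assms assms] in simp_all)
  finally show ?thesis
    by simp
qed

lemma kop_form_scale:
  assumes "integrable M f"
  shows "kop_form (\<lambda>x. c * f x) (\<lambda>x. c * f x) = c\<^sup>2 * kop_form f f"
proof -
  have "kop (\<lambda>x. c * f x) x = c * kop f x" for x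
    by (simp add: kop_def mult.left_commute)
  then show ?thesis
    by (simp add: kop_form_def power2_eq_square mult_ac)
qed

text \<open>
  The supremum of the Rayleigh quotient is attained: a maximizing sequence \<open>f\<close> satisfies
  \<open>kop (f n) - \<mu> f n \<rightarrow> 0\<close>, and \<open>kop (f n)\<close> converges uniformly along a subsequence.
\<close>

lemma kop_eigenfunction_exists:
  assumes f0: "f0 \<in> sqint M" and pos: "kop_form f0 f0 \<noteq> 0"
  obtains \<mu> g where "0 < \<mu>" "g \<in> sqint M" "\<forall>x\<in>space M. kop g x = \<mu> * g x" "0 < (\<integral>x. (g x)\<^sup>2 \<partial>M)"
proof -
  define U where "U = {f \<in> sqint M. (\<integral>x. (f x)\<^sup>2 \<partial>M) \<le> 1}"
  define A where "A = measure M (space M) + 1"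
  have "0 \<le> A"
    by (simp add: A_def)
  have U_sqint: "f \<in> sqint M" and U_int: "integrable M f" and U_norm: "(\<integral>x. (f x)\<^sup>2 \<partial>M) \<le> 1"
    and U_L1: "(\<integral>x. \<bar>f x\<bar> \<partial>M) \<le> A" if "f \<in> U" for f
    using that sqint_integrable[of f] sqint_L1_le[of f] by (auto simp: U_def A_def)
  define \<mu> where "\<mu> = (SUP f\<in>U. kop_form f f)"
  have bdd: "bdd_above ((\<lambda>f. kop_form f f) ` U)"
  proof (rule bdd_aboveI2)
    fix f assume f: "f \<in> U"
    have "kop_form f f \<le> kbound * (\<integral>x. \<bar>f x\<bar> \<partial>M) * (\<integral>x. \<bar>f x\<bar> \<partial>M)"
      by (rule kop_form_le_L1[OF U_int[OF f]])
    also have "\<dots> \<le> kbound * A * A"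
      using kbound_pos \<open>0 \<le> A\<close> U_L1[OF f] by (intro mult_mono) auto
    finally show "kop_form f f \<le> kbound * A * A" .
  qed
  have "(\<lambda>x. 0) \<in> U"
    by (simp add: U_def sqint_zero)
  \<comment> \<open>Elements are functions rather than classes, so a function of norm 0 cannot be
    normalized and is treated separately; its form vanishes.\<close>
  have Rayleigh: "kop_form f f \<le> \<mu> * (\<integral>x. (f x)\<^sup>2 \<partial>M)" if f: "f \<in> sqint M" for f
  proof (cases "(\<integral>x. (f x)\<^sup>2 \<partial>M) = 0")
    case True
    then have "AE x in M. (f x)\<^sup>2 = 0"
      using sqint_integrable_square[OF f] by (subst (asm) integral_nonneg_eq_0_iff_AE) auto
    then have "kop_form f f = (\<integral>x. 0 \<partial>M)"
      unfolding kop_form_def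
      using integrable_mult_kop[OF sqint_integrable[OF f] sqint_integrable[OF f]]
      by (intro integral_cong_AE) auto
    with True show ?thesis
      by simp
  next
    case False
    define s where "s = (\<integral>x. (f x)\<^sup>2 \<partial>M)"
    have "0 \<le> s"
      by (simp add: s_def)
    moreover have "s \<noteq> 0"
      using False by (simp add: s_def)
    ultimately have "0 < s"
      by linarith
    define c where "c = inverse (sqrt s)"
    have c2: "c\<^sup>2 = inverse s"
      using \<open>0 < s\<close> by (simp add: c_def power_inverse)
    have "(\<lambda>x. c * f x) \<in> U"
      using sqint_cmult[OF f] \<open>0 < s\<close> c2 by (simp add: U_def power_mult_distrib s_def[symmetric])
    then have "kop_form (\<lambda>x. c * f x) (\<lambda>x. c * f x) \<le> \<mu>"
      unfolding \<mu>_def by (rule cSUP_upper[OF _ bdd])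
    then have "inverse s * kop_form f f \<le> \<mu>"
      by (simp add: kop_form_scale[OF sqint_integrable[OF f]] c2)
    then show ?thesis
      using \<open>0 < s\<close> unfolding s_def[symmetric] by (simp add: field_simps)
  qed
  have "0 < \<mu>"
  proof (rule ccontr)
    assume "\<not> 0 < \<mu>"
    then have "\<mu> * (\<integral>x. (f0 x)\<^sup>2 \<partial>M) \<le> 0"
      by (intro mult_nonpos_nonneg) auto
    then show False
      using Rayleigh[OF f0] kop_form_nonneg[OF sqint_integrable[OF f0]] pos by linarith
  qed
  \<comment> \<open>The operator inequality \<open>T^2 \<le> \<mu> T\<close>: apply Cauchy-Schwarz
    for the form to \<open>kop f\<close> and \<open>f\<close>, bound the form of
    \<open>kop f\<close> by the Rayleigh quotient, and cancel one factor \<open>q\<close>.\<close>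
  have kop_norm: "(\<integral>x. (kop f x)\<^sup>2 \<partial>M) \<le> \<mu> * kop_form f f" if f: "integrable M f" for f
  proof -
    define q where "q = (\<integral>x. (kop f x)\<^sup>2 \<partial>M)"
    have kf: "integrable M (kop f)"
      by (rule sqint_integrable[OF sqint_kop[OF f]])
    have q: "kop_form (kop f) f = q"
      by (simp add: kop_form_def q_def power2_eq_square)
    have "q\<^sup>2 \<le> kop_form (kop f) (kop f) * kop_form f f"
      using kop_form_Cauchy_Schwarz[OF kf f] by (simp add: q)
    also have "\<dots> \<le> (\<mu> * q) * kop_form f f"
      using Rayleigh[OF sqint_kop[OF f]] kop_form_nonneg[OF f]
      by (intro mult_right_mono) (simp_all add: q_def)
    finally have *: "q * q \<le> q * (\<mu> * kop_form f f)"
      by (simp add: power2_eq_square mult_ac)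
    have "0 \<le> q"
      by (simp add: q_def)
    then have "q \<le> \<mu> * kop_form f f"
      using * \<open>0 < \<mu>\<close> kop_form_nonneg[OF f] by (cases "q = 0") auto
    then show ?thesis
      by (simp add: q_def)
  qed
  have "\<exists>f\<in>U. \<mu> - inverse (real (Suc n)) < kop_form f f" for n
    using \<open>(\<lambda>x. 0) \<in> U\<close> bdd by (subst less_cSUP_iff[symmetric]) (auto simp: \<mu>_def)
  then obtain F where F: "\<And>n. F n \<in> U" and F_form: "\<And>n. \<mu> - inverse (real (Suc n)) < kop_form (F n) (F n)"
    by metis
  obtain r g where r: "strict_mono r"
    and ulim: "uniform_limit (space M) (\<lambda>n. kop (F (r n))) g sequentially"
    by (rule kop_convergent_subsequence[of F A]) (use F U_int U_L1 in auto)
  define f where "f n = F (r n)" for n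
  have f: "f n \<in> U" for n
    by (simp add: f_def F)
  note f_int = U_int[OF f]
  have kf_int: "integrable M (kop (f n))" for n
    by (rule sqint_integrable[OF sqint_kop[OF f_int]])
  have ulim': "uniform_limit (space M) (\<lambda>n. kop (f n)) g sequentially"
    using ulim by (simp add: f_def)
  have plim: "(\<lambda>n. kop (f n) x) \<longlonglongrightarrow> g x" if "x \<in> space M" for x
    by (rule tendsto_uniform_limitI[OF ulim' that])
  have g_meas: "g \<in> borel_measurable M"
    by (rule borel_measurable_LIMSEQ_real[OF plim kop_measurable[OF f_int]])
  have kf_bound: "\<bar>kop (f n) x\<bar> \<le> kbound * A" if "x \<in> space M" for n x
    by (rule order_trans[OF abs_kop_le[OF f_int that] mult_left_mono[OF U_L1[OF f]]])
      (use kbound_pos in simp)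
  have "\<bar>g x\<bar> \<le> kbound * A" if "x \<in> space M" for x
    using LIMSEQ_le_const2[OF tendsto_rabs[OF plim[OF that]]] kf_bound[OF that] by blast
  then have g: "g \<in> sqint M"
    by (rule sqint_bounded[OF g_meas])
  have form_lim: "(\<lambda>n. kop_form (f n) (f n)) \<longlonglongrightarrow> \<mu>"
  proof (rule tendsto_sandwich)
    show "(\<lambda>n. \<mu> - inverse (real (Suc n))) \<longlonglongrightarrow> \<mu>"
      using tendsto_diff[OF tendsto_const LIMSEQ_inverse_real_of_nat, of \<mu>] by simp
    have "\<mu> - inverse (real (Suc n)) \<le> kop_form (f n) (f n)" for n
    proof -
      have "inverse (real (Suc (r n))) \<le> inverse (real (Suc n))"
        using seq_suble[OF r, of n] by (intro le_imp_inverse_le) auto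
      then show ?thesis
        using F_form[of "r n"] unfolding f_def by linarith
    qed
    then show "\<forall>\<^sub>F n in sequentially. \<mu> - inverse (real (Suc n)) \<le> kop_form (f n) (f n)"
      by simp
    have "kop_form (f n) (f n) \<le> \<mu>" for n
      unfolding \<mu>_def by (rule cSUP_upper[OF f bdd])
    then show "\<forall>\<^sub>F n in sequentially. kop_form (f n) (f n) \<le> \<mu>"
      by simp
  qed simp
  have "kop g z = \<mu> * g z" if z: "z \<in> space M" for z
  proof -
    \<comment> \<open>The residual tends to 0 only in L^2. Applying \<open>kop\<close> once more
      makes it tend to 0 at every point, so the limit satisfies the eigenvalue equation
      everywhere.\<close>
    define h where "h n x = 1 * kop (f n) x + (- \<mu>) * f n x" for n x
    have h_sq: "h n \<in> sqint M" for n
      unfolding h_def by (intro sqint_add sqint_cmult sqint_kop[OF f_int] U_sqint[OF f])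
    have h_norm: "(\<integral>x. (h n x)\<^sup>2 \<partial>M) \<le> \<mu> * (\<mu> - kop_form (f n) (f n))" for n
    proof -
      note int = sqint_integrable_square[OF U_sqint[OF f]] sqint_integrable_square[OF sqint_kop[OF f_int]]
        integrable_mult_kop[OF f_int f_int]
      have "(\<integral>x. (h n x)\<^sup>2 \<partial>M) = (\<integral>x. (kop (f n) x)\<^sup>2 - 2 * \<mu> * (f n x * kop (f n) x) + \<mu>\<^sup>2 * (f n x)\<^sup>2 \<partial>M)"
        by (simp add: h_def power2_diff power_mult_distrib algebra_simps)
      also have "\<dots> = (\<integral>x. (kop (f n) x)\<^sup>2 \<partial>M) - 2 * \<mu> * kop_form (f n) (f n) + \<mu>\<^sup>2 * (\<integral>x. (f n x)\<^sup>2 \<partial>M)"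
        using int by (simp add: kop_form_def)
      also have "\<dots> \<le> \<mu> * kop_form (f n) (f n) - 2 * \<mu> * kop_form (f n) (f n) + \<mu>\<^sup>2 * 1"
        using kop_norm[OF f_int] U_norm[OF f] \<open>0 < \<mu>\<close> by (intro add_mono diff_mono mult_left_mono) auto
      finally show ?thesis
        by (simp add: power2_eq_square algebra_simps)
    qed
    have "(\<lambda>n. (kop (h n) z)\<^sup>2) \<longlonglongrightarrow> 0"
    proof (rule tendsto_sandwich[of "\<lambda>_. 0"])
      show "(\<lambda>n. kbound * (\<mu> * (\<mu> * (\<mu> - kop_form (f n) (f n))))) \<longlonglongrightarrow> 0"
        using tendsto_mult_left[OF tendsto_diff[OF tendsto_const[of \<mu>] form_lim], of "kbound * (\<mu> * \<mu>)"]
        by (simp add: mult.assoc)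
      have "(kop (h n) z)\<^sup>2 \<le> kbound * (\<mu> * (\<mu> * (\<mu> - kop_form (f n) (f n))))" for n
      proof -
        have "(kop (h n) z)\<^sup>2 \<le> K z z * kop_form (h n) (h n)"
          by (rule kop_square_le[OF sqint_integrable[OF h_sq] z])
        also have "\<dots> \<le> kbound * kop_form (h n) (h n)"
          by (intro mult_right_mono diag_le_kbound z kop_form_nonneg sqint_integrable h_sq)
        also have "\<dots> \<le> kbound * (\<mu> * (\<integral>x. (h n x)\<^sup>2 \<partial>M))"
          using kbound_pos by (intro mult_left_mono Rayleigh h_sq) simp
        also have "\<dots> \<le> kbound * (\<mu> * (\<mu> * (\<mu> - kop_form (f n) (f n))))"
          using kbound_pos \<open>0 < \<mu>\<close> by (intro mult_left_mono h_norm) auto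
        finally show ?thesis .
      qed
      then show "\<forall>\<^sub>F n in sequentially. (kop (h n) z)\<^sup>2 \<le> kbound * (\<mu> * (\<mu> * (\<mu> - kop_form (f n) (f n))))"
        by simp
    qed simp_all
    then have "(\<lambda>n. kop (h n) z) \<longlonglongrightarrow> 0"
      by simp
    moreover have "(\<lambda>n. kop (h n) z) \<longlonglongrightarrow> kop g z - \<mu> * g z"
    proof -
      have "(\<lambda>n. kop (kop (f n)) z) \<longlonglongrightarrow> kop g z"
        unfolding kop_def[of _ z]
      proof (rule integral_dominated_convergence)
        show "AE x in M. (\<lambda>n. K z x * kop (f n) x) \<longlonglongrightarrow> K z x * g x"
          by (intro AE_I2 tendsto_mult_left plim)
        show "AE x in M. norm (K z x * kop (f n) x) \<le> kbound * (kbound * A)" for n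
        proof (rule AE_I2)
          fix x assume x: "x \<in> space M"
          show "norm (K z x * kop (f n) x) \<le> kbound * (kbound * A)"
            unfolding real_norm_def abs_mult
            by (rule mult_mono[OF abs_le_kbound[OF z x] kf_bound[OF x]]) (use kbound_pos in auto)
        qed
      qed (use z g_meas kop_measurable[OF f_int] in simp_all)
      then have "(\<lambda>n. 1 * kop (kop (f n)) z + (- \<mu>) * kop (f n) z) \<longlonglongrightarrow> 1 * kop g z + (- \<mu>) * g z"
        by (intro tendsto_add tendsto_mult_left plim z)
      moreover have "kop (h n) z = 1 * kop (kop (f n)) z + (- \<mu>) * kop (f n) z" for n
        unfolding h_def by (rule kop_lincomb[OF kf_int f_int z])
      ultimately show ?thesis
        by simp
    qed
    ultimately show ?thesis
      using LIMSEQ_unique by fastforce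
  qed
  moreover have "0 < (\<integral>x. (g x)\<^sup>2 \<partial>M)"
  proof -
    have "(\<lambda>n. \<integral>x. (kop (f n) x)\<^sup>2 \<partial>M) \<longlonglongrightarrow> (\<integral>x. (g x)\<^sup>2 \<partial>M)"
    proof (rule integral_dominated_convergence)
      show "AE x in M. (\<lambda>n. (kop (f n) x)\<^sup>2) \<longlonglongrightarrow> (g x)\<^sup>2"
        by (intro AE_I2 tendsto_power plim)
      show "AE x in M. norm ((kop (f n) x)\<^sup>2) \<le> (kbound * A)\<^sup>2" for n
      proof (rule AE_I2)
        fix x assume x: "x \<in> space M"
        show "norm ((kop (f n) x)\<^sup>2) \<le> (kbound * A)\<^sup>2"
          using power_mono[OF kf_bound[OF x, of n] abs_ge_zero, of 2] by simp
      qed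
    qed (use g_meas kop_measurable[OF f_int] in simp_all)
    \<comment> \<open>The limit cannot degenerate: Cauchy-Schwarz on the unit ball bounds the norm
      of \<open>kop (f n)\<close> from below by the form, which tends to
      \<open>\<mu>\<close>.\<close>
    moreover have "(kop_form (f n) (f n))\<^sup>2 \<le> (\<integral>x. (kop (f n) x)\<^sup>2 \<partial>M)" for n
    proof -
      have "(kop_form (f n) (f n))\<^sup>2 \<le> (\<integral>x. (f n x)\<^sup>2 \<partial>M) * (\<integral>x. (kop (f n) x)\<^sup>2 \<partial>M)"
        unfolding kop_form_def by (rule sqint_Cauchy_Schwarz[OF U_sqint[OF f] sqint_kop[OF f_int]])
      also have "\<dots> \<le> 1 * (\<integral>x. (kop (f n) x)\<^sup>2 \<partial>M)"
        by (intro mult_right_mono U_norm f) simp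
      finally show ?thesis
        by simp
    qed
    ultimately have "\<mu>\<^sup>2 \<le> (\<integral>x. (g x)\<^sup>2 \<partial>M)"
      using tendsto_power[OF form_lim, of 2] by (intro LIMSEQ_le) auto
    then show ?thesis
      using \<open>0 < \<mu>\<close> by (meson less_le_trans zero_less_power)
  qed
  ultimately show ?thesis
    using that[OF \<open>0 < \<mu>\<close> g] by blast
qed

end

section \<open>Mercer's expansion for an abstract kernel\<close>

lemma kform_diff: "kform (\<lambda>x y. A x y - B x y) xs ys = kform A xs ys - kform B xs ys"
  by (simp add: kform_def right_diff_distrib sum_list_subtractf)

lemma kform_add: "kform (\<lambda>x y. A x y + B x y) xs ys = kform A xs ys + kform B xs ys"
  by (simp add: kform_def distrib_left sum_list_addf)

lemma kform_rank_one:
  "kform (\<lambda>x y. c * a x * a y) xs xs = c * (\<Sum>q\<leftarrow>xs. fst q * a (snd q))\<^sup>2"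
proof -
  have "kform (\<lambda>x y. c * a x * a y) xs ys =
      c * (\<Sum>q\<leftarrow>xs. fst q * a (snd q)) * (\<Sum>q\<leftarrow>ys. fst q * a (snd q))" for ys
    by (simp add: kform_def sum_list_const_mult[symmetric] sum_list_mult_const[symmetric] mult_ac)
  then show ?thesis
    by (simp add: power2_eq_square)
qed

lemma kform_sum:
  "kform (\<lambda>x y. \<Sum>i\<in>I. A i x y) xs ys = (\<Sum>i\<in>I. kform (A i) xs ys)"
proof (induction I rule: infinite_finite_induct)
  case (insert i I)
  then show ?case
    using kform_add[of "A i" "\<lambda>x y. \<Sum>i\<in>I. A i x y" xs ys] by simp
qed (simp_all add: kform_def)

context mercer_kernel
begin

lemma kop_sum:
  assumes "\<And>i. i \<in> I \<Longrightarrow> integrable M (f i)" "z \<in> space M"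
  shows "kop (\<lambda>x. \<Sum>i\<in>I. c i * f i x) z = (\<Sum>i\<in>I. c i * kop (f i) z)"
proof -
  have "kop (\<lambda>x. \<Sum>i\<in>I. c i * f i x) z = (\<integral>x. (\<Sum>i\<in>I. c i * (K z x * f i x)) \<partial>M)"
    by (simp add: kop_def sum_distrib_left mult_ac)
  also have "\<dots> = (\<Sum>i\<in>I. c i * kop (f i) z)"
    using assms by (subst Bochner_Integration.integral_sum) (auto simp: kop_def integrable_section_mult)
  finally show ?thesis .
qed

text \<open>The eigenvalue equation is required at every point, since the expansion is uniform over
  all points. \<open>complete\<close> only says that no eigenfunction to a non-zero eigenvalue is
  orthogonal to all \<open>e j\<close>; nothing is assumed about the kernel of the operator.
  \<open>support\<close> upgrades the vanishing of a quadratic form to the vanishing of its kernel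
  at each diagonal point.\<close>

theorem uniform_eigenfunction_expansion:
  fixes J :: "nat set" and lam :: "nat \<Rightarrow> real" and e :: "nat \<Rightarrow> 'a \<Rightarrow> real"
  assumes e: "\<And>j. j \<in> J \<Longrightarrow> e j \<in> sqint M"
    and eig: "\<And>j x. j \<in> J \<Longrightarrow> x \<in> space M \<Longrightarrow> kop (e j) x = lam j * e j x"
    and lam: "\<And>j. j \<in> J \<Longrightarrow> lam j \<noteq> 0"
    and orth: "\<And>i j. i \<in> J \<Longrightarrow> j \<in> J \<Longrightarrow> (\<integral>x. e i x * e j x \<partial>M) = (if i = j then 1 else 0)"
    and complete: "\<And>\<mu> f. \<mu> \<noteq> 0 \<Longrightarrow> f \<in> sqint M \<Longrightarrow> \<forall>x\<in>space M. kop f x = \<mu> * f x \<Longrightarrow>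
      \<forall>j\<in>J. (\<integral>x. f x * e j x \<partial>M) = 0 \<Longrightarrow> (\<integral>x. (f x)\<^sup>2 \<partial>M) = 0"
    and support: "\<And>x \<epsilon>. x \<in> space M \<Longrightarrow> 0 < \<epsilon> \<Longrightarrow>
      \<exists>U\<in>sets M. 0 < measure M U \<and> (\<forall>y\<in>U. kdist2 K x y < \<epsilon>)"
    and "0 < \<epsilon>"
  shows "\<exists>N. \<forall>m\<ge>N. \<forall>x\<in>space M. \<forall>y\<in>space M.
    \<bar>K x y - (\<Sum>j\<in>J \<inter> {..m}. lam j * e j x * e j y)\<bar> \<le> \<epsilon>"
proof -
  define P where "P m x y = (\<Sum>j\<in>J \<inter> {..m}. lam j * e j x * e j y)" for m :: nat and x y
  define R where "R m x y = K x y - P m x y" for m x y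
  note e_int = sqint_integrable[OF e]
  have lam_pos: "0 < lam j" if "j \<in> J" for j
  proof -
    have "kop_form (e j) (e j) = (\<integral>x. lam j * (e j x * e j x) \<partial>M)"
      unfolding kop_form_def by (intro Bochner_Integration.integral_cong) (simp_all add: eig that)
    then have "kop_form (e j) (e j) = lam j"
      using orth[OF that that] by simp
    then show ?thesis
      using kop_form_nonneg[OF e_int[OF that]] lam[OF that] by simp
  qed
  have psd_R: "psd_on (space M) (R m)" for m
    unfolding psd_on_def
  proof (intro conjI ballI allI impI)
    show "R m x y = R m y x" if "x \<in> space M" "y \<in> space M" for x y
      using psd_onD_sym[OF psd that] by (simp add: R_def P_def mult_ac)
  next
    fix xs :: "(real \<times> 'a) list" assume xs: "snd ` set xs \<subseteq> space M"
    define I where "I = J \<inter> {..m}"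
    have I: "finite I" "I \<subseteq> J"
      by (auto simp: I_def)
    define s where "s j = (\<Sum>q\<leftarrow>xs. fst q * e j (snd q))" for j
    \<comment> \<open>The coefficients \<open>- s j\<close> minimize the mixed form of
      \<open>xs\<close> and a density in the span of the \<open>e j\<close>. The minimum is exactly
      the form of \<open>R m\<close> on \<open>xs\<close>, so its positivity is a case of
      \<open>kform_kop_form_nonneg\<close>.\<close>
    define g where "g x = (\<Sum>j\<in>I. (- s j) * e j x)" for x
    have "g \<in> sqint M"
      unfolding g_def using I(2) by (intro sqint_sum e) blast
    then have g_int: "integrable M g"
      by (rule sqint_integrable)
    have kop_g: "kop g z = (\<Sum>j\<in>I. - (s j * lam j * e j z))" if "z \<in> space M" for z
    proof -
      have "kop g z = (\<Sum>j\<in>I. (- s j) * kop (e j) z)"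
        unfolding g_def using I(2) by (intro kop_sum e_int that) blast
      also have "\<dots> = (\<Sum>j\<in>I. - (s j * lam j * e j z))"
        using I(2) that by (intro sum.cong) (auto simp: eig)
      finally show ?thesis .
    qed
    have "(\<Sum>q\<leftarrow>xs. fst q * kop g (snd q)) = (\<Sum>q\<leftarrow>xs. fst q * (\<Sum>j\<in>I. - (s j * lam j * e j (snd q))))"
      using xs by (intro arg_cong[where f=sum_list] map_cong) (auto simp: kop_g)
    also have "\<dots> = (\<Sum>j\<in>I. - (s j * lam j) * (\<Sum>q\<leftarrow>xs. fst q * e j (snd q)))"
      by (induction xs) (simp_all add: sum_distrib_left distrib_left sum.distrib sum_subtractf sum_negf mult_ac)
    also have "\<dots> = - (\<Sum>j\<in>I. lam j * (s j)\<^sup>2)"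
      by (simp add: s_def[symmetric] power2_eq_square sum_negf mult_ac)
    finally have mixed: "(\<Sum>q\<leftarrow>xs. fst q * kop g (snd q)) = - (\<Sum>j\<in>I. lam j * (s j)\<^sup>2)" .
    have "kop_form g g = (\<integral>x. (\<Sum>i\<in>I. \<Sum>j\<in>I. s i * (s j * lam j) * (e i x * e j x)) \<partial>M)"
      unfolding kop_form_def
      by (intro Bochner_Integration.integral_cong refl)
        (simp add: kop_g, simp add: g_def sum_negf sum_product mult_ac)
    also have "\<dots> = (\<Sum>i\<in>I. \<Sum>j\<in>I. s i * (s j * lam j) * (if i = j then 1 else 0))"
    proof -
      have "integrable M (\<lambda>x. e i x * e j x)" if "i \<in> I" "j \<in> I" for i j
        using that I(2) by (intro sqint_integrable_mult e) auto
      then show ?thesis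
        using I(2) by (simp add: Bochner_Integration.integral_sum orth subset_iff cong: sum.cong)
    qed
    also have "\<dots> = (\<Sum>j\<in>I. lam j * (s j)\<^sup>2)"
      using I(1) by (simp add: if_distrib[of "(*) _"] power2_eq_square mult_ac cong: if_cong)
    finally have form: "kop_form g g = (\<Sum>j\<in>I. lam j * (s j)\<^sup>2)" .
    have "kform (P m) xs xs = (\<Sum>j\<in>I. lam j * (s j)\<^sup>2)"
      using kform_sum[of "\<lambda>j x y. lam j * e j x * e j y" I xs xs]
      unfolding kform_rank_one s_def by (simp add: P_def[abs_def] I_def)
    then have "kform (R m) xs xs = kform K xs xs - (\<Sum>j\<in>I. lam j * (s j)\<^sup>2)"
      unfolding R_def kform_diff by simp
    then show "0 \<le> kform (R m) xs xs"
      using kform_kop_form_nonneg[OF g_int xs] by (simp add: mixed form)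
  qed
  have P_diag_nonneg: "0 \<le> P m x x" for m x
    unfolding P_def using less_imp_le[OF lam_pos] by (intro sum_nonneg) (auto simp: mult.assoc)
  have P_diag_le: "P m x x \<le> kbound" if "x \<in> space M" for m x
    using psd_on_diag_nonneg[OF psd_R that, of m] diag_le_kbound[OF that] by (simp add: R_def)
  \<comment> \<open>The subtracted part is itself positive semidefinite, so it only shrinks the
    pseudometric. Hence the nets and balls of \<open>K\<close> serve all \<open>R m\<close> at once
    and also their limit.\<close>
  have kdist2_R: "kdist2 (R m) x y \<le> kdist2 K x y" for m x y
  proof -
    have "kdist2 K x y - kdist2 (R m) x y = (\<Sum>j\<in>J \<inter> {..m}. lam j * (e j x - e j y)\<^sup>2)"
      by (simp add: kdist2_def R_def P_def power2_eq_square algebra_simps sum.distrib sum_subtractf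
          sum_distrib_left)
    moreover have "0 \<le> (\<Sum>j\<in>J \<inter> {..m}. lam j * (e j x - e j y)\<^sup>2)"
      using less_imp_le[OF lam_pos] by (intro sum_nonneg) auto
    ultimately show ?thesis
      by linarith
  qed
  have R_diag_le: "R m x x \<le> kbound" if "x \<in> space M" for m x
    using P_diag_nonneg[of m x] diag_le_kbound[OF that] by (simp add: R_def)
  have R_abs_le: "\<bar>R m x y\<bar> \<le> kbound" if "x \<in> space M" "y \<in> space M" for m x y
  proof -
    have "\<bar>R m x y\<bar> \<le> sqrt (R m x x) * sqrt (R m y y)"
      by (rule psd_on_abs_le[OF psd_R that])
    also have "\<dots> \<le> sqrt kbound * sqrt kbound"
      using that kbound_pos psd_on_diag_nonneg[OF psd_R] R_diag_le by (intro mult_mono) auto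
    finally show ?thesis
      using kbound_pos by simp
  qed

  \<comment> \<open>Padding with zeros outside \<open>J\<close> turns the finite and the infinite
    case into one series. On the diagonal its terms are non-negative with partial sums at most
    \<open>kbound\<close>; off the diagonal it is dominated by two diagonal series.\<close>
  define t where "t j x y = (if j \<in> J then lam j * e j x * e j y else 0)" for j x y
  have P_t: "P m x y = (\<Sum>j\<le>m. t j x y)" for m x y
    unfolding P_def t_def by (simp add: sum.inter_restrict[symmetric] Int_commute)
  have t_diag: "0 \<le> t j x x" for j x
    using less_imp_le[OF lam_pos] by (auto simp: t_def mult.assoc)
  have summable_diag: "summable (\<lambda>j. t j x x)" if "x \<in> space M" for x
  proof (rule summableI_nonneg_bounded[OF t_diag])
    show "(\<Sum>j<n. t j x x) \<le> kbound" for n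
      using P_diag_le[OF that, of n] t_diag[of n x] unfolding P_t lessThan_Suc_atMost[symmetric] by simp
  qed
  have summable_t: "summable (\<lambda>j. t j x y)" if "x \<in> space M" "y \<in> space M" for x y
  proof (rule summable_comparison_test')
    show "summable (\<lambda>j. t j x x + t j y y)"
      using that by (intro summable_add summable_diag)
    show "norm (t j x y) \<le> t j x x + t j y y" for j
    proof (cases "j \<in> J")
      case True
      have "\<bar>e j x * e j y\<bar> \<le> e j x * e j x + e j y * e j y"
        using sum_squares_bound[of "\<bar>e j x\<bar>" "\<bar>e j y\<bar>"] abs_ge_zero[of "e j x * e j y"]
        unfolding abs_mult power2_abs power2_eq_square by linarith
      then have "lam j * \<bar>e j x * e j y\<bar> \<le> lam j * (e j x * e j x + e j y * e j y)"
        using lam_pos[OF True] by (intro mult_left_mono) auto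
      then show ?thesis
        using True lam_pos[OF True] by (simp add: t_def abs_mult distrib_left mult.assoc)
    qed (simp add: t_def)
  qed
  define Q where "Q x y = K x y - (\<Sum>j. t j x y)" for x y
  have R_lim: "(\<lambda>m. R m x y) \<longlonglongrightarrow> Q x y" if "x \<in> space M" "y \<in> space M" for x y
    unfolding R_def Q_def P_t by (intro tendsto_diff tendsto_const summable_LIMSEQ' summable_t that)
  have psd_Q: "psd_on (space M) Q"
    by (rule psd_on_limit[OF psd_R R_lim])
  have kdist2_Q: "kdist2 Q x y \<le> kdist2 K x y" if "x \<in> space M" "y \<in> space M" for x y
  proof (rule LIMSEQ_le_const2)
    show "(\<lambda>m. kdist2 (R m) x y) \<longlonglongrightarrow> kdist2 Q x y"
      unfolding kdist2_def by (intro tendsto_intros R_lim that)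
  qed (use kdist2_R in blast)
  have P_meas: "(\<lambda>x. P m x y) \<in> borel_measurable M" "(\<lambda>x. P m x x) \<in> borel_measurable M" for m y
  proof -
    have eM: "e j \<in> borel_measurable M" if "j \<in> J \<inter> {..m}" for j
      using that by (intro sqint_measurable e) simp
    show "(\<lambda>x. P m x y) \<in> borel_measurable M" "(\<lambda>x. P m x x) \<in> borel_measurable M"
      unfolding P_def
      by (rule borel_measurable_sum, rule borel_measurable_times, rule borel_measurable_times,
          simp_all only: eM borel_measurable_const)+
  qed
  \<comment> \<open>The limit kernel lies in the same class, so the existence of eigenfunctions is
    available for it.\<close>
  interpret Q: mercer_kernel M Q
  proof
    show "psd_on (space M) Q"
      by (rule psd_Q)
    show "(\<lambda>x. Q x y) \<in> borel_measurable M" if "y \<in> space M" for y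
    proof (rule borel_measurable_LIMSEQ_real)
      show "(\<lambda>m. R m x y) \<longlonglongrightarrow> Q x y" if "x \<in> space M" for x
        by (rule R_lim[OF that \<open>y \<in> space M\<close>])
      show "(\<lambda>x. R m x y) \<in> borel_measurable M" for m
        unfolding R_def by (intro borel_measurable_diff measurable_section that P_meas)
    qed
    show "(\<lambda>x. Q x x) \<in> borel_measurable M"
    proof (rule borel_measurable_LIMSEQ_real)
      show "(\<lambda>m. R m x x) \<longlonglongrightarrow> Q x x" if "x \<in> space M" for x
        by (rule R_lim[OF that that])
      show "(\<lambda>x. R m x x) \<in> borel_measurable M" for m
        unfolding R_def by (intro borel_measurable_diff measurable_diag P_meas)
    qed
    fix \<epsilon> :: real assume "0 < \<epsilon>"
    obtain F where F: "finite F" "F \<subseteq> space M" "\<forall>x\<in>space M. \<exists>y\<in>F. kdist2 K x y < \<epsilon>"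
      using totally_bounded[OF \<open>0 < \<epsilon>\<close>] by blast
    have "\<forall>x\<in>space M. \<exists>y\<in>F. kdist2 Q x y < \<epsilon>"
    proof
      fix x assume x: "x \<in> space M"
      then obtain y where "y \<in> F" "kdist2 K x y < \<epsilon>"
        using F(3) by blast
      then show "\<exists>y\<in>F. kdist2 Q x y < \<epsilon>"
        using kdist2_Q[OF x] F(2) by (meson le_less_trans subsetD)
    qed
    then show "\<exists>F. finite F \<and> F \<subseteq> space M \<and> (\<forall>x\<in>space M. \<exists>y\<in>F. kdist2 Q x y < \<epsilon>)"
      using F by blast
  qed
  have Q_kop: "(\<lambda>m. kop f z - (\<Sum>j\<in>J \<inter> {..m}. lam j * e j z * (\<integral>x. f x * e j x \<partial>M))) \<longlonglongrightarrow> Q.kop f z"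
    if f: "f \<in> sqint M" and z: "z \<in> space M" for f z
  proof -
    note f_int = sqint_integrable[OF f]
    have "(\<lambda>m. \<integral>y. R m z y * f y \<partial>M) \<longlonglongrightarrow> Q.kop f z"
      unfolding Q.kop_def
    proof (rule integral_dominated_convergence)
      show "AE x in M. (\<lambda>m. R m z x * f x) \<longlonglongrightarrow> Q z x * f x"
        by (intro AE_I2 tendsto_mult_right R_lim z)
      show "AE x in M. norm (R m z x * f x) \<le> kbound * \<bar>f x\<bar>" for m
      proof (rule AE_I2)
        fix x assume x: "x \<in> space M"
        show "norm (R m z x * f x) \<le> kbound * \<bar>f x\<bar>"
          unfolding real_norm_def abs_mult by (rule mult_right_mono[OF R_abs_le[OF z x] abs_ge_zero])
      qed
      have "(\<lambda>x. P m z x) \<in> borel_measurable M" for m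
        using P_meas(1)[of m z] by (simp add: P_def mult_ac)
      then show "(\<lambda>x. R m z x * f x) \<in> borel_measurable M" for m
        unfolding R_def using z f_int by (intro borel_measurable_times borel_measurable_diff) auto
    qed (use f_int Q.integrable_section_mult[OF f_int z] in auto)
    moreover have "(\<integral>y. R m z y * f y \<partial>M) =
        kop f z - (\<Sum>j\<in>J \<inter> {..m}. lam j * e j z * (\<integral>x. f x * e j x \<partial>M))" for m
    proof -
      have fe: "integrable M (\<lambda>x. lam j * e j z * (f x * e j x))" if "j \<in> J \<inter> {..m}" for j
        using that by (auto intro!: sqint_integrable_mult f e)
      have "(\<integral>y. R m z y * f y \<partial>M) =
          (\<integral>y. K z y * f y - (\<Sum>j\<in>J \<inter> {..m}. lam j * e j z * (f y * e j y)) \<partial>M)"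
        unfolding R_def P_def left_diff_distrib sum_distrib_right by (simp only: mult_ac)
      also have "\<dots> = kop f z - (\<integral>y. (\<Sum>j\<in>J \<inter> {..m}. lam j * e j z * (f y * e j y)) \<partial>M)"
        unfolding kop_def
        by (intro Bochner_Integration.integral_diff integrable_section_mult f_int z
            Bochner_Integration.integrable_sum fe)
      also have "(\<integral>y. (\<Sum>j\<in>J \<inter> {..m}. lam j * e j z * (f y * e j y)) \<partial>M) =
          (\<Sum>j\<in>J \<inter> {..m}. \<integral>y. lam j * e j z * (f y * e j y) \<partial>M)"
        by (rule Bochner_Integration.integral_sum[OF fe])
      finally show ?thesis
        by simp
    qed
    ultimately show ?thesis
      by simp
  qed
  \<comment> \<open>From \<open>m = i\<close> on, orthonormality leaves exactly
    \<open>lam i * e i z\<close> in the sum, so the sequence of \<open>Q_kop\<close> is eventually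
    0.\<close>
  have Q_kop_e: "Q.kop (e i) z = 0" if i: "i \<in> J" and z: "z \<in> space M" for i z
  proof -
    have "kop (e i) z - (\<Sum>j\<in>J \<inter> {..m}. lam j * e j z * (\<integral>x. e i x * e j x \<partial>M)) = 0" if "i \<le> m" for m
    proof -
      have "(\<Sum>j\<in>J \<inter> {..m}. lam j * e j z * (\<integral>x. e i x * e j x \<partial>M)) =
          (\<Sum>j\<in>J \<inter> {..m}. if i = j then lam j * e j z else 0)"
        using i by (intro sum.cong) (auto simp: orth)
      also have "\<dots> = lam i * e i z"
        using i that by simp
      finally show ?thesis
        using i z by (simp add: eig)
    qed
    then have "\<forall>\<^sub>F m in sequentially.
        kop (e i) z - (\<Sum>j\<in>J \<inter> {..m}. lam j * e j z * (\<integral>x. e i x * e j x \<partial>M)) = 0"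
      using eventually_ge_at_top[of i] by (rule eventually_mono[rotated])
    from tendsto_cong[OF this, THEN iffD1, OF Q_kop[OF e[OF i] z]] show ?thesis
      by (simp add: tendsto_const_iff)
  qed
  \<comment> \<open>Otherwise \<open>Q\<close> has an eigenfunction \<open>g\<close> to a positive
    eigenvalue. As \<open>Q\<close> is symmetric and annihilates every \<open>e j\<close>,
    \<open>g\<close> is orthogonal to all of them. Then the operators of \<open>Q\<close> and
    \<open>K\<close> agree on \<open>g\<close>, which contradicts \<open>complete\<close>.\<close>
  have Q_form_zero: "Q.kop_form f f = 0" if f: "f \<in> sqint M" for f
  proof (rule ccontr)
    assume "Q.kop_form f f \<noteq> 0"
    then obtain \<mu> g where "0 < \<mu>" and g: "g \<in> sqint M"
      and Qg: "\<forall>x\<in>space M. Q.kop g x = \<mu> * g x" and norm: "0 < (\<integral>x. (g x)\<^sup>2 \<partial>M)"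
      by (rule Q.kop_eigenfunction_exists[OF f])
    have ortho: "(\<integral>x. g x * e j x \<partial>M) = 0" if j: "j \<in> J" for j
    proof -
      have "\<mu> * (\<integral>x. g x * e j x \<partial>M) = (\<integral>x. e j x * Q.kop g x \<partial>M)"
        by (subst Bochner_Integration.integral_mult_right_zero[symmetric])
          (intro Bochner_Integration.integral_cong, auto simp: Qg)
      also have "\<dots> = (\<integral>x. g x * Q.kop (e j) x \<partial>M)"
        using Q.kop_form_commute[OF e_int[OF j] sqint_integrable[OF g]] by (simp add: Q.kop_form_def)
      also have "\<dots> = (\<integral>x. 0 \<partial>M)"
        by (intro Bochner_Integration.integral_cong) (auto simp: Q_kop_e[OF j])
      finally show ?thesis
        using \<open>0 < \<mu>\<close> by simp
    qed
    have "kop g z = \<mu> * g z" if z: "z \<in> space M" for z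
    proof -
      have "(\<lambda>m::nat. kop g z) \<longlonglongrightarrow> Q.kop g z"
        using Q_kop[OF g z] by (simp add: ortho)
      then show ?thesis
        using Qg z by (simp add: tendsto_const_iff)
    qed
    then show False
      using complete[of \<mu> g] \<open>0 < \<mu>\<close> g ortho norm by simp
  qed
  have Q_diag: "Q x x = 0" if x: "x \<in> space M" for x
  proof (rule ccontr)
    assume "Q x x \<noteq> 0"
    define a where "a = Q x x"
    have "0 < a"
      using psd_on_diag_nonneg[OF psd_Q x] \<open>Q x x \<noteq> 0\<close> by (simp add: a_def)
    \<comment> \<open>This radius keeps the section of \<open>Q\<close> at \<open>x\<close> above
      \<open>a / 2\<close> on a set of positive measure. The indicator of that set then has a
      positive image at \<open>x\<close>, although \<open>kop_square_le\<close> and the vanishing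
      form make this image 0.\<close>
    define \<delta> where "\<delta> = (a / (2 * sqrt Q.kbound))\<^sup>2"
    have "0 < \<delta>"
      using \<open>0 < a\<close> Q.kbound_pos by (simp add: \<delta>_def)
    obtain U where U: "U \<in> sets M" "0 < measure M U" "\<forall>y\<in>U. kdist2 K x y < \<delta>"
      using support[OF x \<open>0 < \<delta>\<close>] by blast
    have UM: "U \<subseteq> space M"
      by (rule sets.sets_into_space[OF U(1)])
    have Q_ge: "a / 2 \<le> Q x y" if y: "y \<in> U" for y
    proof -
      have yM: "y \<in> space M"
        using UM y by blast
      have "\<bar>Q x x - Q y x\<bar> \<le> sqrt (kdist2 Q x y) * sqrt Q.kbound"
        by (rule Q.section_diff_le[OF x yM x])
      also have "\<dots> \<le> sqrt \<delta> * sqrt Q.kbound"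
        using kdist2_Q[OF x yM] U(3) y Q.kbound_pos
        by (intro mult_right_mono) (auto intro: less_imp_le order_trans)
      also have "\<dots> = a / 2"
        using \<open>0 < a\<close> Q.kbound_pos by (simp add: \<delta>_def real_sqrt_abs)
      finally have "a - Q y x \<le> a / 2"
        unfolding a_def by linarith
      then show ?thesis
        using psd_onD_sym[OF psd_Q x yM] by simp
    qed
    define f where "f = (indicator U :: 'a \<Rightarrow> real)"
    have f: "f \<in> sqint M"
      using U(1) by (intro sqint_bounded[of _ 1]) (auto simp: f_def)
    have "(Q.kop f x)\<^sup>2 \<le> Q x x * Q.kop_form f f"
      by (rule Q.kop_square_le[OF sqint_integrable[OF f] x])
    then have "Q.kop f x = 0"
      by (simp add: Q_form_zero[OF f])
    moreover have "(\<integral>y. a / 2 * f y \<partial>M) \<le> Q.kop f x"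
      unfolding Q.kop_def
    proof (rule integral_mono)
      show "a / 2 * f y \<le> Q x y * f y" for y
        using Q_ge by (cases "y \<in> U") (auto simp: f_def)
    qed (use sqint_integrable[OF f] Q.integrable_section_mult[OF _ x] in auto)
    moreover have "(\<integral>y. a / 2 * f y \<partial>M) = a / 2 * measure M U"
      using U(1) UM by (simp add: f_def Int_absorb2)
    moreover have "0 < a / 2 * measure M U"
      using \<open>0 < a\<close> U(2) by simp
    ultimately show False
      by linarith
  qed

  \<comment> \<open>With \<open>\<epsilon> / 4\<close> for the net and for the diagonal at its
    points, each contributes \<open>sqrt \<epsilon> / 2\<close>, and the root of the diagonal is at
    most \<open>sqrt \<epsilon>\<close> everywhere.\<close>
  have "0 < \<epsilon> / 4"
    using \<open>0 < \<epsilon>\<close> by simp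
  from totally_bounded[OF this]
  obtain F where F: "finite F" "F \<subseteq> space M" "\<forall>x\<in>space M. \<exists>y\<in>F. kdist2 K x y < \<epsilon> / 4"
    by blast
  have "\<forall>y\<in>F. \<forall>\<^sub>F m in sequentially. R m y y < \<epsilon> / 4"
  proof
    fix y assume "y \<in> F"
    then have y: "y \<in> space M"
      using F(2) by blast
    show "\<forall>\<^sub>F m in sequentially. R m y y < \<epsilon> / 4"
      using order_tendstoD(2)[OF R_lim[OF y y], of "\<epsilon> / 4"] \<open>0 < \<epsilon>\<close> by (simp add: Q_diag[OF y])
  qed
  from eventually_ball_finite[OF F(1) this]
  obtain N where N: "\<And>m y. N \<le> m \<Longrightarrow> y \<in> F \<Longrightarrow> R m y y < \<epsilon> / 4"
    unfolding eventually_sequentially by metis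
  have sqrt_\<epsilon>: "sqrt (\<epsilon> / 4) = sqrt \<epsilon> / 2"
    by (simp add: real_sqrt_divide)
  have diag: "sqrt (R m x x) \<le> sqrt \<epsilon>" if m: "N \<le> m" and x: "x \<in> space M" for m x
  proof -
    obtain y where y: "y \<in> F" "kdist2 K x y < \<epsilon> / 4"
      using F(3) x by blast
    have yM: "y \<in> space M"
      using F(2) y(1) by blast
    have "sqrt (R m x x) \<le> sqrt (R m y y) + sqrt (kdist2 (R m) x y)"
      using psd_on_sqrt_diag_diff_le[OF psd_R x yM, of m] by linarith
    also have "\<dots> \<le> sqrt (\<epsilon> / 4) + sqrt (\<epsilon> / 4)"
      using N[OF m y(1)] y(2) kdist2_R[of m x y] by (intro add_mono real_sqrt_le_mono) linarith+
    finally show ?thesis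
      by (simp add: sqrt_\<epsilon>)
  qed
  have "\<bar>R m x y\<bar> \<le> \<epsilon>" if "N \<le> m" "x \<in> space M" "y \<in> space M" for m x y
  proof -
    have "\<bar>R m x y\<bar> \<le> sqrt (R m x x) * sqrt (R m y y)"
      by (rule psd_on_abs_le[OF psd_R that(2,3)])
    also have "\<dots> \<le> sqrt \<epsilon> * sqrt \<epsilon>"
      using that \<open>0 < \<epsilon>\<close> psd_on_diag_nonneg[OF psd_R] by (intro mult_mono diag) auto
    finally show ?thesis
      using \<open>0 < \<epsilon>\<close> by simp
  qed
  then show ?thesis
    unfolding R_def P_def by blast
qed

end

section \<open>Iterated directional derivatives\<close>

lemma iter_deriv_Nil [simp]: "iter_deriv [] f = f"
  by (simp add: iter_deriv_def)

lemma iter_deriv_Cons [simp]: "iter_deriv (v # vs) f = dir_deriv v (iter_deriv vs f)"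
  by (simp add: iter_deriv_def)

lemma eventually_line_in_open:
  fixes v :: "'a::real_normed_vector"
  assumes "open S" "x \<in> S"
  shows "\<forall>\<^sub>F t in nhds (0::real). x + t *\<^sub>R v \<in> S"
proof -
  have "((\<lambda>t. x + t *\<^sub>R v) \<longlongrightarrow> x + 0 *\<^sub>R v) (nhds (0::real))"
    by (intro tendsto_intros filterlim_ident)
  then show ?thesis
    using assms topological_tendstoD by fastforce
qed

lemma dir_deriv_cong_open:
  assumes "open S" "x \<in> S" "\<And>y. y \<in> S \<Longrightarrow> f y = g y"
  shows "dir_deriv v f x = dir_deriv v g x"
  unfolding dir_deriv_def
  by (intro deriv_cong_ev eventually_mono[OF eventually_line_in_open[OF assms(1,2)]] refl assms(3))

lemma differentiable_cong_open:
  fixes f g :: "'a::real_normed_vector \<Rightarrow> 'b::real_normed_vector"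
  assumes "open S" "x \<in> S" "\<And>y. y \<in> S \<Longrightarrow> f y = g y"
  shows "(\<lambda>t::real. f (x + t *\<^sub>R v)) differentiable (at 0) \<longleftrightarrow>
    (\<lambda>t::real. g (x + t *\<^sub>R v)) differentiable (at (0::real))"
proof -
  have *: "(\<lambda>t::real. g (x + t *\<^sub>R v)) differentiable (at 0)"
    if eq: "\<And>y. y \<in> S \<Longrightarrow> f y = g y" and diff: "(\<lambda>t::real. f (x + t *\<^sub>R v)) differentiable (at 0)" for f g :: "'a \<Rightarrow> 'b"
  proof -
    obtain D where "((\<lambda>t::real. f (x + t *\<^sub>R v)) has_derivative D) (at 0)"
      using diff by (auto simp: differentiable_def)
    moreover have "\<forall>\<^sub>F t in at 0. f (x + t *\<^sub>R v) = g (x + t *\<^sub>R v)"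
      unfolding eventually_at_filter
      by (rule eventually_mono[OF eventually_line_in_open[OF assms(1,2), of v]]) (simp add: eq)
    ultimately have "((\<lambda>t::real. g (x + t *\<^sub>R v)) has_derivative D) (at 0)"
      by (rule has_derivative_transform_eventually) (use eq[OF assms(2)] in simp_all)
    then show ?thesis
      by (auto simp: differentiable_def)
  qed
  show ?thesis
    using *[of f g] *[of g f] assms(3) by auto
qed

lemma iter_deriv_cong_open:
  assumes "open S" "\<And>y. y \<in> S \<Longrightarrow> f y = g y" "x \<in> S"
  shows "iter_deriv vs f x = iter_deriv vs g x"
  using assms(3)
proof (induction vs arbitrary: x)
  case (Cons v vs)
  then show ?case
    using assms(1) by (auto intro: dir_deriv_cong_open)
qed (simp add: assms(2))

lemma has_dir_deriv:
  assumes "(\<lambda>s::real. f (x + t *\<^sub>R v + s *\<^sub>R v)) differentiable (at 0)"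
  shows "((\<lambda>s. f (x + s *\<^sub>R v)) has_real_derivative dir_deriv v f (x + t *\<^sub>R v)) (at t)"
proof -
  have "((\<lambda>s. f (x + t *\<^sub>R v + s *\<^sub>R v)) has_real_derivative dir_deriv v f (x + t *\<^sub>R v)) (at 0)"
    using assms unfolding dir_deriv_def
    by (metis DERIV_imp_deriv real_differentiable_def)
  then have "((\<lambda>s. f (x + (s + t) *\<^sub>R v)) has_real_derivative dir_deriv v f (x + t *\<^sub>R v)) (at 0)"
    by (simp add: scaleR_add_left add_ac)
  then show ?thesis
    using DERIV_shift[of "\<lambda>s. f (x + s *\<^sub>R v)" _ 0 t] by simp
qed

lemma dir_derivI:
  assumes "((\<lambda>t. f (x + t *\<^sub>R v)) has_real_derivative D) (at 0)"
  shows "dir_deriv v f x = D" "(\<lambda>t::real. f (x + t *\<^sub>R v)) differentiable (at 0)"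
  using assms by (auto simp: dir_deriv_def DERIV_imp_deriv real_differentiable_def)

lemma has_dir_deriv_0:
  assumes "(\<lambda>s::real. f (x + s *\<^sub>R v)) differentiable (at 0)"
  shows "((\<lambda>s. f (x + s *\<^sub>R v)) has_real_derivative dir_deriv v f x) (at 0)"
  using has_dir_deriv[of f x 0 v] assms by simp

text \<open>Two applications of the mean value theorem, first along \<open>u\<close> to the
  difference of \<open>f\<close> on two parallel segments, then along \<open>v\<close> to
  \<open>dir_deriv u f\<close>, identify the quotient with the mixed derivative at a nearby point.
  The quotient is symmetric in \<open>u\<close> and \<open>v\<close>, which gives Schwarz's theorem;
  it is also the second-order limit that makes mixed derivatives of kernels positive
  semidefinite.\<close>

lemma double_difference_tendsto:
  fixes f :: "'a::real_normed_vector \<Rightarrow> real"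
  assumes "open S" "x \<in> S"
    and fu: "\<And>y. y \<in> S \<Longrightarrow> (\<lambda>t::real. f (y + t *\<^sub>R u)) differentiable (at 0)"
    and fuv: "\<And>y. y \<in> S \<Longrightarrow> (\<lambda>t::real. dir_deriv u f (y + t *\<^sub>R v)) differentiable (at 0)"
    and cont: "continuous_on S (dir_deriv v (dir_deriv u f))"
  shows "((\<lambda>t. (f (x + t *\<^sub>R u + t *\<^sub>R v) - f (x + t *\<^sub>R u) - f (x + t *\<^sub>R v) + f x) / t\<^sup>2)
    \<longlongrightarrow> dir_deriv v (dir_deriv u f) x) (at 0)"
proof (rule tendstoI)
  let ?D = "dir_deriv v (dir_deriv u f)"
  fix e :: real assume "0 < e"
  obtain d1 where d1: "0 < d1" "\<And>y. y \<in> S \<Longrightarrow> dist y x < d1 \<Longrightarrow> dist (?D y) (?D x) < e"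
    using cont \<open>x \<in> S\<close> \<open>0 < e\<close> unfolding continuous_on_iff by blast
  obtain d2 where d2: "0 < d2" "ball x d2 \<subseteq> S"
    using assms(1,2) by (rule openE)
  \<comment> \<open>For \<open>\<bar>t\<bar> < d\<close> the whole parallelogram spanned by
    \<open>t *\<^sub>R u\<close> and \<open>t *\<^sub>R v\<close> stays in the ball of radius
    \<open>min d1 d2\<close>; the 1 guards against \<open>u = v = 0\<close>.\<close>
  define d where "d = min d1 d2 / (norm u + norm v + 1)"
  have n: "0 < norm u + norm v + 1"
    by (intro add_nonneg_pos add_nonneg_nonneg) auto
  have "0 < d"
    using d1 d2 n by (simp add: d_def)
  have "dist ((f (x + t *\<^sub>R u + t *\<^sub>R v) - f (x + t *\<^sub>R u) - f (x + t *\<^sub>R v) + f x) / t\<^sup>2) (?D x) < e"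
    if t: "t \<noteq> 0" "\<bar>t\<bar> < d" for t
  proof -
    have close: "x + (a * t) *\<^sub>R u + (b * t) *\<^sub>R v \<in> S \<and> dist (x + (a * t) *\<^sub>R u + (b * t) *\<^sub>R v) x < d1"
      if "0 \<le> a" "a \<le> 1" "0 \<le> b" "b \<le> 1" for a b
    proof -
      have "norm ((a * t) *\<^sub>R u + (b * t) *\<^sub>R v) \<le> \<bar>a\<bar> * \<bar>t\<bar> * norm u + \<bar>b\<bar> * \<bar>t\<bar> * norm v"
        by (rule order_trans[OF norm_triangle_ineq]) (simp add: abs_mult)
      also have "\<dots> \<le> 1 * \<bar>t\<bar> * norm u + 1 * \<bar>t\<bar> * norm v"
        using that by (intro add_mono mult_right_mono) auto
      also have "\<dots> \<le> \<bar>t\<bar> * (norm u + norm v + 1)"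
        by (simp add: algebra_simps)
      also have "\<dots> < d * (norm u + norm v + 1)"
        using t n by (intro mult_strict_right_mono) auto
      also have "\<dots> = min d1 d2"
        using n by (simp add: d_def)
      finally have "dist (x + (a * t) *\<^sub>R u + (b * t) *\<^sub>R v) x < min d1 d2"
        by (simp add: dist_norm add.assoc)
      then show ?thesis
        using d2(2) by (auto simp: dist_commute)
    qed
    have der_u: "((\<lambda>s. f (y + (s * t) *\<^sub>R u)) has_real_derivative dir_deriv u f (y + (s * t) *\<^sub>R u) * t) (at s)"
      if "y + (s * t) *\<^sub>R u \<in> S" for y s
      by (rule DERIV_chain2[where f="\<lambda>s. f (y + s *\<^sub>R u)" and g="\<lambda>s. s * t", OF has_dir_deriv[OF fu[OF that]]]) (auto intro!: derivative_eq_intros)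
    have der_v: "((\<lambda>s. dir_deriv u f (y + (s * t) *\<^sub>R v)) has_real_derivative ?D (y + (s * t) *\<^sub>R v) * t) (at s)"
      if "y + (s * t) *\<^sub>R v \<in> S" for y s
      by (rule DERIV_chain2[where f="\<lambda>s. dir_deriv u f (y + s *\<^sub>R v)" and g="\<lambda>s. s * t", OF has_dir_deriv[OF fuv[OF that]]]) (auto intro!: derivative_eq_intros)
    define g where "g s = f (x + t *\<^sub>R v + (s * t) *\<^sub>R u) - f (x + (s * t) *\<^sub>R u)" for s
    have "\<exists>a. 0 < a \<and> a < 1 \<and> g 1 - g 0 = (1 - 0) *
        (dir_deriv u f (x + t *\<^sub>R v + (a * t) *\<^sub>R u) * t - dir_deriv u f (x + (a * t) *\<^sub>R u) * t)"
    proof (rule MVT2)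
      fix s :: real assume s: "0 \<le> s" "s \<le> 1"
      show "(g has_real_derivative dir_deriv u f (x + t *\<^sub>R v + (s * t) *\<^sub>R u) * t -
          dir_deriv u f (x + (s * t) *\<^sub>R u) * t) (at s)"
        unfolding g_def
        by (intro DERIV_diff der_u) (use close[of s 1] close[of s 0] s in \<open>simp_all add: add_ac\<close>)
    qed simp
    then obtain a where a: "0 < a" "a < 1" and g: "g 1 - g 0 =
        (dir_deriv u f (x + t *\<^sub>R v + (a * t) *\<^sub>R u) - dir_deriv u f (x + (a * t) *\<^sub>R u)) * t"
      by (auto simp: left_diff_distrib)
    have "\<exists>b. 0 < b \<and> b < 1 \<and>
        dir_deriv u f (x + (a * t) *\<^sub>R u + (1 * t) *\<^sub>R v) - dir_deriv u f (x + (a * t) *\<^sub>R u + (0 * t) *\<^sub>R v) =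
        (1 - 0) * (?D (x + (a * t) *\<^sub>R u + (b * t) *\<^sub>R v) * t)"
    proof (rule MVT2)
      fix s :: real assume s: "0 \<le> s" "s \<le> 1"
      show "((\<lambda>s. dir_deriv u f (x + (a * t) *\<^sub>R u + (s * t) *\<^sub>R v)) has_real_derivative
          ?D (x + (a * t) *\<^sub>R u + (s * t) *\<^sub>R v) * t) (at s)"
        by (rule der_v) (use close[of a s] s a in simp)
    qed simp
    then obtain b where b: "0 < b" "b < 1" and
      Db: "dir_deriv u f (x + (a * t) *\<^sub>R u + t *\<^sub>R v) - dir_deriv u f (x + (a * t) *\<^sub>R u) =
        ?D (x + (a * t) *\<^sub>R u + (b * t) *\<^sub>R v) * t"
      by auto
    have "f (x + t *\<^sub>R u + t *\<^sub>R v) - f (x + t *\<^sub>R u) - f (x + t *\<^sub>R v) + f x = g 1 - g 0"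
      by (simp add: g_def add_ac)
    also have "\<dots> = ?D (x + (a * t) *\<^sub>R u + (b * t) *\<^sub>R v) * t * t"
      unfolding g Db[symmetric] by (simp add: add_ac)
    finally have "(f (x + t *\<^sub>R u + t *\<^sub>R v) - f (x + t *\<^sub>R u) - f (x + t *\<^sub>R v) + f x) / t\<^sup>2 =
        ?D (x + (a * t) *\<^sub>R u + (b * t) *\<^sub>R v)"
      using t by (simp add: power2_eq_square)
    then show ?thesis
      using d1(2) close[of a b] a b by simp
  qed
  then show "\<forall>\<^sub>F t in at 0. dist ((f (x + t *\<^sub>R u + t *\<^sub>R v) - f (x + t *\<^sub>R u) - f (x + t *\<^sub>R v) + f x) / t\<^sup>2) (?D x) < e"
    unfolding eventually_at using \<open>0 < d\<close> by (intro exI[of _ d]) auto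
qed

lemma dir_deriv_commute:
  fixes f :: "'a::real_normed_vector \<Rightarrow> real"
  assumes "open S" "x \<in> S"
    and "\<And>y. y \<in> S \<Longrightarrow> (\<lambda>t::real. f (y + t *\<^sub>R u)) differentiable (at 0)"
    and "\<And>y. y \<in> S \<Longrightarrow> (\<lambda>t::real. f (y + t *\<^sub>R v)) differentiable (at 0)"
    and "\<And>y. y \<in> S \<Longrightarrow> (\<lambda>t::real. dir_deriv u f (y + t *\<^sub>R v)) differentiable (at 0)"
    and "\<And>y. y \<in> S \<Longrightarrow> (\<lambda>t::real. dir_deriv v f (y + t *\<^sub>R u)) differentiable (at 0)"
    and "continuous_on S (dir_deriv v (dir_deriv u f))"
    and "continuous_on S (dir_deriv u (dir_deriv v f))"
  shows "dir_deriv v (dir_deriv u f) x = dir_deriv u (dir_deriv v f) x"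
proof (rule tendsto_unique)
  show "((\<lambda>t. (f (x + t *\<^sub>R u + t *\<^sub>R v) - f (x + t *\<^sub>R u) - f (x + t *\<^sub>R v) + f x) / t\<^sup>2)
    \<longlongrightarrow> dir_deriv v (dir_deriv u f) x) (at 0)"
    by (rule double_difference_tendsto[OF assms(1,2,3,5,7)])
  have "((\<lambda>t. (f (x + t *\<^sub>R v + t *\<^sub>R u) - f (x + t *\<^sub>R v) - f (x + t *\<^sub>R u) + f x) / t\<^sup>2)
    \<longlongrightarrow> dir_deriv u (dir_deriv v f) x) (at 0)"
    by (rule double_difference_tendsto[OF assms(1,2,4,6,8)])
  then show "((\<lambda>t. (f (x + t *\<^sub>R u + t *\<^sub>R v) - f (x + t *\<^sub>R u) - f (x + t *\<^sub>R v) + f x) / t\<^sup>2)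
    \<longlongrightarrow> dir_deriv u (dir_deriv v f) x) (at 0)"
    by (simp add: algebra_simps)
qed simp

text \<open>
  The directions are indexed by labels, and a down-closed predicate \<open>P\<close> on multisets of labels
  says which iterated derivatives are required to exist and to be continuous.
\<close>

definition diff_class ::
  "'a::real_normed_vector set \<Rightarrow> ('i \<Rightarrow> 'a) \<Rightarrow> ('i multiset \<Rightarrow> bool) \<Rightarrow> ('a \<Rightarrow> real) \<Rightarrow> bool" where
  "diff_class S d P f \<longleftrightarrow> (\<forall>ws. P (mset ws) \<longrightarrow>
     iter_deriv_exists_on S (map d ws) f \<and> continuous_on S (iter_deriv (map d ws) f))"

text \<open>Induction on the length. If the outermost directions agree, the tails are permutations
  of each other; if not, both lists are rearranged to differ by one exchange of the two outermost
  directions, which is Schwarz's theorem. Down-closedness supplies the regularity of all shorter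
  lists.\<close>

lemma iter_deriv_perm:
  assumes "open S" and f: "diff_class S d P f"
    and down: "\<And>A B. P B \<Longrightarrow> A \<subseteq># B \<Longrightarrow> P A"
    and "P (mset ws)" "mset ws = mset ws'" "x \<in> S"
  shows "iter_deriv (map d ws) f x = iter_deriv (map d ws') f x"
  using assms(4-6)
proof (induction "length ws" arbitrary: ws ws' x rule: less_induct)
  case less
  have cong: "iter_deriv (map d (w # us)) f y = iter_deriv (map d (w # us')) f y"
    if "P (mset (w # us))" "mset us = mset us'" "length (w # us) = length ws" "y \<in> S" for w us us' y
  proof -
    have "P (mset us)"
      using that(1) by (rule down) simp
    then show ?thesis
      unfolding list.map iter_deriv_Cons
      using that by (intro dir_deriv_cong_open[OF \<open>open S\<close>] less.hyps) auto
  qed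
  show ?case
  proof (cases ws)
    case Nil
    then show ?thesis
      using less.prems by simp
  next
    case (Cons u us)
    then obtain v vs where ws': "ws' = v # vs"
      using less.prems by (cases ws') auto
    have eq: "add_mset u (mset us) = add_mset v (mset vs)"
      using less.prems Cons ws' by simp
    show ?thesis
    proof (cases "u = v")
      case True
      then show ?thesis
        using cong[of u us vs x] less.prems eq unfolding Cons ws' by simp
    next
      case False
      then have "v \<in># mset us"
        using eq by (metis insert_noteq_member)
      \<comment> \<open>The lists are brought to the forms \<open>u # v # zs\<close> and
        \<open>v # u # zs\<close>, which share the tail \<open>zs\<close>.\<close>
      obtain zs where "mset zs = mset us - {#v#}"
        using ex_mset by blast
      then have us: "mset us = mset (v # zs)"
        using \<open>v \<in># mset us\<close> by simp
      then have vs: "mset vs = mset (u # zs)"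
        using eq by (simp add: add_mset_commute)
      have P: "P (mset (u # v # zs))"
        using less.prems(1) us unfolding Cons by simp
      have fine: "iter_deriv_exists_on S (map d ys) f \<and> continuous_on S (iter_deriv (map d ys) f)"
        if "mset ys \<subseteq># mset (u # v # zs)" for ys
        using f down[OF P that] by (simp add: diff_class_def)
      let ?g = "iter_deriv (map d zs) f"
      have "iter_deriv (map d ws) f x = iter_deriv (map d (u # v # zs)) f x"
        unfolding Cons by (rule cong) (use less.prems us mset_eq_length[OF us] Cons in auto)
      also have "\<dots> = iter_deriv (map d (v # u # zs)) f x"
        unfolding list.map iter_deriv_Cons
      proof (rule dir_deriv_commute[OF \<open>open S\<close> \<open>x \<in> S\<close>])
        show "(\<lambda>t. ?g (y + t *\<^sub>R d v)) differentiable at 0" if "y \<in> S" for y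
          using fine[of "v # zs"] that by simp
        show "(\<lambda>t. ?g (y + t *\<^sub>R d u)) differentiable at 0" if "y \<in> S" for y
          using fine[of "u # zs"] that by simp
        show "(\<lambda>t. dir_deriv (d v) ?g (y + t *\<^sub>R d u)) differentiable at 0" if "y \<in> S" for y
          using fine[of "u # v # zs"] that by simp
        show "(\<lambda>t. dir_deriv (d u) ?g (y + t *\<^sub>R d v)) differentiable at 0" if "y \<in> S" for y
          using fine[of "v # u # zs"] that by simp
        show "continuous_on S (dir_deriv (d u) (dir_deriv (d v) ?g))"
          using fine[of "u # v # zs"] by simp
        show "continuous_on S (dir_deriv (d v) (dir_deriv (d u) ?g))"
          using fine[of "v # u # zs"] by simp
      qed
      also have "\<dots> = iter_deriv (map d ws') f x"
        unfolding ws' by (rule cong) (use less.prems us vs mset_eq_length[OF us] Cons P in \<open>auto simp: add_mset_commute\<close>)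
      finally show ?thesis .
    qed
  qed
qed

section \<open>Positive definiteness of mixed derivatives\<close>

lemma kform_concat:
  "kform G (concat (map F xs)) (concat (map F' ys)) = (\<Sum>a\<leftarrow>xs. \<Sum>b\<leftarrow>ys. kform G (F a) (F' b))"
proof -
  have "kform G us (concat (map F' ys)) = (\<Sum>b\<leftarrow>ys. kform G us (F' b))" for us
    by (induction ys) (simp_all add: kform_append_right)
  then show ?thesis
    by (induction xs) (simp_all add: kform_append_left)
qed

text \<open>
  Point evaluations may be complemented by a derivative \<open>p\<close> of point evaluations along \<open>q\<close>:
  in a quadratic form, \<open>p\<close> is the limit of the difference quotients of \<open>q\<close>.
\<close>

lemma psd_on_insert_derivative:
  fixes q :: "real \<Rightarrow> 'a"
  assumes psd: "psd_on I G" and "qz \<in> I" and q: "\<forall>\<^sub>F t in at 0. q t \<in> I"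
    and sym: "\<And>j. j \<in> I \<Longrightarrow> G j p = G p j"
    and lim1: "\<And>j. j \<in> I \<Longrightarrow> ((\<lambda>t. (G (q t) j - G qz j) / t) \<longlongrightarrow> G p j) (at 0)"
    and lim2: "((\<lambda>t. (G (q t) (q t) - G qz (q t) - G (q t) qz + G qz qz) / t\<^sup>2) \<longlongrightarrow> G p p) (at 0)"
  shows "psd_on (insert p I) G"
  unfolding psd_on_def
proof (intro conjI ballI allI impI)
  show "G x y = G y x" if "x \<in> insert p I" "y \<in> insert p I" for x y
    using that sym psd_onD_sym[OF psd] by fastforce
next
  fix xs :: "(real \<times> 'a) list" assume xs: "snd ` set xs \<subseteq> insert p I"
  \<comment> \<open>An entry outside \<open>I\<close> sits at \<open>p\<close> and is replaced by
    the difference quotient of the point masses at \<open>q t\<close> and \<open>qz\<close>.\<close>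
  define F where "F t a = (if snd a \<in> I then [a] else [(fst a / t, q t), (- fst a / t, qz)])"
    for t :: real and a :: "real \<times> 'a"
  have lim: "((\<lambda>t. kform G (F t a) (F t b)) \<longlongrightarrow> fst a * fst b * G (snd a) (snd b)) (at 0)"
    if "a \<in> set xs" "b \<in> set xs" for a b
  proof -
    obtain c x where a: "a = (c, x)"
      by (cases a)
    obtain d y where b: "b = (d, y)"
      by (cases b)
    have xy: "x \<in> I \<or> x = p" "y \<in> I \<or> y = p"
      using subsetD[OF xs imageI[OF that(1)]] subsetD[OF xs imageI[OF that(2)]] by (auto simp: a b)
    have lim_y: "((\<lambda>t. c * d * ((G (q t) y - G qz y) / t)) \<longlongrightarrow> c * d * G p y) (at 0)" if "y \<in> I"
      by (rule tendsto_mult_left[OF lim1[OF that]])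
    have lim_x: "((\<lambda>t. c * d * ((G (q t) x - G qz x) / t)) \<longlongrightarrow> c * d * G p x) (at 0)" if "x \<in> I"
      by (rule tendsto_mult_left[OF lim1[OF that]])
    have lim_p: "((\<lambda>t. c * d * ((G (q t) (q t) - G qz (q t) - G (q t) qz + G qz qz) / t\<^sup>2)) \<longlongrightarrow> c * d * G p p) (at 0)"
      by (rule tendsto_mult_left[OF lim2])
    consider "x \<in> I" "y \<in> I" | "x \<notin> I" "x = p" "y \<in> I" | "x \<in> I" "y \<notin> I" "y = p"
      | "x \<notin> I" "x = p" "y \<notin> I" "y = p"
      using xy by blast
    then show ?thesis
    proof cases
      case 1
      then show ?thesis
        by (simp add: a b F_def)
    next
      case 2
      then have "(\<lambda>t. kform G (F t a) (F t b)) = (\<lambda>t. c * d * ((G (q t) y - G qz y) / t))"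
        by (auto simp: a b F_def kform_def fun_eq_iff diff_divide_distrib right_diff_distrib)
      then show ?thesis
        using lim_y[OF \<open>y \<in> I\<close>] 2
        by (simp add: a b)
    next
      case 3
      \<comment> \<open>\<open>lim1\<close> differentiates in the first argument only. The second
        argument is reached by symmetry, which is available as soon as \<open>q t\<close> lies in
        \<open>I\<close>.\<close>
      have "\<forall>\<^sub>F t in at 0. c * d * ((G (q t) x - G qz x) / t) = kform G (F t a) (F t b)"
        using q
      proof eventually_elim
        case (elim t)
        then have "G x (q t) = G (q t) x" "G x qz = G qz x"
          using psd_onD_sym[OF psd] \<open>x \<in> I\<close> \<open>qz \<in> I\<close> by auto
        then show ?case
          using 3 by (simp add: a b F_def kform_def diff_divide_distrib right_diff_distrib)
      qed
      from tendsto_cong[OF this, THEN iffD1, OF lim_x[OF \<open>x \<in> I\<close>]] show ?thesis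
        using 3 sym[of x] by (simp add: a b)
    next
      case 4
      then have "(\<lambda>t. kform G (F t a) (F t b)) =
          (\<lambda>t. c * d * ((G (q t) (q t) - G qz (q t) - G (q t) qz + G qz qz) / t\<^sup>2))"
        by (auto simp: a b F_def kform_def fun_eq_iff diff_divide_distrib add_divide_distrib
            right_diff_distrib distrib_left power2_eq_square)
      then show ?thesis
        using lim_p 4 by (simp add: a b)
    qed
  qed
  have "((\<lambda>t. kform G (concat (map (F t) xs)) (concat (map (F t) xs))) \<longlongrightarrow> kform G xs xs) (at 0)"
    unfolding kform_concat kform_def[of G xs xs] by (intro tendsto_sum_list lim)
  moreover have "\<forall>\<^sub>F t in at 0. 0 \<le> kform G (concat (map (F t) xs)) (concat (map (F t) xs))"
    using q
  proof eventually_elim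
    case (elim t)
    show ?case
      by (rule psd_onD_nonneg[OF psd]) (use elim \<open>qz \<in> I\<close> in \<open>auto simp: F_def split: if_splits\<close>)
  qed
  ultimately show "0 \<le> kform G xs xs"
    by (rule tendsto_lowerbound) simp
qed

text \<open>A quadratic form sees finitely many points, so derivatives of point evaluations may be
  adjoined one at a time in a finite induction.\<close>

lemma psd_on_finite_subsets:
  assumes "\<And>F. finite F \<Longrightarrow> F \<subseteq> S \<Longrightarrow> psd_on F G"
  shows "psd_on S G"
  unfolding psd_on_def
proof (intro conjI ballI allI impI)
  show "G x y = G y x" if "x \<in> S" "y \<in> S" for x y
    using psd_onD_sym[OF assms[of "{x, y}"]] that by simp
  show "0 \<le> kform G xs xs" if "snd ` set xs \<subseteq> S" for xs
    using psd_onD_nonneg[OF assms[of "snd ` set xs"]] that by simp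
qed

lemma psd_on_subset: "psd_on S G \<Longrightarrow> F \<subseteq> S \<Longrightarrow> psd_on F G"
  by (auto simp: psd_on_def)

lemma psd_on_reindex:
  assumes "psd_on S G" "\<And>x. x \<in> T \<Longrightarrow> \<phi> x \<in> S" "\<And>x y. x \<in> T \<Longrightarrow> y \<in> T \<Longrightarrow> H x y = G (\<phi> x) (\<phi> y)"
  shows "psd_on T H"
  unfolding psd_on_def
proof (intro conjI ballI allI impI)
  show "H x y = H y x" if "x \<in> T" "y \<in> T" for x y
    using psd_onD_sym[OF assms(1)] assms that by simp
  fix xs :: "(real \<times> 'b) list" assume xs: "snd ` set xs \<subseteq> T"
  have "kform H xs xs = kform G (map (map_prod id \<phi>) xs) (map (map_prod id \<phi>) xs)"
    unfolding kform_def map_map comp_def fst_map_prod snd_map_prod id_apply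
  proof (intro arg_cong[where f=sum_list] map_cong refl)
    fix p q assume "p \<in> set xs" "q \<in> set xs"
    then have "snd p \<in> T" "snd q \<in> T"
      using xs by auto
    then show "fst p * fst q * H (snd p) (snd q) = fst p * fst q * G (\<phi> (snd p)) (\<phi> (snd q))"
      by (simp add: assms(3))
  qed
  also have "0 \<le> \<dots>"
    using xs assms(2) by (intro psd_onD_nonneg[OF assms(1)]) auto
  finally show "0 \<le> kform H xs xs" .
qed

lemma positive_definite_kernel_psd_on:
  assumes "positive_definite_kernel S h"
  shows "psd_on S (\<lambda>x y. h (x, y))"
  unfolding psd_on_def
proof (intro conjI ballI allI impI)
  show "h (x, y) = h (y, x)" if "x \<in> S" "y \<in> S" for x y
    using assms that by (auto simp: positive_definite_kernel_def)
  fix xs :: "(real \<times> 'a) list" assume xs: "snd ` set xs \<subseteq> S"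
  define c where "c i = fst (xs ! i)" for i
  define x where "x i = snd (xs ! i)" for i
  have eq: "xs = map (\<lambda>i. (c i, x i)) [0..<length xs]"
    by (simp add: c_def x_def map_nth)
  have "x i \<in> S" if "i < length xs" for i
    using that xs nth_mem[OF that] unfolding x_def by blast
  then have "0 \<le> (\<Sum>i<length xs. \<Sum>j<length xs. c i * h (x i, x j) * c j)"
    using assms unfolding positive_definite_kernel_def by blast
  also have "\<dots> = kform (\<lambda>x y. h (x, y)) (map (\<lambda>i. (c i, x i)) [0..<length xs]) (map (\<lambda>i. (c i, x i)) [0..<length xs])"
    unfolding kform_upt by (simp add: mult_ac)
  finally show "0 \<le> kform (\<lambda>x y. h (x, y)) xs xs"
    by (simp add: eq[symmetric])
qed

section \<open>Mixed derivatives of kernels, indexed by lists of coordinates\<close>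

lemma length_mi_list: "length (mi_list \<alpha>) = mi_order \<alpha>"
  using sum_count_set[of "mi_list \<alpha>" UNIV] by (simp add: count_list_mi_list mi_order_def)

lemma mi_order_count_list: "mi_order (count_list is) = length is"
  using sum_count_set[of "is" UNIV] by (simp add: mi_order_def)

lemma mset_mi_list: "mset (mi_list (count_list is)) = mset is"
  by (rule multiset_eqI) (simp add: count_mset count_list_mi_list)

lemma Ck_eq_diff_class: "f \<in> Ck \<Theta> k \<longleftrightarrow> diff_class \<Theta> (\<lambda>i. axis i 1) (\<lambda>A. size A \<le> k) f"
  by (simp add: Ck_def diff_class_def)

lemma Ck_iter_deriv_perm:
  assumes "open \<Theta>" "f \<in> Ck \<Theta> k" "length is \<le> k" "mset is = mset js" "x \<in> \<Theta>"
  shows "iter_deriv (map (\<lambda>i. axis i 1) is) f x = iter_deriv (map (\<lambda>i. axis i 1) js) f x"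
  using assms(3-5)
  by (intro iter_deriv_perm[OF assms(1) assms(2)[unfolded Ck_eq_diff_class]])
    (auto dest: size_mset_mono mset_eq_length)

abbreviation kernel_iter_deriv where
  "kernel_iter_deriv ws \<equiv> iter_deriv (map kernel_dir ws)"

text \<open>The order condition of \<open>Ckk_closure\<close> as a predicate on multisets; it is
  down-closed, as reordering derivatives requires.\<close>

definition kernel_class :: "nat \<Rightarrow> ('n::finite + 'n) multiset \<Rightarrow> bool" where
  "kernel_class k A \<longleftrightarrow> size (filter_mset isl A) \<le> k \<and> size (filter_mset (\<lambda>w. \<not> isl w) A) \<le> k"

lemma kernel_class_mset:
  "kernel_class k (mset ws) \<longleftrightarrow>
    length (filter isl ws) \<le> k \<and> length (filter (\<lambda>w. \<not> isl w) ws) \<le> k"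
  by (simp add: kernel_class_def flip: mset_filter)

lemma kernel_class_Inl_Inr:
  "kernel_class k (mset (map Inl is @ map Inr js)) \<longleftrightarrow> length is \<le> k \<and> length js \<le> k"
  unfolding kernel_class_mset by (simp add: filter_map comp_def)

lemma kernel_class_mono: "kernel_class k B \<Longrightarrow> A \<subseteq># B \<Longrightarrow> kernel_class k A"
  unfolding kernel_class_def by (meson le_trans multiset_filter_mono size_mset_mono)

lemma Ckk_closureD:
  assumes "h \<in> Ckk_closure \<Theta> k" "kernel_class k (mset ws)"
  shows "iter_deriv_exists_on (\<Theta> \<times> \<Theta>) (map kernel_dir ws) h"
    and "uniformly_continuous_on (\<Theta> \<times> \<Theta>) (kernel_iter_deriv ws h)"
  using assms by (auto simp: Ckk_closure_def kernel_class_mset)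

lemma Ckk_closure_diff_class:
  "h \<in> Ckk_closure \<Theta> k \<Longrightarrow> diff_class (\<Theta> \<times> \<Theta>) kernel_dir (kernel_class k) h"
  by (auto simp: diff_class_def Ckk_closureD uniformly_continuous_imp_continuous)

lemma kernel_iter_deriv_perm:
  assumes "open \<Theta>" "h \<in> Ckk_closure \<Theta> k" "kernel_class k (mset ws)" "mset ws = mset ws'"
    "x \<in> \<Theta>" "y \<in> \<Theta>"
  shows "kernel_iter_deriv ws h (x, y) = kernel_iter_deriv ws' h (x, y)"
  by (rule iter_deriv_perm[OF open_Times[OF assms(1,1)] Ckk_closure_diff_class[OF assms(2)]
        kernel_class_mono assms(3,4)]) (use assms in auto)

lemma iter_deriv_swap:
  "iter_deriv (map prod.swap vs) (\<lambda>p. f (prod.swap p)) = (\<lambda>p. iter_deriv vs f (prod.swap p))"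
proof (induction vs)
  case (Cons v vs)
  have "prod.swap (p + t *\<^sub>R prod.swap v) = prod.swap p + t *\<^sub>R v" for p and t :: real
    by (cases p; cases v) simp
  then show ?case
    unfolding list.map iter_deriv_Cons Cons.IH dir_deriv_def by simp
qed simp

text \<open>By the symmetry of \<open>h\<close>, swapping the variables exchanges the two kinds of
  derivatives; Schwarz's theorem then restores the order in which the first variable is listed
  first.\<close>

lemma kernel_iter_deriv_commute:
  assumes "open \<Theta>" and h: "h \<in> Ckk_closure \<Theta> k" and "length is \<le> k" "length js \<le> k"
    and xy: "x \<in> \<Theta>" "y \<in> \<Theta>"
    and sym: "\<And>x y. x \<in> \<Theta> \<Longrightarrow> y \<in> \<Theta> \<Longrightarrow> h (x, y) = h (y, x)"
  shows "kernel_iter_deriv (map Inl is @ map Inr js) h (x, y) =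
    kernel_iter_deriv (map Inl js @ map Inr is) h (y, x)"
proof -
  let ?ws = "map Inl is @ map Inr js" and ?ws' = "map Inr is @ map Inl js"
  have swap: "map prod.swap (map kernel_dir ?ws') = map kernel_dir ?ws"
    by simp
  have "kernel_iter_deriv ?ws h (x, y) = kernel_iter_deriv ?ws (\<lambda>p. h (prod.swap p)) (x, y)"
    by (rule iter_deriv_cong_open[of "\<Theta> \<times> \<Theta>"]) (use assms in \<open>auto intro: open_Times\<close>)
  also have "\<dots> = kernel_iter_deriv ?ws' h (y, x)"
    unfolding swap[symmetric] iter_deriv_swap by simp
  also have "\<dots> = kernel_iter_deriv (map Inl js @ map Inr is) h (y, x)"
  proof (rule kernel_iter_deriv_perm[OF \<open>open \<Theta>\<close> h _ _ xy(2,1)])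
    show "kernel_class k (mset ?ws')"
      unfolding kernel_class_mset using assms by (simp add: filter_map comp_def)
  qed simp
  finally show ?thesis .
qed

text \<open>Induction on the maximal order of the derivatives. They are indexed by lists rather than
  multi-indices, so that raising the order by one is \<open>Cons\<close>: evaluating the derivative
  \<open>i # js\<close> at \<open>x\<close> is the derivative of evaluating \<open>js\<close> along
  the line in direction \<open>i\<close>.\<close>

lemma kernel_iter_deriv_psd:
  fixes \<Theta> :: "(real^'n::finite) set"
  assumes "open \<Theta>" and h: "h \<in> Ckk_closure \<Theta> k" and pd: "positive_definite_kernel \<Theta> h"
  shows "psd_on ({is. length is \<le> k} \<times> \<Theta>)
    (\<lambda>p q. kernel_iter_deriv (map Inl (fst p) @ map Inr (fst q)) h (snd p, snd q))"
    (is "psd_on _ ?G")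
proof -
  have h_sym: "h (x, y) = h (y, x)" if "x \<in> \<Theta>" "y \<in> \<Theta>" for x y
    using pd that by (auto simp: positive_definite_kernel_def)
  have sym: "?G p q = ?G q p" if "p \<in> {is. length is \<le> k} \<times> \<Theta>" "q \<in> {is. length is \<le> k} \<times> \<Theta>" for p q
    using that by (intro kernel_iter_deriv_commute[OF \<open>open \<Theta>\<close> h] h_sym) auto
  have "psd_on ({is. length is \<le> m} \<times> \<Theta>) ?G" if "m \<le> k" for m
    using that
  proof (induction m)
    case 0
    show ?case
      by (rule psd_on_reindex[OF positive_definite_kernel_psd_on[OF pd], of _ snd]) auto
  next
    case (Suc m)
    let ?I = "{is. length is \<le> m} \<times> \<Theta>"
    \<comment> \<open>New points of order \<open>Suc m\<close> are added singly. Keeping all of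
      \<open>?I\<close> in the index set provides the points of order \<open>m\<close> along which
      the difference quotients are taken.\<close>
    have "psd_on (?I \<union> F) ?G" if "finite F" "F \<subseteq> {is. length is \<le> Suc m} \<times> \<Theta>" for F
      using that
    proof (induction F rule: finite_induct)
      case empty
      then show ?case
        using Suc by simp
    next
      case (insert p F)
      obtain "is" x where p: "p = (is, x)"
        by (cases p)
      have x: "x \<in> \<Theta>" and len: "length is \<le> Suc m"
        using insert.prems p by auto
      have I: "?I \<union> F \<subseteq> {is. length is \<le> k} \<times> \<Theta>"
        using insert.prems Suc.prems by force
      show ?case
      proof (cases "length is \<le> m")
        case True
        then have "p \<in> ?I"
          using p x by simp
        then show ?thesis
          using insert by (simp add: insert_absorb)
      next
        case False
        then obtain i js where "is": "is = i # js" and js: "length js = m"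
          using len by (cases "is") auto
        let ?e = "axis i 1 :: real^'n"
        have "psd_on (insert p (?I \<union> F)) ?G"
        proof (rule psd_on_insert_derivative[where qz="(js, x)" and q="\<lambda>t. (js, x + t *\<^sub>R ?e)"])
          show "psd_on (?I \<union> F) ?G"
            using insert by simp
          show "(js, x) \<in> ?I \<union> F"
            using js x by simp
          have "\<forall>\<^sub>F t in nhds 0. (js, x + t *\<^sub>R ?e) \<in> ?I \<union> F"
            by (rule eventually_mono[OF eventually_line_in_open[OF \<open>open \<Theta>\<close> x, of ?e]]) (simp add: js)
          then show "\<forall>\<^sub>F t in at 0. (js, x + t *\<^sub>R ?e) \<in> ?I \<union> F"
            by (simp add: eventually_at_filter eventually_mono)
          show "?G q p = ?G p q" if "q \<in> ?I \<union> F" for q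
            using I that insert.prems Suc.prems by (intro sym) auto
          show "((\<lambda>t. (?G (js, x + t *\<^sub>R ?e) q - ?G (js, x) q) / t) \<longlongrightarrow> ?G p q) (at 0)"
            if "q \<in> ?I \<union> F" for q
          proof -
            obtain ls y where q: "q = (ls, y)"
              by (cases q)
            have ls: "length ls \<le> k" and y: "y \<in> \<Theta>"
              using I that q by auto
            let ?f = "kernel_iter_deriv (map Inl js @ map Inr ls) h"
            have "iter_deriv_exists_on (\<Theta> \<times> \<Theta>) (map kernel_dir (map Inl is @ map Inr ls)) h"
              by (rule Ckk_closureD(1)[OF h kernel_class_Inl_Inr[THEN iffD2]])
                (use "is" js ls Suc.prems in simp)
            then have "(\<lambda>t. ?f ((x, y) + t *\<^sub>R kernel_dir (Inl i))) differentiable (at 0)"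
              using x y by (simp add: "is")
            from has_dir_deriv_0[OF this]
            have "((\<lambda>t. (?f ((x, y) + t *\<^sub>R kernel_dir (Inl i)) - ?f (x, y)) / t)
                \<longlongrightarrow> dir_deriv (kernel_dir (Inl i)) ?f (x, y)) (at 0)"
              unfolding DERIV_def by simp
            then show ?thesis
              by (simp add: p q "is")
          qed
          let ?f = "kernel_iter_deriv (map Inl js @ map Inr js) h"
          have cls: "kernel_class k (mset ws)"
            if "mset ws \<subseteq># mset (map Inl is @ map Inr is)" for ws
            by (rule kernel_class_mono[OF kernel_class_Inl_Inr[THEN iffD2] that])
              (use "is" js Suc.prems in simp)
          have "((\<lambda>t. (?f ((x, x) + t *\<^sub>R kernel_dir (Inr i) + t *\<^sub>R kernel_dir (Inl i))
              - ?f ((x, x) + t *\<^sub>R kernel_dir (Inr i)) - ?f ((x, x) + t *\<^sub>R kernel_dir (Inl i)) + ?f (x, x)) / t\<^sup>2)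
              \<longlongrightarrow> dir_deriv (kernel_dir (Inl i)) (dir_deriv (kernel_dir (Inr i)) ?f) (x, x)) (at 0)"
          proof (rule double_difference_tendsto[of "\<Theta> \<times> \<Theta>"])
            have "kernel_class k (mset (Inl i # Inr i # map Inl js @ map Inr js))"
              by (rule cls) (simp add: "is")
            note fine = Ckk_closureD[OF h this]
            show "(\<lambda>t. ?f (y + t *\<^sub>R kernel_dir (Inr i))) differentiable (at 0)" if "y \<in> \<Theta> \<times> \<Theta>" for y
              using fine(1) that by (cases y) simp
            show "(\<lambda>t. dir_deriv (kernel_dir (Inr i)) ?f (y + t *\<^sub>R kernel_dir (Inl i))) differentiable (at 0)"
              if "y \<in> \<Theta> \<times> \<Theta>" for y
              using fine(1) that by (cases y) simp
            show "continuous_on (\<Theta> \<times> \<Theta>) (dir_deriv (kernel_dir (Inl i)) (dir_deriv (kernel_dir (Inr i)) ?f))"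
              using uniformly_continuous_imp_continuous[OF fine(2)] by simp
          qed (use x \<open>open \<Theta>\<close> in \<open>auto intro: open_Times\<close>)
          \<comment> \<open>The double difference yields the two new derivatives outermost, whereas
            \<open>?G p p\<close> lists all derivatives in the first variable before those in the
            second.\<close>
          moreover have "dir_deriv (kernel_dir (Inl i)) (dir_deriv (kernel_dir (Inr i)) ?f) (x, x) = ?G p p"
            using kernel_iter_deriv_perm[OF \<open>open \<Theta>\<close> h cls, of "Inl i # Inr i # map Inl js @ map Inr js"
              "map Inl is @ map Inr is" x x] x by (simp add: p "is")
          ultimately show "((\<lambda>t. (?G (js, x + t *\<^sub>R ?e) (js, x + t *\<^sub>R ?e) - ?G (js, x) (js, x + t *\<^sub>R ?e)
              - ?G (js, x + t *\<^sub>R ?e) (js, x) + ?G (js, x) (js, x)) / t\<^sup>2) \<longlongrightarrow> ?G p p) (at 0)"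
            by simp
        qed
        then show ?thesis
          by simp
      qed
    qed
    note * = this
    show ?case
      by (rule psd_on_finite_subsets) (rule psd_on_subset[OF * Un_upper2])
  qed
  then show ?thesis
    by simp
qed

section \<open>Smooth bump functions\<close>

text \<open>\<open>flat 0\<close> is the classical function \<open>exp (- 1 / t)\<close>, continued
  by 0. The powers of \<open>inverse t\<close> are included because they arise by differentiation;
  with them the family is closed under derivatives up to linear combinations.\<close>

definition flat :: "nat \<Rightarrow> real \<Rightarrow> real" where
  "flat k t = (if 0 < t then inverse t ^ k * exp (- inverse t) else 0)"

lemma flat_at_right_0: "(flat k \<longlongrightarrow> 0) (at_right 0)"
proof -
  have "((\<lambda>t. inverse t ^ k / exp (inverse t)) \<longlongrightarrow> 0) (at_right (0::real))"
    by (rule filterlim_compose[OF tendsto_power_div_exp_0 filterlim_inverse_at_top_right])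
  moreover have "\<forall>\<^sub>F t in at_right 0. inverse t ^ k / exp (inverse t) = flat k t"
    using eventually_at_right_less[of 0]
    by eventually_elim (simp add: flat_def exp_minus divide_inverse)
  ultimately show ?thesis
    by (rule Lim_transform_eventually)
qed

lemma has_real_derivative_flat:
  "(flat k has_real_derivative (flat (k + 2) t - real k * flat (k + 1) t)) (at t)"
proof -
  consider "0 < t" | "t < 0" | "t = 0"
    by linarith
  then show ?thesis
  proof cases
    case 1
    have inv: "(inverse has_real_derivative - (inverse t * inverse t)) (at t)"
      using 1 by (auto intro!: derivative_eq_intros)
    have "((\<lambda>t. inverse t ^ k * exp (- inverse t)) has_real_derivative
        real k * (- (inverse t * inverse t) * inverse t ^ (k - Suc 0)) * exp (- inverse t) +
        exp (- inverse t) * (- (- (inverse t * inverse t))) * inverse t ^ k) (at t)"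
      by (intro DERIV_mult DERIV_power DERIV_fun_exp DERIV_minus inv)
    also have "real k * (- (inverse t * inverse t) * inverse t ^ (k - Suc 0)) * exp (- inverse t) +
        exp (- inverse t) * (- (- (inverse t * inverse t))) * inverse t ^ k =
        flat (k + 2) t - real k * flat (k + 1) t"
      using 1 by (cases k) (simp_all add: flat_def)
    finally have "((\<lambda>t. inverse t ^ k * exp (- inverse t)) has_real_derivative
        (flat (k + 2) t - real k * flat (k + 1) t)) (at t)" .
    then show ?thesis
      by (rule has_field_derivative_transform_within_open[of _ _ _ "{0<..}"]) (use 1 in \<open>auto simp: flat_def\<close>)
  next
    case 2
    have "((\<lambda>t. 0) has_real_derivative 0) (at t)"
      by simp
    then have "(flat k has_real_derivative 0) (at t)"
      by (rule has_field_derivative_transform_within_open[of _ _ _ "{..<0}"]) (use 2 in \<open>auto simp: flat_def\<close>)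
    then show ?thesis
      using 2 by (simp add: flat_def)
  next
    case 3
    \<comment> \<open>At 0 the difference quotient of \<open>flat k\<close> is
      \<open>flat (Suc k)\<close> on the right, so the family also provides its own derivative
      there.\<close>
    have "((\<lambda>h. flat k h / h) \<longlongrightarrow> 0) (at_right 0)"
    proof (rule Lim_transform_eventually[OF flat_at_right_0[of "Suc k"]])
      show "\<forall>\<^sub>F t in at_right 0. flat (Suc k) t = flat k t / t"
        by (intro always_eventually allI) (simp add: flat_def divide_inverse)
    qed
    moreover have "((\<lambda>h. flat k h / h) \<longlongrightarrow> 0) (at_left 0)"
    proof (rule Lim_transform_eventually[OF tendsto_const])
      show "\<forall>\<^sub>F t in at_left 0. 0 = flat k t / t"
        using eventually_at_left_real[of "-1" 0, simplified]
        by eventually_elim (simp add: flat_def)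
    qed
    ultimately have "((\<lambda>h. flat k h / h) \<longlongrightarrow> 0) (at 0)"
      by (rule filterlim_split_at[rotated])
    then show ?thesis
      using 3 by (simp add: DERIV_def flat_def)
  qed
qed

lemma flat_0_bounds: "0 \<le> flat 0 t" "flat 0 t \<le> 1"
  by (auto simp: flat_def)

text \<open>A class closed under partial derivatives by its construction, so that smoothness of all
  orders follows from a single induction over lists of coordinates.\<close>

inductive_set flat_algebra :: "(real^'n::finite \<Rightarrow> real) set" where
  flat: "(\<lambda>x. flat k (c * x $ i + d)) \<in> flat_algebra"
| const: "(\<lambda>x. c) \<in> flat_algebra"
| add: "f \<in> flat_algebra \<Longrightarrow> g \<in> flat_algebra \<Longrightarrow> (\<lambda>x. f x + g x) \<in> flat_algebra"
| mult: "f \<in> flat_algebra \<Longrightarrow> g \<in> flat_algebra \<Longrightarrow> (\<lambda>x. f x * g x) \<in> flat_algebra"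

lemma flat_algebra_prod:
  "(\<And>a. a \<in> A \<Longrightarrow> f a \<in> flat_algebra) \<Longrightarrow> (\<lambda>x. \<Prod>a\<in>A. f a x) \<in> flat_algebra"
  by (induction A rule: infinite_finite_induct) (auto intro: flat_algebra.intros)

lemma flat_algebra_deriv:
  "f \<in> flat_algebra \<Longrightarrow> \<exists>f'\<in>flat_algebra. \<forall>x. ((\<lambda>t. f (x + t *\<^sub>R axis i 1)) has_real_derivative f' x) (at 0)"
proof (induction rule: flat_algebra.induct)
  case (flat k c j d)
  let ?c = "if i = j then c else 0"
  have der: "((\<lambda>t. flat k (c * (x + t *\<^sub>R axis i 1) $ j + d)) has_real_derivative
      (flat (k + 2) (c * x $ j + d) + (- real k) * flat (k + 1) (c * x $ j + d)) * ?c) (at 0)" for x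
  proof (rule DERIV_chain2[where f="flat k" and g="\<lambda>t. c * (x + t *\<^sub>R axis i 1) $ j + d"])
    show "(flat k has_real_derivative
        (flat (k + 2) (c * x $ j + d) + (- real k) * flat (k + 1) (c * x $ j + d)))
        (at (c * (x + 0 *\<^sub>R axis i 1) $ j + d))"
      using has_real_derivative_flat[of k "c * x $ j + d"] by simp
    show "((\<lambda>t. c * (x + t *\<^sub>R axis i 1) $ j + d) has_real_derivative ?c) (at 0)"
      by (auto intro!: derivative_eq_intros simp: axis_def)
  qed
  have mem: "(\<lambda>x. (flat (k + 2) (c * x $ j + d) + (- real k) * flat (k + 1) (c * x $ j + d)) * ?c)
      \<in> flat_algebra"
    by (intro flat_algebra.intros)
  show ?case
    by (rule bexI[OF _ mem], rule allI, rule der)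
next
  case (const c)
  then show ?case
    by (intro bexI[of _ "\<lambda>_. 0"]) (auto intro: flat_algebra.intros)
next
  case (add f g)
  then obtain f' g' where "f' \<in> flat_algebra" "g' \<in> flat_algebra"
    "\<forall>x. ((\<lambda>t. f (x + t *\<^sub>R axis i 1)) has_real_derivative f' x) (at 0)"
    "\<forall>x. ((\<lambda>t. g (x + t *\<^sub>R axis i 1)) has_real_derivative g' x) (at 0)"
    by blast
  then show ?case
    by (intro bexI[of _ "\<lambda>x. f' x + g' x"] allI DERIV_add) (auto intro: flat_algebra.intros)
next
  case (mult f g)
  then obtain f' g' where *: "f' \<in> flat_algebra" "g' \<in> flat_algebra"
    "\<forall>x. ((\<lambda>t. f (x + t *\<^sub>R axis i 1)) has_real_derivative f' x) (at 0)"
    "\<forall>x. ((\<lambda>t. g (x + t *\<^sub>R axis i 1)) has_real_derivative g' x) (at 0)"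
    by blast
  have "((\<lambda>t. f (x + t *\<^sub>R axis i 1) * g (x + t *\<^sub>R axis i 1)) has_real_derivative f' x * g x + g' x * f x) (at 0)" for x
    using DERIV_mult[OF *(3,4)[rule_format, of x]] by simp
  then show ?case
    using * mult by (intro bexI[of _ "\<lambda>x. f' x * g x + g' x * f x"]) (auto intro!: flat_algebra.intros)
qed

lemma flat_algebra_continuous: "f \<in> flat_algebra \<Longrightarrow> continuous_on UNIV f"
proof (induction rule: flat_algebra.induct)
  case (flat k c i d)
  have "continuous_on UNIV (flat k)"
    using has_real_derivative_flat DERIV_isCont by (metis continuous_at_imp_continuous_on)
  then show ?case
    by (rule continuous_on_compose2) (auto intro!: continuous_intros)
qed (auto intro: continuous_intros)

lemma flat_algebra_Ck:
  assumes "f \<in> flat_algebra"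
  shows "f \<in> Ck UNIV k"
proof -
  have "iter_deriv (map (\<lambda>i. axis i 1) is) f \<in> flat_algebra \<and>
      iter_deriv_exists_on UNIV (map (\<lambda>i. axis i 1) is) f" for "is"
  proof (induction "is")
    case Nil
    then show ?case
      using assms by simp
  next
    case (Cons i "is")
    let ?g = "iter_deriv (map (\<lambda>i. axis i 1) is) f"
    obtain g' where g': "g' \<in> flat_algebra"
      "\<And>x. ((\<lambda>t. ?g (x + t *\<^sub>R axis i 1)) has_real_derivative g' x) (at 0)"
      using flat_algebra_deriv Cons by blast
    then have "dir_deriv (axis i 1) ?g = g'"
      using dir_derivI(1) by blast
    then show ?case
      using g' Cons dir_derivI(2)[OF g'(2)] by simp
  qed
  then show ?thesis
    using flat_algebra_continuous by (auto simp: Ck_def)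
qed

text \<open>A smooth approximation of the indicator of the open box. The factor \<open>Suc m\<close>
  drives every positive argument to infinity, where \<open>flat 0\<close> tends to 1; outside the
  box some factor is 0.\<close>

definition box_bump :: "nat \<Rightarrow> real^'n::finite \<Rightarrow> real^'n \<Rightarrow> real^'n \<Rightarrow> real" where
  "box_bump m a b x =
     (\<Prod>i\<in>UNIV. flat 0 (real (Suc m) * (x $ i - a $ i)) * flat 0 (real (Suc m) * (b $ i - x $ i)))"

lemma box_bump_eq_0: "x \<notin> box a b \<Longrightarrow> box_bump m a b x = 0"
  unfolding box_bump_def mem_box_cart
  by (auto simp: flat_def prod_zero_iff mult_pos_pos zero_less_mult_iff)

lemma box_bump_bounds: "0 \<le> box_bump m a b x" "box_bump m a b x \<le> 1"
  unfolding box_bump_def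
  by (auto intro!: prod_nonneg prod_le_1 mult_nonneg_nonneg mult_le_one flat_0_bounds)

lemma box_bump_tendsto:
  fixes a b x :: "real^'n::finite"
  shows "(\<lambda>m. box_bump m a b x) \<longlonglongrightarrow> indicator (box a b) x"
proof (cases "x \<in> box a b")
  case True
  have one: "(\<lambda>m. flat 0 (real (Suc m) * s)) \<longlonglongrightarrow> 1" if "0 < s" for s
  proof -
    have "(\<lambda>m. inverse (real (Suc m)) * inverse s) \<longlonglongrightarrow> 0 * inverse s"
      by (rule tendsto_mult_right[OF LIMSEQ_inverse_real_of_nat])
    then have "(\<lambda>m. exp (- (inverse (real (Suc m)) * inverse s))) \<longlonglongrightarrow> exp (- (0 * inverse s))"
      by (intro tendsto_exp tendsto_minus)
    then show ?thesis
      using that by (simp add: flat_def zero_less_mult_iff)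
  qed
  have "(\<lambda>m. box_bump m a b x) \<longlonglongrightarrow> (\<Prod>i\<in>(UNIV::'n set). 1 * 1)"
    unfolding box_bump_def using True
    by (intro tendsto_prod tendsto_mult one) (auto simp: mem_box_cart)
  then show ?thesis
    using True by simp
qed (simp add: box_bump_eq_0)

lemma box_bump_test_function:
  assumes "cbox a b \<subseteq> \<Theta>"
  shows "box_bump m a b \<in> test_functions \<Theta>"
proof -
  have "(\<lambda>x. flat 0 (real (Suc m) * x $ i + (- real (Suc m) * a $ i)) *
      flat 0 (- real (Suc m) * x $ i + real (Suc m) * b $ i)) \<in> flat_algebra" for i
    by (intro flat_algebra.intros)
  then have "box_bump m a b \<in> flat_algebra"
    unfolding box_bump_def[abs_def] by (intro flat_algebra_prod) (simp add: algebra_simps)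
  then have "\<forall>k. box_bump m a b \<in> Ck UNIV k"
    using flat_algebra_Ck by blast
  moreover have sub: "closure {x. box_bump m a b x \<noteq> 0} \<subseteq> cbox a b"
    using box_bump_eq_0 box_subset_cbox by (intro closure_minimal) blast+
  moreover have "compact (closure {x. box_bump m a b x \<noteq> 0})"
    using sub bounded_cbox bounded_subset compact_closure by (metis closure_closure compact_eq_bounded_closed closed_closure)
  ultimately show ?thesis
    using assms unfolding test_functions_def by blast
qed

section \<open>The fundamental lemma of the calculus of variations\<close>

lemma integrable_lebesgue_on_iff:
  fixes f :: "'a::euclidean_space \<Rightarrow> real"
  assumes "S \<in> sets lebesgue"
  shows "integrable (lebesgue_on S) f \<longleftrightarrow> integrable lebesgue (\<lambda>x. indicator S x * f x)"
  using assms by (simp add: integrable_restrict_space)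

lemma integral_lebesgue_on:
  fixes f :: "'a::euclidean_space \<Rightarrow> real"
  assumes "S \<in> sets lebesgue"
  shows "integral\<^sup>L (lebesgue_on S) f = (\<integral>x. indicator S x * f x \<partial>lebesgue)"
  using assms by (simp add: integral_restrict_space)

lemma AE_lebesgue_on_iff:
  assumes "S \<in> sets lebesgue"
  shows "(AE x in lebesgue_on S. P x) \<longleftrightarrow> (AE x in lebesgue. x \<in> S \<longrightarrow> P x)"
  using assms by (simp add: AE_restrict_space_iff)

lemma open_in_lebesgue: "open S \<Longrightarrow> S \<in> sets lebesgue"
  by (simp add: borel_open)

text \<open>Local integrability speaks about compact sets only; measurability is glued from a
  countable cover of the open set by closed boxes.\<close>

lemma locally_integrable_measurable:
  assumes "open \<Theta>" "locally_integrable \<Theta> f"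
  shows "f \<in> borel_measurable (lebesgue_on \<Theta>)"
proof -
  obtain \<D> where \<D>: "countable \<D>" "\<D> \<subseteq> Pow \<Theta>" "\<And>X. X \<in> \<D> \<Longrightarrow> \<exists>a b. X = cbox a b" "\<Union>\<D> = \<Theta>"
    using open_countable_Union_open_cbox[OF assms(1)] by metis
  show ?thesis
  proof (rule measurable_piecewise_restrict[OF \<D>(1)])
    fix X assume X: "X \<in> \<D>"
    then have sub: "X \<subseteq> \<Theta>" and cX: "compact X"
      using \<D> compact_cbox by blast+
    show "X \<inter> space (lebesgue_on \<Theta>) \<in> sets (lebesgue_on \<Theta>)"
      using sub cX open_in_lebesgue[OF assms(1)]
      by (auto simp: sets_restrict_space_iff Int_absorb2 borel_compact intro!: sets_completionI_sets)
    have "f \<in> borel_measurable (lebesgue_on X)"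
      using assms(2) sub cX unfolding locally_integrable_def by (blast intro: borel_measurable_integrable)
    moreover have "restrict_space (lebesgue_on \<Theta>) X = lebesgue_on X"
      using sub by (simp add: restrict_restrict_space Int_absorb1 open_in_lebesgue assms(1)
          borel_compact cX sets_completionI_sets)
    ultimately show "f \<in> borel_measurable (restrict_space (lebesgue_on \<Theta>) X)"
      by simp
  qed (use \<D>(4) in simp)
qed

text \<open>The bump functions of the box are test functions, bounded by 1 and convergent to the
  indicator of the open box, so dominated convergence applies.\<close>

lemma integral_box_eq_0:
  fixes \<Theta> :: "(real^'n::finite) set"
  assumes "open \<Theta>" and g: "locally_integrable \<Theta> g"
    and zero: "\<And>\<phi>. \<phi> \<in> test_functions \<Theta> \<Longrightarrow> integral\<^sup>L (lebesgue_on \<Theta>) (\<lambda>x. g x * \<phi> x) = 0"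
    and sub: "cbox a b \<subseteq> \<Theta>"
  shows "integrable lebesgue (\<lambda>x. indicator (box a b) x * g x)"
    and "(\<integral>x. indicator (box a b) x * g x \<partial>lebesgue) = 0"
proof -
  have gi: "integrable lebesgue (\<lambda>x. indicator (cbox a b) x * g x)"
    using g sub compact_cbox by (subst integrable_lebesgue_on_iff[symmetric]) (auto simp: locally_integrable_def)
  have eq: "indicator (box a b) x * g x = indicator (box a b) x * (indicator (cbox a b) x * g x)" for x
    using box_subset_cbox[of a b] by (auto simp: indicator_def)
  have bump_eq: "box_bump m a b x * g x = box_bump m a b x * (indicator (cbox a b) x * g x)" for m x
    using box_bump_eq_0[of x a b m] box_subset_cbox[of a b] by (auto simp: indicator_def)
  have bump_meas: "box_bump m a b \<in> borel_measurable lebesgue" for m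
  proof -
    have "box_bump m a b \<in> Ck UNIV 0"
      using box_bump_test_function[OF sub] by (simp add: test_functions_def)
    then have "continuous_on UNIV (box_bump m a b)"
      by (simp add: Ck_def)
    then show ?thesis
      using borel_measurable_continuous_onI[of "box_bump m a b"] by (intro measurable_completion) simp
  qed
  have gm: "(\<lambda>x. indicator (cbox a b) x * g x) \<in> borel_measurable lebesgue"
    using gi by (rule borel_measurable_integrable)
  have im: "(\<lambda>x. indicator (box a b) x * (indicator (cbox a b) x * g x)) \<in> borel_measurable lebesgue"
    by (intro borel_measurable_times gm borel_measurable_indicator) (simp add: borel_open)
  show "integrable lebesgue (\<lambda>x. indicator (box a b) x * g x)"
    unfolding eq by (rule Bochner_Integration.integrable_bound[OF gi im]) (auto simp: indicator_def)
  have "(\<lambda>m. \<integral>x. box_bump m a b x * g x \<partial>lebesgue) \<longlonglongrightarrow> (\<integral>x. indicator (box a b) x * g x \<partial>lebesgue)"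
  proof (rule integral_dominated_convergence)
    show "AE x in lebesgue. (\<lambda>m. box_bump m a b x * g x) \<longlonglongrightarrow> indicator (box a b) x * g x"
      by (intro always_eventually allI tendsto_mult_right box_bump_tendsto)
    show "integrable lebesgue (\<lambda>x. \<bar>indicator (cbox a b) x * g x\<bar>)"
      using gi by simp
    show "AE x in lebesgue. norm (box_bump m a b x * g x) \<le> \<bar>indicator (cbox a b) x * g x\<bar>" for m
    proof (intro always_eventually allI)
      fix x
      have "\<bar>box_bump m a b x\<bar> * \<bar>indicator (cbox a b) x * g x\<bar> \<le> 1 * \<bar>indicator (cbox a b) x * g x\<bar>"
        using box_bump_bounds[of m a b x] by (intro mult_right_mono) auto
      then show "norm (box_bump m a b x * g x) \<le> \<bar>indicator (cbox a b) x * g x\<bar>"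
        unfolding bump_eq by (simp add: abs_mult)
    qed
    show "(\<lambda>x. indicator (box a b) x * g x) \<in> borel_measurable lebesgue"
      unfolding eq by (rule im)
    show "(\<lambda>x. box_bump m a b x * g x) \<in> borel_measurable lebesgue" for m
      unfolding bump_eq by (intro borel_measurable_times gm bump_meas)
  qed
  moreover have "(\<integral>x. box_bump m a b x * g x \<partial>lebesgue) = 0" for m
  proof -
    have "(\<lambda>x. indicator \<Theta> x * (g x * box_bump m a b x)) = (\<lambda>x. box_bump m a b x * g x)"
      using box_bump_eq_0[of _ a b m] box_subset_cbox[of a b] sub by (auto simp: indicator_def fun_eq_iff)
    then show ?thesis
      using zero[OF box_bump_test_function[OF sub, of m]]
      by (simp add: integral_lebesgue_on[OF open_in_lebesgue[OF assms(1)]])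
  qed
  ultimately show "(\<integral>x. indicator (box a b) x * g x \<partial>lebesgue) = 0"
    by (simp add: tendsto_const_iff)
qed

text \<open>Open boxes form an intersection-stable generator of the Borel sets, so vanishing
  integrals spread from boxes to all Borel sets. The hypothesis on the total integral is what
  handles complements.\<close>

lemma AE_eq_0_of_box_integrals:
  fixes G :: "'a::euclidean_space \<Rightarrow> real"
  assumes G: "integrable lebesgue G" and total: "(\<integral>x. G x \<partial>lebesgue) = 0"
    and boxes: "\<And>c d. (\<integral>x. indicator (box c d) x * G x \<partial>lebesgue) = 0"
  shows "AE x in lebesgue. G x = 0"
proof -
  \<comment> \<open>Boxes generate Borel sets, not Lebesgue sets, hence the passage to a Borel
    representative.\<close>
  obtain G' where G': "G' \<in> borel_measurable lborel" and ae: "AE x in lborel. G x = G' x"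
    using completion_ex_borel_measurable_real[OF borel_measurable_integrable[OF G]] by blast
  have [measurable]: "G' \<in> borel_measurable borel"
    using G' by simp
  have ae': "AE x in lebesgue. G x = G' x"
    by (rule AE_completion[OF ae])
  have G'_leb: "G' \<in> borel_measurable lebesgue"
    by (rule measurable_completion[OF G'])
  have "integrable lebesgue G'"
    by (rule Bochner_Integration.integrable_cong_AE_imp[OF G G'_leb]) (use ae' in auto)
  then have int: "integrable lborel G'"
    using integrable_completion[OF G'] by simp
  have transfer: "(\<integral>x. indicator A x * G' x \<partial>lborel) = (\<integral>x. indicator A x * G x \<partial>lebesgue)"
    if "A \<in> sets borel" for A
  proof -
    have "(\<integral>x. indicator A x * G' x \<partial>lborel) = (\<integral>x. indicator A x * G' x \<partial>lebesgue)"
      by (rule integral_completion[symmetric]) (use that in measurable)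
    also have "\<dots> = (\<integral>x. indicator A x * G x \<partial>lebesgue)"
      using ae' that G'_leb borel_measurable_integrable[OF G]
      by (intro integral_cong_AE borel_measurable_times borel_measurable_indicator) auto
    finally show ?thesis .
  qed
  have zero: "(\<integral>x. indicator A x * G' x \<partial>lborel) = 0" if A: "A \<in> sets borel" for A
  proof -
    have "Int_stable (range (\<lambda>(a, b). box a b :: 'a set))"
      by (auto simp: Int_stable_def box_Int_box)
    moreover have "(range (\<lambda>(a, b). box a b :: 'a set)) \<subseteq> Pow UNIV"
      by auto
    moreover have "A \<in> sigma_sets UNIV (range (\<lambda>(a, b). box a b))"
      using A unfolding borel_eq_box by simp
    ultimately show ?thesis
    proof (induction rule: sigma_sets_induct_disjoint)
      case (basic A)
      then obtain a b where "A = box a b"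
        by auto
      then show ?case
        using transfer[of "box a b"] boxes by (simp add: borel_open)
    next
      case empty
      then show ?case
        by simp
    next
      case (compl A)
      then have A: "A \<in> sets borel"
        by (simp add: borel_eq_box)
      have i: "integrable lborel (\<lambda>x. indicator A x * G' x)"
        by (rule Bochner_Integration.integrable_bound[OF int]) (use A in \<open>auto simp: indicator_def\<close>)
      have "(\<integral>x. indicator (UNIV - A) x * G' x \<partial>lborel) = (\<integral>x. G' x - indicator A x * G' x \<partial>lborel)"
        by (intro Bochner_Integration.integral_cong) (auto simp: indicator_def)
      also have "\<dots> = (\<integral>x. indicator UNIV x * G' x \<partial>lborel) - (\<integral>x. indicator A x * G' x \<partial>lborel)"
        using int i by simp
      also have "\<dots> = 0"
        using transfer[of UNIV] total compl by simp
      finally show ?case .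
    next
      case (union F)
      then have F: "F i \<in> sets borel" for i
        by (simp add: borel_eq_box subset_eq)
      then have UF: "(\<Union>i. F i) \<in> sets borel"
        by blast
      have "(LINT x:(\<Union>i. F i)|lborel. G' x) = (\<Sum>i. (LINT x:(F i)|lborel. G' x))"
      proof (rule lebesgue_integral_countable_add)
        show "set_integrable lborel (\<Union>i. F i) G'"
          unfolding set_integrable_def
          using UF borel_measurable_integrable[OF int]
          by (intro Bochner_Integration.integrable_bound[OF int] borel_measurable_scaleR borel_measurable_indicator)
            (auto simp: indicator_def)
      qed (use F union in \<open>auto simp: disjoint_family_on_def\<close>)
      then show ?case
        using union by (simp add: set_lebesgue_integral_def)
    qed
  qed
  have "AE x in lborel. G' x = 0"
    by (rule sigma_finite_measure.density_zero[OF sigma_finite_lborel int]) (simp add: set_lebesgue_integral_def zero)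
  with ae show ?thesis
    by (intro AE_completion) auto
qed

text \<open>It suffices to treat each closed box of a countable cover. There \<open>g\<close>, cut
  off to the open box, has vanishing integrals over all boxes, since intersecting with another box
  leaves a box whose closure is still inside the domain; the faces are negligible.\<close>

theorem fundamental_lemma_calculus_of_variations:
  fixes \<Theta> :: "(real^'n::finite) set"
  assumes "open \<Theta>" and g: "locally_integrable \<Theta> g"
    and zero: "\<And>\<phi>. \<phi> \<in> test_functions \<Theta> \<Longrightarrow> integral\<^sup>L (lebesgue_on \<Theta>) (\<lambda>x. g x * \<phi> x) = 0"
  shows "AE x in lebesgue_on \<Theta>. g x = 0"
proof -
  obtain \<D> where \<D>: "countable \<D>" "\<D> \<subseteq> Pow \<Theta>" "\<And>X. X \<in> \<D> \<Longrightarrow> \<exists>a b. X = cbox a b" "\<Union>\<D> = \<Theta>"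
    using open_countable_Union_open_cbox[OF assms(1)] by metis
  have "AE x in lebesgue. x \<in> X \<longrightarrow> g x = 0" if X: "X \<in> \<D>" for X
  proof -
    obtain a b where ab: "X = cbox a b"
      using \<D>(3)[OF X] by blast
    then have sub: "cbox a b \<subseteq> \<Theta>"
      using \<D>(2) X by blast
    have box0: "integrable lebesgue (\<lambda>x. indicator (box a b) x * g x)"
      "(\<integral>x. indicator (box a b) x * g x \<partial>lebesgue) = 0" if "cbox a b \<subseteq> \<Theta>" for a b
      using integral_box_eq_0[OF assms(1,2) _ that] zero by blast+
    have "AE x in lebesgue. indicator (box a b) x * g x = 0"
    proof (rule AE_eq_0_of_box_integrals[OF box0[OF sub]])
      fix c d
      obtain a' b' where Int: "box c d \<inter> box a b = box a' b'" and sub': "cbox a' b' \<subseteq> cbox a b"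
      proof
        let ?a = "\<Sum>i\<in>Basis. max (c \<bullet> i) (a \<bullet> i) *\<^sub>R i" and ?b = "\<Sum>i\<in>Basis. min (d \<bullet> i) (b \<bullet> i) *\<^sub>R i"
        show "box c d \<inter> box a b = box ?a ?b"
          by (rule box_Int_box)
        show "cbox ?a ?b \<subseteq> cbox a b"
          by (auto simp: mem_box)
      qed
      have "(\<lambda>x. indicator (box c d) x * (indicator (box a b) x * g x)) = (\<lambda>x. indicator (box a' b') x * g x)"
        unfolding Int[symmetric] by (simp add: indicator_inter_arith mult.assoc)
      then show "(\<integral>x. indicator (box c d) x * (indicator (box a b) x * g x) \<partial>lebesgue) = 0"
        using box0(2)[OF subset_trans[OF sub' sub]] by simp
    qed
    moreover have "AE x in lebesgue. x \<notin> cbox a b - box a b"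
      using negligible_frontier_interval[of a b] by (intro AE_not_in) (simp add: negligible_iff_null_sets)
    ultimately show ?thesis
      unfolding ab by eventually_elim (auto simp: indicator_def)
  qed
  then have "AE x in lebesgue. \<forall>X\<in>\<D>. x \<in> X \<longrightarrow> g x = 0"
    by (intro AE_ball_countable[THEN iffD2] \<D>(1) ballI)
  then have "AE x in lebesgue. x \<in> \<Theta> \<longrightarrow> g x = 0"
    by eventually_elim (use \<D>(4) in blast)
  then show ?thesis
    by (simp add: AE_lebesgue_on_iff open_in_lebesgue assms(1))
qed

section \<open>Integration by parts\<close>

text \<open>The mean value theorem bounds the difference quotients by \<open>B\<close>, and
  dominated convergence applies along every null sequence. Measurability of the derivative comes for
  free, as a pointwise limit of the quotients.\<close>

lemma has_real_derivative_integral: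
  fixes g g' :: "real \<Rightarrow> 'a \<Rightarrow> real"
  assumes "0 < r"
    and der: "\<And>t x. \<bar>t\<bar> < r \<Longrightarrow> x \<in> space M \<Longrightarrow> ((\<lambda>t. g t x) has_real_derivative g' t x) (at t)"
    and bound: "\<And>t x. \<bar>t\<bar> < r \<Longrightarrow> x \<in> space M \<Longrightarrow> \<bar>g' t x\<bar> \<le> B x"
    and B: "integrable M B"
    and int: "\<And>t. \<bar>t\<bar> < r \<Longrightarrow> integrable M (g t)"
  shows "((\<lambda>t. \<integral>x. g t x \<partial>M) has_real_derivative (\<integral>x. g' 0 x \<partial>M)) (at 0)"
    and "integrable M (g' 0)"
proof -
  have quotient_bound: "\<bar>(g t x - g 0 x) / t\<bar> \<le> B x" if t: "\<bar>t\<bar> < r" "t \<noteq> 0" and x: "x \<in> space M" for t x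
  proof -
    have small: "\<bar>s * t\<bar> < r" if "0 \<le> s" "s \<le> 1" for s
    proof -
      have "s * \<bar>t\<bar> \<le> 1 * \<bar>t\<bar>"
        by (rule mult_right_mono) (use that in auto)
      then have "\<bar>s * t\<bar> \<le> \<bar>t\<bar>"
        using that by (simp add: abs_mult)
      then show ?thesis
        using t(1) by linarith
    qed
    have "\<exists>s. 0 < s \<and> s < 1 \<and> g (1 * t) x - g (0 * t) x = (1 - 0) * (g' (s * t) x * t)"
    proof (rule MVT2)
      fix s :: real assume s: "0 \<le> s" "s \<le> 1"
      show "((\<lambda>s. g (s * t) x) has_real_derivative g' (s * t) x * t) (at s)"
        by (rule DERIV_chain2[where f="\<lambda>t. g t x" and g="\<lambda>s. s * t", OF der[OF small[OF s] x]])
          (auto intro!: derivative_eq_intros)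
    qed simp
    then obtain s where s: "0 < s" "s < 1" "g t x - g 0 x = g' (s * t) x * t"
      by auto
    then show ?thesis
      using t bound[OF small x, of s] by simp
  qed
  have lim: "(\<lambda>n. \<integral>x. (g (X n) x - g 0 x) / X n \<partial>M) \<longlonglongrightarrow> (\<integral>x. g' 0 x \<partial>M) \<and> integrable M (g' 0)"
    if X: "\<And>n. \<bar>X n\<bar> < r" "\<And>n. X n \<noteq> 0" "X \<longlonglongrightarrow> 0" for X :: "nat \<Rightarrow> real"
  proof -
    have pw: "(\<lambda>n. (g (X n) x - g 0 x) / X n) \<longlonglongrightarrow> g' 0 x" if "x \<in> space M" for x
    proof -
      have "((\<lambda>h. (g h x - g 0 x) / h) \<longlongrightarrow> g' 0 x) (at 0)"
        using der[of 0 x] that \<open>0 < r\<close> by (simp add: DERIV_def)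
      moreover have "filterlim X (at 0) sequentially"
        using X by (simp add: filterlim_at)
      ultimately show ?thesis
        by (rule filterlim_compose)
    qed
    have meas: "(\<lambda>x. (g (X n) x - g 0 x) / X n) \<in> borel_measurable M" for n
      using int[of "X n"] int[of 0] X(1) \<open>0 < r\<close> by (intro borel_measurable_divide borel_measurable_diff) auto
    have meas': "g' 0 \<in> borel_measurable M"
      by (rule borel_measurable_LIMSEQ_real[OF pw meas])
    have AE1: "AE x in M. (\<lambda>n. (g (X n) x - g 0 x) / X n) \<longlonglongrightarrow> g' 0 x"
      using pw by (intro AE_I2)
    have AE2: "AE x in M. norm ((g (X n) x - g 0 x) / X n) \<le> B x" for n
      using quotient_bound[OF X(1,2)] by (intro AE_I2) simp
    show ?thesis
      using integral_dominated_convergence[OF meas' meas B AE1 AE2]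
        integrable_dominated_convergence[OF meas' meas B AE1 AE2] by simp
  qed
  \<comment> \<open>One explicit null sequence inside the radius, from which the integrability of
    \<open>g' 0\<close> is read off.\<close>
  have "(\<lambda>n. r / 2 * inverse (real (Suc n))) \<longlonglongrightarrow> r / 2 * 0"
    by (rule tendsto_mult_left[OF LIMSEQ_inverse_real_of_nat])
  moreover have "\<bar>r / 2 * inverse (real (Suc n))\<bar> < r" for n
  proof -
    have "inverse (real (Suc n)) \<le> 1"
      by (simp add: field_simps)
    then have "r / 2 * inverse (real (Suc n)) \<le> r / 2 * 1"
      using \<open>0 < r\<close> by (intro mult_left_mono) auto
    then show ?thesis
      using \<open>0 < r\<close> by (simp add: abs_mult)
  qed
  ultimately show "integrable M (g' 0)"
    using lim[of "\<lambda>n. r / 2 * inverse (real (Suc n))"] \<open>0 < r\<close> by simp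
  show "((\<lambda>t. \<integral>x. g t x \<partial>M) has_real_derivative (\<integral>x. g' 0 x \<partial>M)) (at 0)"
    unfolding DERIV_def
  proof (subst tendsto_at_iff_sequentially, intro allI impI)
    fix X :: "nat \<Rightarrow> real"
    assume X: "\<forall>i. X i \<in> UNIV - {0}" "X \<longlonglongrightarrow> 0"
    have "\<forall>\<^sub>F n in sequentially. \<bar>X n\<bar> < r"
      using order_tendstoD(2)[OF tendsto_rabs[OF X(2)], of r] \<open>0 < r\<close> by simp
    \<comment> \<open>An arbitrary null sequence is only eventually inside the radius, so its tail
      is used.\<close>
    then obtain N where N: "\<And>n. N \<le> n \<Longrightarrow> \<bar>X n\<bar> < r"
      unfolding eventually_sequentially by blast
    have *: "(\<lambda>n. \<integral>x. (g (X (n + N)) x - g 0 x) / X (n + N) \<partial>M) \<longlonglongrightarrow> (\<integral>x. g' 0 x \<partial>M)"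
      using lim[of "\<lambda>n. X (n + N)"] N X LIMSEQ_ignore_initial_segment[OF X(2), of N] by simp
    have eq: "(\<integral>x. (g (X (n + N)) x - g 0 x) / X (n + N) \<partial>M) =
        ((\<integral>x. g (0 + X (n + N)) x \<partial>M) - (\<integral>x. g 0 x \<partial>M)) / X (n + N)" for n
      using int[of "X (n + N)"] int[of 0] N[of "n + N"] \<open>0 < r\<close> by simp
    have "(\<lambda>n. ((\<lambda>h. ((\<integral>x. g (0 + h) x \<partial>M) - (\<integral>x. g 0 x \<partial>M)) / h) \<circ> X) (n + N)) \<longlonglongrightarrow> (\<integral>x. g' 0 x \<partial>M)"
      unfolding comp_def eq[symmetric] by (rule * )
    then show "((\<lambda>h. ((\<integral>x. g (0 + h) x \<partial>M) - (\<integral>x. g 0 x \<partial>M)) / h) \<circ> X) \<longlonglongrightarrow> (\<integral>x. g' 0 x \<partial>M)"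
      by (rule LIMSEQ_offset)
  qed
qed

text \<open>Compact support inside the open domain makes the extension by zero continuous. Integrals
  over the domain thus become Borel integrals over the whole space, where translation invariance can
  be used.\<close>

lemma extend_by_zero:
  fixes f :: "real^'n::finite \<Rightarrow> real"
  assumes "open \<Theta>" "compact C" "C \<subseteq> \<Theta>" "continuous_on \<Theta> f" "\<And>x. x \<in> \<Theta> \<Longrightarrow> x \<notin> C \<Longrightarrow> f x = 0"
  defines "E \<equiv> \<lambda>x. if x \<in> \<Theta> then f x else 0"
  shows "continuous_on UNIV E" and "integrable lborel E" and "integrable (lebesgue_on \<Theta>) f"
    and "integral\<^sup>L (lebesgue_on \<Theta>) f = (\<integral>x. E x \<partial>lborel)"
proof -
  have "continuous_on \<Theta> E"
    using assms(4) by (rule continuous_on_eq) (simp add: E_def)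
  moreover have "continuous_on (- C) E"
    by (rule continuous_on_eq[OF continuous_on_const[of _ 0]]) (use assms in \<open>auto simp: E_def\<close>)
  ultimately have "continuous_on (\<Theta> \<union> - C) E"
    using assms(1,2) by (intro continuous_on_open_Un) (auto simp: compact_imp_closed open_Compl)
  moreover have "\<Theta> \<union> - C = UNIV"
    using assms(3) by auto
  ultimately show cont: "continuous_on UNIV E"
    by simp
  have "integrable lborel (\<lambda>x. indicator C x *\<^sub>R E x)"
    by (rule borel_integrable_compact[OF assms(2) continuous_on_subset[OF cont]]) simp
  moreover have "(\<lambda>x. indicator C x *\<^sub>R E x) = E"
    using assms(5) by (auto simp: fun_eq_iff E_def indicator_def)
  ultimately show int: "integrable lborel E"
    by simp
  have E: "(\<lambda>x. indicator \<Theta> x * f x) = E"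
    by (auto simp: fun_eq_iff E_def indicator_def)
  have meas: "E \<in> borel_measurable lborel"
    using int by (rule borel_measurable_integrable)
  show "integrable (lebesgue_on \<Theta>) f"
    unfolding integrable_lebesgue_on_iff[OF open_in_lebesgue[OF assms(1)]] E
    using int integrable_completion[OF meas] by simp
  show "integral\<^sup>L (lebesgue_on \<Theta>) f = (\<integral>x. E x \<partial>lborel)"
    unfolding integral_lebesgue_on[OF open_in_lebesgue[OF assms(1)]] E
    by (rule integral_completion[OF meas])
qed

lemma dir_deriv_eq_0_outside:
  assumes "closed C" "\<And>x. x \<notin> C \<Longrightarrow> w x = 0" "x \<notin> C"
  shows "dir_deriv v w x = 0"
proof -
  have "dir_deriv v w x = dir_deriv v (\<lambda>_. 0) x"
    by (rule dir_deriv_cong_open[of "- C"]) (use assms in \<open>auto simp: open_Compl\<close>)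
  then show ?thesis
    by (simp add: dir_deriv_def)
qed

text \<open>Let \<open>F\<close> be the zero extension of \<open>u * w\<close>. The integral of
  \<open>F\<close> translated by \<open>t *\<^sub>R v\<close> does not depend on \<open>t\<close>;
  differentiating under the integral at 0 shows that the product-rule derivative of \<open>F\<close>
  has integral 0. This treats any direction without iterated integrals.\<close>

lemma integration_by_parts_dir:
  fixes \<Theta> :: "(real^'n::finite) set"
  assumes "open \<Theta>" "compact C" "C \<subseteq> \<Theta>"
    and u: "\<And>x. x \<in> \<Theta> \<Longrightarrow> (\<lambda>t::real. u (x + t *\<^sub>R v)) differentiable (at 0)"
      "continuous_on \<Theta> u" "continuous_on \<Theta> (dir_deriv v u)"
    and w: "\<And>x. x \<in> \<Theta> \<Longrightarrow> (\<lambda>t::real. w (x + t *\<^sub>R v)) differentiable (at 0)"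
      "continuous_on \<Theta> w" "continuous_on \<Theta> (dir_deriv v w)"
    and supp: "\<And>x. x \<notin> C \<Longrightarrow> w x = 0"
  shows "integral\<^sup>L (lebesgue_on \<Theta>) (\<lambda>x. u x * dir_deriv v w x) =
    - integral\<^sup>L (lebesgue_on \<Theta>) (\<lambda>x. dir_deriv v u x * w x)"
proof -
  have closed: "closed C"
    by (rule compact_imp_closed[OF assms(2)])
  have dw0: "dir_deriv v w x = 0" if "x \<notin> C" for x
    by (rule dir_deriv_eq_0_outside[OF closed supp that])
  define F where "F x = (if x \<in> \<Theta> then u x * w x else 0)" for x
  define F1 where "F1 x = (if x \<in> \<Theta> then dir_deriv v u x * w x else 0)" for x
  define F2 where "F2 x = (if x \<in> \<Theta> then u x * dir_deriv v w x else 0)" for x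
  note F_ext = extend_by_zero[OF assms(1-3), of "\<lambda>x. u x * w x", folded F_def]
  note F1_ext = extend_by_zero[OF assms(1-3), of "\<lambda>x. dir_deriv v u x * w x", folded F1_def]
  note F2_ext = extend_by_zero[OF assms(1-3), of "\<lambda>x. u x * dir_deriv v w x", folded F2_def]
  have F: "continuous_on UNIV F" "integrable lborel F"
    using F_ext supp u w by (simp_all add: continuous_on_mult)
  have F1: "continuous_on UNIV F1" "integrable lborel F1"
    "integral\<^sup>L (lebesgue_on \<Theta>) (\<lambda>x. dir_deriv v u x * w x) = (\<integral>x. F1 x \<partial>lborel)"
    using F1_ext supp u w by (simp_all add: continuous_on_mult)
  have F2: "continuous_on UNIV F2" "integrable lborel F2"
    "integral\<^sup>L (lebesgue_on \<Theta>) (\<lambda>x. u x * dir_deriv v w x) = (\<integral>x. F2 x \<partial>lborel)"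
    using F2_ext dw0 u w by (simp_all add: continuous_on_mult)
  have der0: "((\<lambda>t. F (x + t *\<^sub>R v)) has_real_derivative F1 x + F2 x) (at 0)" for x
  proof (cases "x \<in> \<Theta>")
    case True
    have "((\<lambda>t. u (x + t *\<^sub>R v) * w (x + t *\<^sub>R v)) has_real_derivative F1 x + F2 x) (at 0)"
      using DERIV_mult[OF has_dir_deriv_0[OF u(1)[OF True]] has_dir_deriv_0[OF w(1)[OF True]]] True
      by (simp add: F1_def F2_def mult.commute)
    moreover have "\<forall>\<^sub>F t in nhds 0. u (x + t *\<^sub>R v) * w (x + t *\<^sub>R v) = F (x + t *\<^sub>R v)"
      by (rule eventually_mono[OF eventually_line_in_open[OF assms(1) True, of v]]) (simp add: F_def)
    ultimately show ?thesis
      by (subst (asm) DERIV_cong_ev) auto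
  next
    case False
    then have "x \<in> - C"
      using assms(3) by auto
    have "((\<lambda>t. 0) has_real_derivative F1 x + F2 x) (at 0)"
      using False by (simp add: F1_def F2_def)
    moreover have "\<forall>\<^sub>F t in nhds 0. 0 = F (x + t *\<^sub>R v)"
      by (rule eventually_mono[OF eventually_line_in_open[OF open_Compl[OF closed] \<open>x \<in> - C\<close>, of v]])
        (simp add: F_def supp)
    ultimately show ?thesis
      by (subst (asm) DERIV_cong_ev) auto
  qed
  have der: "((\<lambda>t. F (x + t *\<^sub>R v)) has_real_derivative (F1 (x + t *\<^sub>R v) + F2 (x + t *\<^sub>R v))) (at t)" for x t
    using has_dir_deriv[of F x t v] dir_derivI[OF der0[of "x + t *\<^sub>R v"]] by simp
  have zero: "F1 x + F2 x = 0" if "x \<notin> C" for x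
    using that supp dw0 by (simp add: F1_def F2_def)
  obtain B where B: "\<And>x. x \<in> C \<Longrightarrow> \<bar>F1 x + F2 x\<bar> \<le> B" "0 \<le> B"
  proof -
    have "compact ((\<lambda>x. F1 x + F2 x) ` C)"
      using F1(1) F2(1) assms(2)
      by (intro compact_continuous_image continuous_on_add) (auto intro: continuous_on_subset)
    then obtain B where "\<And>x. x \<in> C \<Longrightarrow> \<bar>F1 x + F2 x\<bar> \<le> B"
      unfolding bounded_iff compact_eq_bounded_closed by auto
    then show ?thesis
      by (intro that[of "max B 0"]) (auto simp: le_max_iff_disj)
  qed
  \<comment> \<open>\<open>C1\<close> collects all points that a translation with
    \<open>\<bar>t\<bar> \<le> 1\<close> can move into \<open>C\<close>, so one integrable majorant
    \<open>B * indicator C1\<close> serves all small \<open>t\<close>.\<close>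
  define C1 where "C1 = (\<lambda>(y, s). y + s *\<^sub>R v) ` (C \<times> {-1..1::real})"
  have C1: "compact C1"
    unfolding C1_def case_prod_unfold using assms(2)
    by (intro compact_continuous_image compact_Times continuous_intros) auto
  have F_meas: "F \<in> borel_measurable borel"
    using F(2) by (simp add: borel_measurable_integrable)
  have trans_int: "integrable lborel (\<lambda>x. F (x + t *\<^sub>R v))" for t
    using F(2) integrable_distr_eq[of "(+) (t *\<^sub>R v)" lborel borel F] F_meas
    by (simp add: lborel_distr_plus add.commute)
  have trans_eq: "(\<integral>x. F (x + t *\<^sub>R v) \<partial>lborel) = (\<integral>x. F x \<partial>lborel)" for t
    using integral_distr[of "(+) (t *\<^sub>R v)" lborel borel F] F_meas
    by (simp add: lborel_distr_plus add.commute)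
  have "((\<lambda>t. \<integral>x. F (x + t *\<^sub>R v) \<partial>lborel) has_real_derivative
      (\<integral>x. F1 (x + 0 *\<^sub>R v) + F2 (x + 0 *\<^sub>R v) \<partial>lborel)) (at 0)"
  proof (rule has_real_derivative_integral[of 1])
    show "integrable lborel (\<lambda>x. B * indicator C1 x)"
      using C1 emeasure_compact_finite[OF C1]
      by (intro integrable_mult_right integrable_real_indicator) (simp_all add: borel_compact)
    show "\<bar>F1 (x + t *\<^sub>R v) + F2 (x + t *\<^sub>R v)\<bar> \<le> B * indicator C1 x" if "\<bar>t\<bar> < 1" for t x
    proof (cases "x + t *\<^sub>R v \<in> C")
      case True
      have "x \<in> C1"
        unfolding C1_def by (rule image_eqI[of _ _ "(x + t *\<^sub>R v, - t)"]) (use True that in auto)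
      then show ?thesis
        using B(1)[OF True] by simp
    qed (use zero B(2) in simp)
  qed (use der trans_int in auto)
  then have "((\<lambda>t. \<integral>x. F x \<partial>lborel) has_real_derivative (\<integral>x. F1 x + F2 x \<partial>lborel)) (at 0)"
    by (simp add: trans_eq)
  then have "(\<integral>x. F1 x + F2 x \<partial>lborel) = 0"
    using DERIV_const DERIV_unique by blast
  then show ?thesis
    using F1 F2 by simp
qed

section \<open>Weak derivatives\<close>

abbreviation coord_deriv where
  "coord_deriv is \<equiv> iter_deriv (map (\<lambda>i. axis i 1) is)"

lemma test_function_deriv:
  assumes \<phi>: "\<phi> \<in> test_functions \<Theta>"
  shows "continuous_on UNIV (coord_deriv is \<phi>)"
    and "(\<lambda>t::real. coord_deriv is \<phi> (x + t *\<^sub>R axis i 1)) differentiable (at 0)"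
    and "x \<notin> closure {x. \<phi> x \<noteq> 0} \<Longrightarrow> coord_deriv is \<phi> x = 0"
proof -
  have Ck: "\<phi> \<in> Ck UNIV k" for k
    using \<phi> by (simp add: test_functions_def)
  show "continuous_on UNIV (coord_deriv is \<phi>)"
    using Ck[of "length is"] by (auto simp: Ck_def)
  have "iter_deriv_exists_on UNIV (map (\<lambda>i. axis i 1) (i # is)) \<phi>"
    using Ck[of "length (i # is)"] unfolding Ck_def by blast
  then show "(\<lambda>t::real. coord_deriv is \<phi> (x + t *\<^sub>R axis i 1)) differentiable (at 0)"
    by simp
  show "x \<notin> closure {x. \<phi> x \<noteq> 0} \<Longrightarrow> coord_deriv is \<phi> x = 0"
  proof (induction "is" arbitrary: x)
    case Nil
    then show ?case
      using closure_subset[of "{x. \<phi> x \<noteq> 0}"] by auto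
  next
    case (Cons i "is")
    then show ?case
      by (auto intro: dir_deriv_eq_0_outside[OF closed_closure])
  qed
qed

lemma test_function_support:
  assumes "\<phi> \<in> test_functions \<Theta>"
  shows "compact (closure {x. \<phi> x \<noteq> 0})" "closure {x. \<phi> x \<noteq> 0} \<subseteq> \<Theta>"
  using assms by (auto simp: test_functions_def)

text \<open>Derivatives move one at a time from the test function to \<open>f\<close>. The outermost
  one moves first and ends up innermost among the moved ones, hence the reversal.\<close>

lemma Ck_integration_by_parts:
  assumes "open \<Theta>" and f: "f \<in> Ck \<Theta> k" and \<phi>: "\<phi> \<in> test_functions \<Theta>"
    and "length ws + length vs \<le> k"
  shows "integral\<^sup>L (lebesgue_on \<Theta>) (\<lambda>x. coord_deriv ws f x * coord_deriv vs \<phi> x) =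
    (-1) ^ length vs * integral\<^sup>L (lebesgue_on \<Theta>) (\<lambda>x. coord_deriv (rev vs @ ws) f x * \<phi> x)"
  using assms(4)
proof (induction vs arbitrary: ws)
  case (Cons v vs)
  have fine: "iter_deriv_exists_on \<Theta> (map (\<lambda>i. axis i 1) (v # ws)) f"
      "continuous_on \<Theta> (coord_deriv (v # ws) f)" "continuous_on \<Theta> (coord_deriv ws f)"
    using f Cons.prems unfolding Ck_def mem_Collect_eq
    by (metis add_Suc_right add_leD1 le_trans length_Cons add_Suc le_add1 plus_1_eq_Suc)+
  have "integral\<^sup>L (lebesgue_on \<Theta>) (\<lambda>x. coord_deriv ws f x * dir_deriv (axis v 1) (coord_deriv vs \<phi>) x) =
      - integral\<^sup>L (lebesgue_on \<Theta>) (\<lambda>x. dir_deriv (axis v 1) (coord_deriv ws f) x * coord_deriv vs \<phi> x)"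
  proof (rule integration_by_parts_dir[OF \<open>open \<Theta>\<close> test_function_support[OF \<phi>]])
    show "(\<lambda>t::real. coord_deriv ws f (x + t *\<^sub>R axis v 1)) differentiable (at 0)" if "x \<in> \<Theta>" for x
      using fine(1) that by simp
    show "continuous_on \<Theta> (dir_deriv (axis v 1) (coord_deriv ws f))"
      using fine(2) by simp
    show "continuous_on \<Theta> (dir_deriv (axis v 1) (coord_deriv vs \<phi>))"
      using continuous_on_subset[OF test_function_deriv(1)[OF \<phi>, of "v # vs"]] by simp
    show "continuous_on \<Theta> (coord_deriv vs \<phi>)"
      using continuous_on_subset[OF test_function_deriv(1)[OF \<phi>]] by blast
  qed (use fine(3) test_function_deriv(2,3)[OF \<phi>] in auto)
  then show ?case
    using Cons.IH[of "v # ws"] Cons.prems by simp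
qed simp

lemma continuous_imp_locally_integrable:
  fixes f :: "real^'n::finite \<Rightarrow> real"
  assumes "continuous_on \<Theta> f"
  shows "locally_integrable \<Theta> f"
  unfolding locally_integrable_def
proof (intro allI impI, elim conjE)
  fix K assume K: "compact K" "K \<subseteq> \<Theta>"
  have "integrable lborel (\<lambda>x. indicator K x *\<^sub>R f x)"
    by (rule borel_integrable_compact[OF K(1) continuous_on_subset[OF assms K(2)]])
  then have "integrable lebesgue (\<lambda>x. indicator K x *\<^sub>R f x)"
    using integrable_completion borel_measurable_integrable by blast
  then show "integrable (lebesgue_on K) f"
    using K(1) by (subst integrable_lebesgue_on_iff) (simp_all add: borel_compact)
qed

lemma locally_integrable_lincomb:
  "locally_integrable \<Theta> f \<Longrightarrow> locally_integrable \<Theta> g \<Longrightarrow> locally_integrable \<Theta> (\<lambda>x. a * f x + b * g x)"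
  by (auto simp: locally_integrable_def)

lemma locally_integrable_cong_AE:
  assumes "open \<Theta>" "locally_integrable \<Theta> f" "f' \<in> borel_measurable (lebesgue_on \<Theta>)"
    and ae: "AE x in lebesgue_on \<Theta>. f x = f' x"
  shows "locally_integrable \<Theta> f'"
  unfolding locally_integrable_def
proof (intro allI impI, elim conjE)
  fix K :: "(real^'a) set" assume K: "compact K" "K \<subseteq> \<Theta>"
  have K': "K \<in> sets lebesgue"
    using K(1) by (simp add: borel_compact)
  show "integrable (lebesgue_on K) f'"
  proof (rule Bochner_Integration.integrable_cong_AE_imp)
    show "integrable (lebesgue_on K) f"
      using assms(2) K by (simp add: locally_integrable_def)
    have "restrict_space (lebesgue_on \<Theta>) K = lebesgue_on K"
      using K by (simp add: restrict_restrict_space Int_absorb1 open_in_lebesgue[OF assms(1)] K')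
    then show "f' \<in> borel_measurable (lebesgue_on K)"
      using measurable_restrict_space1[OF assms(3), of K] by simp
    show "AE x in lebesgue_on K. f x = f' x"
      using ae K(2) unfolding AE_lebesgue_on_iff[OF K'] AE_lebesgue_on_iff[OF open_in_lebesgue[OF assms(1)]]
      by (auto elim: eventually_mono)
  qed
qed

lemma integrable_mult_compact_support:
  fixes g w :: "real^'n::finite \<Rightarrow> real"
  assumes "open \<Theta>" "locally_integrable \<Theta> g" "continuous_on UNIV w" "compact C" "C \<subseteq> \<Theta>"
    and zero: "\<And>x. x \<notin> C \<Longrightarrow> w x = 0"
  shows "integrable (lebesgue_on \<Theta>) (\<lambda>x. g x * w x)"
proof -
  have "compact (w ` C)"
    using assms(3,4) by (intro compact_continuous_image) (auto intro: continuous_on_subset)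
  then obtain B where B: "\<And>x. x \<in> C \<Longrightarrow> \<bar>w x\<bar> \<le> B"
    unfolding bounded_iff compact_eq_bounded_closed by auto
  have C: "C \<in> sets lebesgue"
    using assms(4) by (simp add: borel_compact)
  have "integrable lebesgue (\<lambda>x. indicator C x * g x)"
    using assms(2,4,5) by (subst integrable_lebesgue_on_iff[OF C, symmetric]) (simp add: locally_integrable_def)
  then have "integrable lebesgue (\<lambda>x. indicator C x * g x * w x)"
  proof (rule integrable_mult_bounded)
    show "\<bar>w x\<bar> \<le> max B 0" for x
      using B zero by (cases "x \<in> C") (auto simp: le_max_iff_disj)
    show "w \<in> borel_measurable lebesgue"
      using borel_measurable_continuous_onI[OF assms(3)] by (intro measurable_completion) simp
  qed
  also have "(\<lambda>x. indicator C x * g x * w x) = (\<lambda>x. indicator \<Theta> x * (g x * w x))"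
    using zero assms(5) by (auto simp: indicator_def fun_eq_iff)
  finally show ?thesis
    by (simp add: integrable_lebesgue_on_iff[OF open_in_lebesgue[OF assms(1)]])
qed

lemma integrable_mult_test_function:
  assumes "open \<Theta>" "locally_integrable \<Theta> g" "\<phi> \<in> test_functions \<Theta>"
  shows "integrable (lebesgue_on \<Theta>) (\<lambda>x. g x * class_deriv \<alpha> \<phi> x)"
    and "integrable (lebesgue_on \<Theta>) (\<lambda>x. g x * \<phi> x)"
  using integrable_mult_compact_support[OF assms(1,2) test_function_deriv(1)[OF assms(3)]
      test_function_support[OF assms(3)] test_function_deriv(3)[OF assms(3)], of "mi_list \<alpha>"]
    integrable_mult_compact_support[OF assms(1,2) test_function_deriv(1)[OF assms(3)]
      test_function_support[OF assms(3)] test_function_deriv(3)[OF assms(3)], of "[]"]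
  by (simp_all add: class_deriv_def)

lemma Ck_has_weak_deriv:
  assumes "open \<Theta>" and f: "f \<in> Ck \<Theta> k" and \<alpha>: "\<alpha> \<in> mi_upto k"
  shows "has_weak_deriv \<Theta> \<alpha> f (class_deriv \<alpha> f)"
  unfolding has_weak_deriv_def
proof (intro conjI ballI)
  have len: "length (mi_list \<alpha>) \<le> k"
    using \<alpha> by (simp add: mi_upto_def length_mi_list)
  have cont: "continuous_on \<Theta> (coord_deriv is f)" if "length is \<le> k" for "is"
    using f that by (auto simp: Ck_def)
  show "locally_integrable \<Theta> f"
    using cont[of "[]"] by (intro continuous_imp_locally_integrable) simp
  show "locally_integrable \<Theta> (class_deriv \<alpha> f)"
    unfolding class_deriv_def by (intro continuous_imp_locally_integrable cont len)
  fix \<phi> assume \<phi>: "\<phi> \<in> test_functions \<Theta>"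
  \<comment> \<open>Schwarz's theorem undoes the reversal caused by integrating by parts.\<close>
  have "integral\<^sup>L (lebesgue_on \<Theta>) (\<lambda>x. coord_deriv (rev (mi_list \<alpha>)) f x * \<phi> x) =
      integral\<^sup>L (lebesgue_on \<Theta>) (\<lambda>x. class_deriv \<alpha> f x * \<phi> x)"
    unfolding class_deriv_def
    by (intro Bochner_Integration.integral_cong refl)
      (simp add: Ck_iter_deriv_perm[OF \<open>open \<Theta>\<close> f, of "rev (mi_list \<alpha>)" "mi_list \<alpha>"] len)
  then show "integral\<^sup>L (lebesgue_on \<Theta>) (\<lambda>x. f x * class_deriv \<alpha> \<phi> x) =
      (-1) ^ mi_order \<alpha> * integral\<^sup>L (lebesgue_on \<Theta>) (\<lambda>x. class_deriv \<alpha> f x * \<phi> x)"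
    using Ck_integration_by_parts[OF \<open>open \<Theta>\<close> f \<phi>, of "[]" "mi_list \<alpha>"] len
    by (simp add: class_deriv_def[of \<alpha> \<phi>] length_mi_list)
qed

lemma has_weak_deriv_lincomb:
  assumes "open \<Theta>" and f: "has_weak_deriv \<Theta> \<alpha> f f'" and g: "has_weak_deriv \<Theta> \<alpha> g g'"
  shows "has_weak_deriv \<Theta> \<alpha> (\<lambda>x. a * f x + b * g x) (\<lambda>x. a * f' x + b * g' x)"
  unfolding has_weak_deriv_def
proof (intro conjI ballI)
  have loc: "locally_integrable \<Theta> f" "locally_integrable \<Theta> f'" "locally_integrable \<Theta> g" "locally_integrable \<Theta> g'"
    using f g by (auto simp: has_weak_deriv_def)
  show "locally_integrable \<Theta> (\<lambda>x. a * f x + b * g x)" "locally_integrable \<Theta> (\<lambda>x. a * f' x + b * g' x)"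
    using loc by (auto intro: locally_integrable_lincomb)
  fix \<phi> assume \<phi>: "\<phi> \<in> test_functions \<Theta>"
  have lin: "integral\<^sup>L (lebesgue_on \<Theta>) (\<lambda>x. (a * u x + b * v x) * w x) =
      a * integral\<^sup>L (lebesgue_on \<Theta>) (\<lambda>x. u x * w x) + b * integral\<^sup>L (lebesgue_on \<Theta>) (\<lambda>x. v x * w x)"
    if "integrable (lebesgue_on \<Theta>) (\<lambda>x. u x * w x)" "integrable (lebesgue_on \<Theta>) (\<lambda>x. v x * w x)" for u v w
    using that by (simp add: distrib_right mult.assoc)
  show "integral\<^sup>L (lebesgue_on \<Theta>) (\<lambda>x. (a * f x + b * g x) * class_deriv \<alpha> \<phi> x) =
      (-1) ^ mi_order \<alpha> * integral\<^sup>L (lebesgue_on \<Theta>) (\<lambda>x. (a * f' x + b * g' x) * \<phi> x)"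
  proof -
    note int = integrable_mult_test_function[OF \<open>open \<Theta>\<close> _ \<phi>]
    have "integral\<^sup>L (lebesgue_on \<Theta>) (\<lambda>x. f x * class_deriv \<alpha> \<phi> x) =
        (-1) ^ mi_order \<alpha> * integral\<^sup>L (lebesgue_on \<Theta>) (\<lambda>x. f' x * \<phi> x)"
      using f \<phi> by (simp add: has_weak_deriv_def)
    moreover have "integral\<^sup>L (lebesgue_on \<Theta>) (\<lambda>x. g x * class_deriv \<alpha> \<phi> x) =
        (-1) ^ mi_order \<alpha> * integral\<^sup>L (lebesgue_on \<Theta>) (\<lambda>x. g' x * \<phi> x)"
      using g \<phi> by (simp add: has_weak_deriv_def)
    moreover have "X = s * F \<Longrightarrow> Y = s * G \<Longrightarrow> a * X + b * Y = s * (a * F + b * G)" for X Y F G s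
      by (simp add: distrib_left mult.left_commute)
    ultimately show ?thesis
      unfolding lin[OF int(1)[OF loc(1)] int(1)[OF loc(3)]] lin[OF int(2)[OF loc(2)] int(2)[OF loc(4)]]
      by simp
  qed
qed

lemma has_weak_deriv_unique:
  assumes "open \<Theta>" and g: "has_weak_deriv \<Theta> \<alpha> f g" and g': "has_weak_deriv \<Theta> \<alpha> f g'"
  shows "AE x in lebesgue_on \<Theta>. g x = g' x"
proof -
  have loc: "locally_integrable \<Theta> g" "locally_integrable \<Theta> g'"
    using g g' by (auto simp: has_weak_deriv_def)
  have "AE x in lebesgue_on \<Theta>. 1 * g x + (-1) * g' x = 0"
  proof (rule fundamental_lemma_calculus_of_variations[OF assms(1) locally_integrable_lincomb[OF loc]])
    fix \<phi> assume \<phi>: "\<phi> \<in> test_functions \<Theta>"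
    have "integral\<^sup>L (lebesgue_on \<Theta>) (\<lambda>x. f x * class_deriv \<alpha> \<phi> x) =
        (-1) ^ mi_order \<alpha> * integral\<^sup>L (lebesgue_on \<Theta>) (\<lambda>x. g x * \<phi> x)"
      using g \<phi> by (simp add: has_weak_deriv_def)
    moreover have "integral\<^sup>L (lebesgue_on \<Theta>) (\<lambda>x. f x * class_deriv \<alpha> \<phi> x) =
        (-1) ^ mi_order \<alpha> * integral\<^sup>L (lebesgue_on \<Theta>) (\<lambda>x. g' x * \<phi> x)"
      using g' \<phi> by (simp add: has_weak_deriv_def)
    ultimately have "integral\<^sup>L (lebesgue_on \<Theta>) (\<lambda>x. g x * \<phi> x) = integral\<^sup>L (lebesgue_on \<Theta>) (\<lambda>x. g' x * \<phi> x)"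
      by simp
    then show "integral\<^sup>L (lebesgue_on \<Theta>) (\<lambda>x. (1 * g x + (-1) * g' x) * \<phi> x) = 0"
      using integrable_mult_test_function(2)[OF assms(1) _ \<phi>] loc by (simp add: left_diff_distrib)
  qed
  then show ?thesis
    by simp
qed

text \<open>Eigenfunctions are fixed only up to null sets, so weak derivatives have to be carried
  over to the smooth representatives.\<close>

lemma has_weak_deriv_cong_AE:
  assumes "open \<Theta>" and g: "has_weak_deriv \<Theta> \<alpha> f g"
    and f': "f' \<in> borel_measurable (lebesgue_on \<Theta>)" and ae: "AE x in lebesgue_on \<Theta>. f x = f' x"
  shows "has_weak_deriv \<Theta> \<alpha> f' g"
  unfolding has_weak_deriv_def
proof (intro conjI ballI)
  have f: "locally_integrable \<Theta> f"
    using g by (simp add: has_weak_deriv_def)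
  show f'_loc: "locally_integrable \<Theta> f'"
    by (rule locally_integrable_cong_AE[OF assms(1) f f' ae])
  show "locally_integrable \<Theta> g"
    using g by (simp add: has_weak_deriv_def)
  fix \<phi> assume \<phi>: "\<phi> \<in> test_functions \<Theta>"
  have "integral\<^sup>L (lebesgue_on \<Theta>) (\<lambda>x. f' x * class_deriv \<alpha> \<phi> x) =
      integral\<^sup>L (lebesgue_on \<Theta>) (\<lambda>x. f x * class_deriv \<alpha> \<phi> x)"
  proof (rule integral_cong_AE)
    show "AE x in lebesgue_on \<Theta>. f' x * class_deriv \<alpha> \<phi> x = f x * class_deriv \<alpha> \<phi> x"
      using ae by eventually_elim simp
  qed (use integrable_mult_test_function(1)[OF assms(1) _ \<phi>] f f'_loc in \<open>blast intro: borel_measurable_integrable\<close>)+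
  then show "integral\<^sup>L (lebesgue_on \<Theta>) (\<lambda>x. f' x * class_deriv \<alpha> \<phi> x) =
      (-1) ^ mi_order \<alpha> * integral\<^sup>L (lebesgue_on \<Theta>) (\<lambda>x. g x * \<phi> x)"
    using g \<phi> by (simp add: has_weak_deriv_def)
qed

lemma has_weak_deriv_weak_deriv: "has_weak_deriv \<Theta> \<alpha> f g \<Longrightarrow> has_weak_deriv \<Theta> \<alpha> f (weak_deriv \<Theta> \<alpha> f)"
  unfolding weak_deriv_def by (rule someI[of "has_weak_deriv \<Theta> \<alpha> f"])

lemma weak_deriv_AE_eq:
  assumes "open \<Theta>" "has_weak_deriv \<Theta> \<alpha> f g"
  shows "AE x in lebesgue_on \<Theta>. weak_deriv \<Theta> \<alpha> f x = g x"
  by (rule has_weak_deriv_unique[OF assms(1) has_weak_deriv_weak_deriv[OF assms(2)] assms(2)])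

section \<open>Sobolev functions and their weak derivatives\<close>

lemma L2_eq_sqint: "L2 \<Theta> = sqint (lebesgue_on \<Theta>)"
  by (simp add: L2_def sqint_def)

lemma sqint_cong_AE:
  assumes "f \<in> sqint M" "g \<in> borel_measurable M" "AE x in M. f x = g x"
  shows "g \<in> sqint M"
proof -
  have "integrable M (\<lambda>x. (g x)\<^sup>2)"
    by (rule Bochner_Integration.integrable_cong_AE_imp[OF sqint_integrable_square[OF assms(1)]])
      (use assms in auto)
  then show ?thesis
    using assms by (simp add: sqint_def)
qed

lemma Hk_weak_deriv:
  assumes "open \<Theta>" "f \<in> Hk \<Theta> k" "\<alpha> \<in> mi_upto k"
  shows "has_weak_deriv \<Theta> \<alpha> f (weak_deriv \<Theta> \<alpha> f)" "weak_deriv \<Theta> \<alpha> f \<in> sqint (lebesgue_on \<Theta>)"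
proof -
  obtain g where g: "g \<in> L2 \<Theta>" "has_weak_deriv \<Theta> \<alpha> f g"
    using assms by (auto simp: Hk_def)
  show w: "has_weak_deriv \<Theta> \<alpha> f (weak_deriv \<Theta> \<alpha> f)"
    by (rule has_weak_deriv_weak_deriv[OF g(2)])
  show "weak_deriv \<Theta> \<alpha> f \<in> sqint (lebesgue_on \<Theta>)"
  proof (rule sqint_cong_AE)
    show "g \<in> sqint (lebesgue_on \<Theta>)"
      using g(1) by (simp add: L2_eq_sqint)
    show "weak_deriv \<Theta> \<alpha> f \<in> borel_measurable (lebesgue_on \<Theta>)"
      using w by (intro locally_integrable_measurable[OF assms(1)]) (simp add: has_weak_deriv_def)
    show "AE x in lebesgue_on \<Theta>. g x = weak_deriv \<Theta> \<alpha> f x"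
      by (rule has_weak_deriv_unique[OF assms(1) g(2) w])
  qed
qed

lemma Hk_lincomb:
  assumes "open \<Theta>" "f \<in> Hk \<Theta> k" "g \<in> Hk \<Theta> k"
  shows "(\<lambda>x. a * f x + b * g x) \<in> Hk \<Theta> k"
  unfolding Hk_def mem_Collect_eq L2_eq_sqint
proof (intro conjI ballI)
  show "(\<lambda>x. a * f x + b * g x) \<in> sqint (lebesgue_on \<Theta>)"
    using assms by (intro sqint_add sqint_cmult) (auto simp: Hk_def L2_eq_sqint)
  fix \<alpha> :: "'a multi_index" assume \<alpha>: "\<alpha> \<in> mi_upto k"
  show "\<exists>g'\<in>sqint (lebesgue_on \<Theta>). has_weak_deriv \<Theta> \<alpha> (\<lambda>x. a * f x + b * g x) g'"
  proof (rule bexI)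
    show "has_weak_deriv \<Theta> \<alpha> (\<lambda>x. a * f x + b * g x)
        (\<lambda>x. a * weak_deriv \<Theta> \<alpha> f x + b * weak_deriv \<Theta> \<alpha> g x)"
      by (intro has_weak_deriv_lincomb Hk_weak_deriv(1)[OF assms(1) _ \<alpha>] assms)
    show "(\<lambda>x. a * weak_deriv \<Theta> \<alpha> f x + b * weak_deriv \<Theta> \<alpha> g x) \<in> sqint (lebesgue_on \<Theta>)"
      by (intro sqint_add sqint_cmult Hk_weak_deriv(2)[OF assms(1) _ \<alpha>] assms)
  qed
qed

lemma weak_deriv_lincomb:
  assumes "open \<Theta>" "f \<in> Hk \<Theta> k" "g \<in> Hk \<Theta> k" "\<alpha> \<in> mi_upto k"
  shows "AE x in lebesgue_on \<Theta>. weak_deriv \<Theta> \<alpha> (\<lambda>x. a * f x + b * g x) x =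
    a * weak_deriv \<Theta> \<alpha> f x + b * weak_deriv \<Theta> \<alpha> g x"
  by (intro weak_deriv_AE_eq has_weak_deriv_lincomb Hk_weak_deriv(1)[OF assms(1) _ assms(4)] assms)

text \<open>Both claims go into one induction, since the derivative of a sum can be split only when
  the partial sum is known to lie in \<open>Hk\<close>.\<close>

lemma Hk_sum:
  assumes "open \<Theta>" "finite I" "\<And>i. i \<in> I \<Longrightarrow> f i \<in> Hk \<Theta> k"
  shows "(\<lambda>x. \<Sum>i\<in>I. c i * f i x) \<in> Hk \<Theta> k \<and> (\<forall>\<alpha>\<in>mi_upto k.
    AE x in lebesgue_on \<Theta>. weak_deriv \<Theta> \<alpha> (\<lambda>x. \<Sum>i\<in>I. c i * f i x) x = (\<Sum>i\<in>I. c i * weak_deriv \<Theta> \<alpha> (f i) x))"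
  using assms(2,3)
proof (induction I rule: finite_induct)
  case empty
  have zero: "has_weak_deriv \<Theta> \<alpha> (\<lambda>x. 0) (\<lambda>x. 0)" for \<alpha> :: "'a multi_index"
    by (simp add: has_weak_deriv_def locally_integrable_def)
  have "(\<lambda>x. 0) \<in> Hk \<Theta> k"
    unfolding Hk_def L2_eq_sqint using zero sqint_zero by blast
  then show ?case
    using weak_deriv_AE_eq[OF assms(1) zero] by simp
next
  case (insert i I)
  let ?s = "\<lambda>x. \<Sum>i\<in>I. c i * f i x"
  have s: "?s \<in> Hk \<Theta> k" and fi: "f i \<in> Hk \<Theta> k"
    using insert by auto
  have eq: "(\<lambda>x. \<Sum>i\<in>insert i I. c i * f i x) = (\<lambda>x. c i * f i x + 1 * ?s x)"
    using insert by simp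
  show ?case
    unfolding eq
  proof (intro conjI ballI)
    show "(\<lambda>x. c i * f i x + 1 * ?s x) \<in> Hk \<Theta> k"
      by (rule Hk_lincomb[OF assms(1) fi s])
    fix \<alpha> :: "'a multi_index" assume \<alpha>: "\<alpha> \<in> mi_upto k"
    have "AE x in lebesgue_on \<Theta>. weak_deriv \<Theta> \<alpha> ?s x = (\<Sum>i\<in>I. c i * weak_deriv \<Theta> \<alpha> (f i) x)"
      using insert \<alpha> by simp
    with weak_deriv_lincomb[OF assms(1) fi s \<alpha>, of "c i" 1]
    show "AE x in lebesgue_on \<Theta>. weak_deriv \<Theta> \<alpha> (\<lambda>x. c i * f i x + 1 * ?s x) x =
        (\<Sum>i\<in>insert i I. c i * weak_deriv \<Theta> \<alpha> (f i) x)"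
      by eventually_elim (use insert in simp)
  qed
qed

section \<open>The Sobolev kernel operator\<close>

locale sobolev_kernel =
  fixes \<Theta> :: "(real^'n::finite) set" and k :: nat and h :: "(real^'n) \<times> (real^'n) \<Rightarrow> real"
  assumes open_domain: "open \<Theta>" and bounded_domain: "bounded \<Theta>"
    and smooth_kernel: "h \<in> Ckk_closure \<Theta> k"
    and pd_kernel: "positive_definite_kernel \<Theta> h"
begin

abbreviation \<Lambda> :: "(real^'n) measure" where "\<Lambda> \<equiv> lebesgue_on \<Theta>"

abbreviation A :: "'n multi_index set" where "A \<equiv> mi_upto k"

definition M :: "('n multi_index \<times> (real^'n)) measure" where
  "M = count_space A \<Otimes>\<^sub>M \<Lambda>"

definition K :: "'n multi_index \<times> (real^'n) \<Rightarrow> 'n multi_index \<times> (real^'n) \<Rightarrow> real" where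
  "K p q = kernel_deriv (fst p) (fst q) h (snd p, snd q)"

lemma finite_A: "finite A"
  by (rule finite_mi_upto)

lemma space_M: "space M = A \<times> \<Theta>"
  by (simp add: M_def space_pair_measure)

lemma domain_sets: "\<Theta> \<in> sets lebesgue"
  by (rule open_in_lebesgue[OF open_domain])

lemma finite_measure_\<Lambda>: "finite_measure \<Lambda>"
  by (intro finite_measure_lebesgue_on lmeasurable_open bounded_domain open_domain)

lemma finite_measure_M: "finite_measure M"
  unfolding M_def
  by (intro finite_measure_pair_measure finite_measure_count_space finite_A finite_measure_\<Lambda>)

lemma pair_sigma_finite_M: "pair_sigma_finite (count_space A) \<Lambda>"
  using finite_measure_count_space[OF finite_A] finite_measure_\<Lambda>
  by (simp add: pair_sigma_finite_def finite_measure_def)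

lemma measurable_M_iff: "f \<in> borel_measurable M \<longleftrightarrow> (\<forall>\<alpha>\<in>A. (\<lambda>x. f (\<alpha>, x)) \<in> borel_measurable \<Lambda>)"
proof
  assume f: "f \<in> borel_measurable M"
  show "\<forall>\<alpha>\<in>A. (\<lambda>x. f (\<alpha>, x)) \<in> borel_measurable \<Lambda>"
  proof
    fix \<alpha> :: "'n multi_index" assume "\<alpha> \<in> A"
    then have "Pair \<alpha> \<in> measurable \<Lambda> M"
      unfolding M_def by (intro measurable_Pair1') simp
    from measurable_compose[OF this f] show "(\<lambda>x. f (\<alpha>, x)) \<in> borel_measurable \<Lambda>" .
  qed
next
  assume "\<forall>\<alpha>\<in>A. (\<lambda>x. f (\<alpha>, x)) \<in> borel_measurable \<Lambda>"
  then show "f \<in> borel_measurable M"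
    unfolding M_def by (intro measurable_pair_measure_countable1 countable_finite finite_A) blast
qed

lemma integrable_M:
  fixes f :: "_ \<Rightarrow> real"
  assumes "\<And>\<alpha>. \<alpha> \<in> A \<Longrightarrow> integrable \<Lambda> (\<lambda>x. f (\<alpha>, x))"
  shows "integrable M f" and "(\<integral>p. f p \<partial>M) = (\<Sum>\<alpha>\<in>A. \<integral>x. f (\<alpha>, x) \<partial>\<Lambda>)"
proof -
  have f: "f \<in> borel_measurable (count_space A \<Otimes>\<^sub>M \<Lambda>)"
    unfolding M_def[symmetric] measurable_M_iff using assms by (blast intro: borel_measurable_integrable)
  have int: "integrable (count_space A \<Otimes>\<^sub>M \<Lambda>) f"
    by (rule pair_sigma_finite.Fubini_integrable[OF pair_sigma_finite_M f])
      (use assms finite_A in \<open>auto simp: integrable_count_space AE_count_space\<close>)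
  then show "integrable M f"
    by (simp add: M_def)
  show "(\<integral>p. f p \<partial>M) = (\<Sum>\<alpha>\<in>A. \<integral>x. f (\<alpha>, x) \<partial>\<Lambda>)"
    using pair_sigma_finite.integral_fst'[OF pair_sigma_finite_M int]
    by (simp add: M_def lebesgue_integral_count_space_finite finite_A)
qed

lemma sqint_M: "(\<And>\<alpha>. \<alpha> \<in> A \<Longrightarrow> (\<lambda>x. f (\<alpha>, x)) \<in> sqint \<Lambda>) \<Longrightarrow> f \<in> sqint M"
  unfolding sqint_def mem_Collect_eq measurable_M_iff by (intro conjI ballI integrable_M) auto

text \<open>The list behind a multi-index is an unspecified choice. By Schwarz's theorem any list
  with the same counts may replace it, so that inductions over lists apply to
  \<open>K\<close>.\<close>

lemma K_iter_deriv:
  assumes "length is \<le> k" "length js \<le> k" "x \<in> \<Theta>" "y \<in> \<Theta>"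
  shows "K (count_list is, x) (count_list js, y) = kernel_iter_deriv (map Inl is @ map Inr js) h (x, y)"
proof -
  have "kernel_iter_deriv (map Inl (mi_list (count_list is)) @ map Inr (mi_list (count_list js))) h (x, y) =
      kernel_iter_deriv (map Inl is @ map Inr js) h (x, y)"
    by (rule kernel_iter_deriv_perm[OF open_domain smooth_kernel kernel_class_Inl_Inr[THEN iffD2]])
      (use assms in \<open>simp_all add: mset_mi_list length_mi_list mi_order_count_list\<close>)
  then show ?thesis
    by (simp add: K_def kernel_deriv_def)
qed

lemma psd_K: "psd_on (A \<times> \<Theta>) K"
  by (rule psd_on_reindex[OF kernel_iter_deriv_psd[OF open_domain smooth_kernel pd_kernel],
        of _ "map_prod mi_list id"])
    (auto simp: mi_upto_def length_mi_list K_def kernel_deriv_def)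

lemma K_uniformly_continuous:
  assumes "\<alpha> \<in> A" "\<beta> \<in> A"
  shows "uniformly_continuous_on (\<Theta> \<times> \<Theta>) (\<lambda>(x, y). K (\<alpha>, x) (\<beta>, y))"
proof -
  have "kernel_class k (mset (map Inl (mi_list \<alpha>) @ map Inr (mi_list \<beta>)))"
    using assms by (intro kernel_class_Inl_Inr[THEN iffD2]) (simp add: mi_upto_def length_mi_list)
  from Ckk_closureD(2)[OF smooth_kernel this] show ?thesis
    by (simp add: K_def kernel_deriv_def case_prod_unfold)
qed

text \<open>\<open>kdist2\<close> is the sum of the two differences between a diagonal value and the
  value at \<open>(x, y)\<close>; uniform continuity makes each smaller than
  \<open>\<epsilon> / 2\<close>. Only points of the same copy of the domain are compared.\<close>

lemma kdist2_small:
  assumes "\<alpha> \<in> A" "0 < \<epsilon>"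
  shows "\<exists>\<delta>>0. \<forall>x\<in>\<Theta>. \<forall>y\<in>\<Theta>. dist x y < \<delta> \<longrightarrow> kdist2 K (\<alpha>, x) (\<alpha>, y) < \<epsilon>"
proof -
  have "0 < \<epsilon> / 2"
    using assms by simp
  from K_uniformly_continuous[OF assms(1,1), unfolded uniformly_continuous_on_def, rule_format, OF this]
  obtain \<delta> where \<delta>: "0 < \<delta>" "\<And>p q. p \<in> \<Theta> \<times> \<Theta> \<Longrightarrow> q \<in> \<Theta> \<times> \<Theta> \<Longrightarrow> dist q p < \<delta> \<Longrightarrow>
      dist (case q of (x, y) \<Rightarrow> K (\<alpha>, x) (\<alpha>, y)) (case p of (x, y) \<Rightarrow> K (\<alpha>, x) (\<alpha>, y)) < \<epsilon> / 2"
    by blast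
  show ?thesis
  proof (intro exI[of _ \<delta>] conjI ballI impI)
    fix x y assume xy: "x \<in> \<Theta>" "y \<in> \<Theta>" "dist x y < \<delta>"
    have "dist (x, x) (x, y) < \<delta>" "dist (y, y) (x, y) < \<delta>"
      using xy by (simp_all add: dist_prod_def dist_commute)
    then have "\<bar>K (\<alpha>, x) (\<alpha>, x) - K (\<alpha>, x) (\<alpha>, y)\<bar> < \<epsilon> / 2" "\<bar>K (\<alpha>, y) (\<alpha>, y) - K (\<alpha>, x) (\<alpha>, y)\<bar> < \<epsilon> / 2"
      using \<delta>(2)[of "(x, y)" "(x, x)"] \<delta>(2)[of "(x, y)" "(y, y)"] xy by (simp_all add: dist_real_def)
    then show "kdist2 K (\<alpha>, x) (\<alpha>, y) < \<epsilon>"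
      unfolding kdist2_def by linarith
  qed (use \<delta>(1) in simp)
qed

sublocale mercer_kernel M K
proof (intro mercer_kernel.intro finite_measure_M mercer_kernel_axioms.intro)
  show "psd_on (space M) K"
    unfolding space_M by (rule psd_K)
  have cont: "continuous_on (\<Theta> \<times> \<Theta>) (\<lambda>(x, y). K (\<alpha>, x) (\<beta>, y))" if "\<alpha> \<in> A" "\<beta> \<in> A" for \<alpha> \<beta>
    by (rule uniformly_continuous_imp_continuous[OF K_uniformly_continuous[OF that]])
  show "(\<lambda>p. K p q) \<in> borel_measurable M" if qM: "q \<in> space M" for q
    unfolding measurable_M_iff
  proof
    fix \<alpha> :: "'n multi_index" assume \<alpha>: "\<alpha> \<in> A"
    obtain \<beta> y where q: "q = (\<beta>, y)" "\<beta> \<in> A" "y \<in> \<Theta>"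
      using qM by (auto simp: space_M)
    have "continuous_on \<Theta> (\<lambda>x. case (x, y) of (x, y) \<Rightarrow> K (\<alpha>, x) (\<beta>, y))"
      by (rule continuous_on_compose2[OF cont[OF \<alpha> q(2)]]) (use q in \<open>auto intro!: continuous_intros\<close>)
    then show "(\<lambda>x. K (\<alpha>, x) q) \<in> borel_measurable \<Lambda>"
      using continuous_imp_measurable_on_sets_lebesgue[OF _ domain_sets] by (simp add: q)
  qed
  show "(\<lambda>p. K p p) \<in> borel_measurable M"
    unfolding measurable_M_iff
  proof
    fix \<alpha> :: "'n multi_index" assume \<alpha>: "\<alpha> \<in> A"
    have "continuous_on \<Theta> (\<lambda>x. case (x, x) of (x, y) \<Rightarrow> K (\<alpha>, x) (\<alpha>, y))"
      by (rule continuous_on_compose2[OF cont[OF \<alpha> \<alpha>]]) (auto intro!: continuous_intros)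
    then show "(\<lambda>x. K (\<alpha>, x) (\<alpha>, x)) \<in> borel_measurable \<Lambda>"
      using continuous_imp_measurable_on_sets_lebesgue[OF _ domain_sets] by simp
  qed
  fix \<epsilon> :: real assume "0 < \<epsilon>"
  have "\<exists>F. finite F \<and> F \<subseteq> \<Theta> \<and> (\<forall>x\<in>\<Theta>. \<exists>y\<in>F. kdist2 K (\<alpha>, x) (\<alpha>, y) < \<epsilon>)" if \<alpha>: "\<alpha> \<in> A" for \<alpha>
  proof -
    obtain \<delta> where \<delta>: "0 < \<delta>" "\<forall>x\<in>\<Theta>. \<forall>y\<in>\<Theta>. dist x y < \<delta> \<longrightarrow> kdist2 K (\<alpha>, x) (\<alpha>, y) < \<epsilon>"
      using kdist2_small[OF \<alpha> \<open>0 < \<epsilon>\<close>] by blast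
    have cpt: "compact (closure \<Theta>)"
      using bounded_domain by (simp add: compact_closure)
    \<comment> \<open>Balls centred in the domain already cover the compact closure, so the net can
      be taken inside the domain, where the kernel is controlled.\<close>
    have cover: "closure \<Theta> \<subseteq> (\<Union>y\<in>\<Theta>. ball y \<delta>)"
    proof
      fix x assume "x \<in> closure \<Theta>"
      then obtain y where "y \<in> \<Theta>" "dist y x < \<delta>"
        using \<delta>(1) unfolding closure_approachable by blast
      then show "x \<in> (\<Union>y\<in>\<Theta>. ball y \<delta>)"
        by auto
    qed
    obtain F where F: "F \<subseteq> \<Theta>" "finite F" "closure \<Theta> \<subseteq> (\<Union>y\<in>F. ball y \<delta>)"
      by (rule compactE_image[OF cpt _ cover]) auto
    have "\<forall>x\<in>\<Theta>. \<exists>y\<in>F. kdist2 K (\<alpha>, x) (\<alpha>, y) < \<epsilon>"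
    proof
      fix x assume x: "x \<in> \<Theta>"
      then obtain y where "y \<in> F" "dist y x < \<delta>"
        using F(3) closure_subset[of \<Theta>] by fastforce
      then show "\<exists>y\<in>F. kdist2 K (\<alpha>, x) (\<alpha>, y) < \<epsilon>"
        using \<delta>(2) x F(1) by (intro bexI[of _ y]) (auto simp: dist_commute)
    qed
    with F show ?thesis
      by blast
  qed
  then obtain F where F: "\<And>\<alpha>. \<alpha> \<in> A \<Longrightarrow> finite (F \<alpha>) \<and> F \<alpha> \<subseteq> \<Theta> \<and> (\<forall>x\<in>\<Theta>. \<exists>y\<in>F \<alpha>. kdist2 K (\<alpha>, x) (\<alpha>, y) < \<epsilon>)"
    by metis
  show "\<exists>F. finite F \<and> F \<subseteq> space M \<and> (\<forall>x\<in>space M. \<exists>y\<in>F. kdist2 K x y < \<epsilon>)"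
  proof (intro exI[of _ "Sigma A F"] conjI ballI)
    show "finite (Sigma A F)"
      using F finite_A by (intro finite_SigmaI) auto
    show "Sigma A F \<subseteq> space M"
      using F by (auto simp: space_M)
    show "\<exists>y\<in>Sigma A F. kdist2 K p y < \<epsilon>" if pM: "p \<in> space M" for p
    proof -
      obtain \<alpha> x where p: "p = (\<alpha>, x)" "\<alpha> \<in> A" "x \<in> \<Theta>"
        using pM by (auto simp: space_M)
      obtain y where "y \<in> F \<alpha>" "kdist2 K (\<alpha>, x) (\<alpha>, y) < \<epsilon>"
        using F[OF p(2)] p(3) by blast
      then show ?thesis
        using p by (intro bexI[of _ "(\<alpha>, y)"]) auto
    qed
  qed
qed

text \<open>The \<open>kdist2\<close> ball contains a copy of a non-empty open subset of the domain,
  and non-empty open sets are not negligible.\<close>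

lemma kernel_ball_pos_measure:
  assumes "p \<in> space M" "0 < \<epsilon>"
  shows "\<exists>U\<in>sets M. 0 < measure M U \<and> (\<forall>q\<in>U. kdist2 K p q < \<epsilon>)"
proof -
  obtain \<alpha> x where p: "p = (\<alpha>, x)" "\<alpha> \<in> A" "x \<in> \<Theta>"
    using assms by (auto simp: space_M)
  obtain \<delta> where \<delta>: "0 < \<delta>" "\<forall>x\<in>\<Theta>. \<forall>y\<in>\<Theta>. dist x y < \<delta> \<longrightarrow> kdist2 K (\<alpha>, x) (\<alpha>, y) < \<epsilon>"
    using kdist2_small[OF p(2) assms(2)] by blast
  define V where "V = \<Theta> \<inter> ball x \<delta>"
  have V: "open V" "x \<in> V" "V \<subseteq> \<Theta>"
    using open_domain p \<delta> by (auto simp: V_def)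
  have V_sets: "V \<in> sets \<Lambda>"
    using V domain_sets by (simp add: sets_restrict_space_iff open_in_lebesgue)
  have "emeasure \<Lambda> V = emeasure lebesgue V"
    using V domain_sets by (simp add: emeasure_restrict_space)
  moreover have "emeasure lebesgue V \<noteq> 0"
    using open_not_negligible[OF V(1)] V by (auto simp: negligible_iff_null_sets null_sets_def open_in_lebesgue)
  ultimately have "emeasure \<Lambda> V \<noteq> 0"
    by simp
  interpret L: finite_measure \<Lambda>
    by (rule finite_measure_\<Lambda>)
  have "emeasure M ({\<alpha>} \<times> V) = emeasure (count_space A) {\<alpha>} * emeasure \<Lambda> V"
    unfolding M_def using p V_sets by (intro L.emeasure_pair_measure_Times) auto
  also have "\<dots> = emeasure \<Lambda> V"
    using p by simp
  finally have "emeasure M ({\<alpha>} \<times> V) \<noteq> 0"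
    using \<open>emeasure \<Lambda> V \<noteq> 0\<close> by simp
  then have "0 < measure M ({\<alpha>} \<times> V)"
    by (metis emeasure_eq_measure ennreal_0 measure_nonneg order_less_le)
  moreover have "{\<alpha>} \<times> V \<in> sets M"
    unfolding M_def using p V_sets by (intro pair_measureI) auto
  moreover have "\<forall>q\<in>{\<alpha>} \<times> V. kdist2 K p q < \<epsilon>"
    using \<delta>(2) p V by (auto simp: V_def)
  ultimately show ?thesis
    by blast
qed

lemma kop_eq_sum:
  assumes "\<And>\<alpha>. \<alpha> \<in> A \<Longrightarrow> integrable \<Lambda> (\<lambda>x. F (\<alpha>, x))" "p \<in> space M"
  shows "kop F p = (\<Sum>\<alpha>\<in>A. \<integral>x. K p (\<alpha>, x) * F (\<alpha>, x) \<partial>\<Lambda>)"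
    and "\<And>\<alpha>. \<alpha> \<in> A \<Longrightarrow> integrable \<Lambda> (\<lambda>x. K p (\<alpha>, x) * F (\<alpha>, x))"
proof -
  show int: "integrable \<Lambda> (\<lambda>x. K p (\<alpha>, x) * F (\<alpha>, x))" if \<alpha>: "\<alpha> \<in> A" for \<alpha>
  proof -
    have "integrable \<Lambda> (\<lambda>x. F (\<alpha>, x) * K p (\<alpha>, x))"
    proof (rule integrable_mult_bounded[OF assms(1)[OF \<alpha>]])
      show "(\<lambda>x. K p (\<alpha>, x)) \<in> borel_measurable \<Lambda>"
        using measurable_section'[OF assms(2)] \<alpha> unfolding measurable_M_iff by blast
      show "\<bar>K p (\<alpha>, x)\<bar> \<le> kbound" if "x \<in> space \<Lambda>" for x
        using that \<alpha> by (intro abs_le_kbound assms(2)) (simp add: space_M)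
    qed
    then show ?thesis
      by (simp add: mult.commute)
  qed
  show "kop F p = (\<Sum>\<alpha>\<in>A. \<integral>x. K p (\<alpha>, x) * F (\<alpha>, x) \<partial>\<Lambda>)"
    unfolding kop_def by (rule integrable_M(2)[OF int])
qed

text \<open>Comparing slice by slice avoids any description of the null sets of the product
  measure.\<close>

lemma kop_cong_slices:
  assumes "\<And>\<alpha>. \<alpha> \<in> A \<Longrightarrow> integrable \<Lambda> (\<lambda>x. F (\<alpha>, x))" "\<And>\<alpha>. \<alpha> \<in> A \<Longrightarrow> integrable \<Lambda> (\<lambda>x. G (\<alpha>, x))"
    and "\<And>\<alpha>. \<alpha> \<in> A \<Longrightarrow> AE x in \<Lambda>. F (\<alpha>, x) = G (\<alpha>, x)" and p: "p \<in> space M"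
  shows "kop F p = kop G p"
proof -
  have "(\<integral>x. K p (\<alpha>, x) * F (\<alpha>, x) \<partial>\<Lambda>) = (\<integral>x. K p (\<alpha>, x) * G (\<alpha>, x) \<partial>\<Lambda>)" if \<alpha>: "\<alpha> \<in> A" for \<alpha>
  proof (rule integral_cong_AE)
    show "AE x in \<Lambda>. K p (\<alpha>, x) * F (\<alpha>, x) = K p (\<alpha>, x) * G (\<alpha>, x)"
      using assms(3)[OF \<alpha>] by eventually_elim simp
  qed (use kop_eq_sum(2)[OF assms(1) p \<alpha>] kop_eq_sum(2)[OF assms(2) p \<alpha>] in auto)
  then show ?thesis
    by (simp add: kop_eq_sum(1)[OF assms(1) p] kop_eq_sum(1)[OF assms(2) p])
qed

section \<open>Derivative families of smooth functions\<close>

lemma count_list_in_A: "length is \<le> k \<Longrightarrow> count_list is \<in> A"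
  by (simp add: mi_upto_def mi_order_count_list)

lemma count_list_mi_list_eq: "count_list (mi_list \<alpha>) = \<alpha>"
  by (simp add: fun_eq_iff count_list_mi_list)

lemma zero_in_A: "(\<lambda>_. 0) \<in> A"
  by (simp add: mi_upto_def mi_order_def)

text \<open>Stated at every point of the line, not only at \<open>t = 0\<close>, because
  differentiation under the integral relies on the mean value theorem.\<close>

lemma K_has_derivative:
  assumes len: "length (i # is) \<le> k" and y: "y + t *\<^sub>R axis i 1 \<in> \<Theta>" and q: "q \<in> space M"
  shows "((\<lambda>s. K (count_list is, y + s *\<^sub>R axis i 1) q) has_real_derivative
    K (count_list (i # is), y + t *\<^sub>R axis i 1) q) (at t)"
proof -
  obtain \<beta> x where \<beta>: "q = (\<beta>, x)" "\<beta> \<in> A" "x \<in> \<Theta>"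
    using q by (auto simp: space_M)
  define js where "js = mi_list \<beta>"
  have js: "length js \<le> k" "count_list js = \<beta>"
    using \<beta> by (simp_all add: js_def length_mi_list mi_upto_def count_list_mi_list_eq)
  let ?f = "kernel_iter_deriv (map Inl is @ map Inr js) h"
  have "kernel_class k (mset (map Inl (i # is) @ map Inr js))"
    by (rule kernel_class_Inl_Inr[THEN iffD2]) (use len js in simp)
  from Ckk_closureD(1)[OF smooth_kernel this]
  have "(\<lambda>s. ?f ((y, x) + t *\<^sub>R kernel_dir (Inl i) + s *\<^sub>R kernel_dir (Inl i))) differentiable (at 0)"
    using y \<beta> by simp
  from has_dir_deriv[OF this]
  have "((\<lambda>s. ?f (y + s *\<^sub>R axis i 1, x)) has_real_derivative
      kernel_iter_deriv (map Inl (i # is) @ map Inr js) h (y + t *\<^sub>R axis i 1, x)) (at t)"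
    by simp
  also have "kernel_iter_deriv (map Inl (i # is) @ map Inr js) h (y + t *\<^sub>R axis i 1, x) =
      K (count_list (i # is), y + t *\<^sub>R axis i 1) q"
    using K_iter_deriv[OF len js(1) y \<beta>(3)] by (simp add: \<beta> js)
  finally show ?thesis
  proof (rule has_field_derivative_transform_within_open)
    have "continuous_on UNIV (\<lambda>s. y + s *\<^sub>R axis i 1)"
      by (intro continuous_intros)
    then show "open ((\<lambda>s. y + s *\<^sub>R axis i 1) -` \<Theta>)"
      by (rule open_vimage[OF open_domain])
    show "?f (y + s *\<^sub>R axis i 1, x) = K (count_list is, y + s *\<^sub>R axis i 1) q"
      if "s \<in> (\<lambda>s. y + s *\<^sub>R axis i 1) -` \<Theta>" for s
      using K_iter_deriv[of "is" js "y + s *\<^sub>R axis i 1" x] that len js \<beta> by simp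
  qed (use y in simp)
qed

text \<open>These are the families of all derivatives of one function in \<open>Ck_closure\<close>,
  described by relations of first order between neighbouring members. In this form the property
  holds visibly for images of \<open>kop\<close> and passes to uniform limits.\<close>

definition smooth_family :: "('n multi_index \<times> (real^'n) \<Rightarrow> real) \<Rightarrow> bool" where
  "smooth_family G \<longleftrightarrow>
     (\<forall>i is y. length (i # is) \<le> k \<longrightarrow> y \<in> \<Theta> \<longrightarrow>
       ((\<lambda>t. G (count_list is, y + t *\<^sub>R axis i 1)) has_real_derivative G (count_list (i # is), y)) (at 0)) \<and>
     (\<forall>\<alpha>\<in>A. uniformly_continuous_on \<Theta> (\<lambda>x. G (\<alpha>, x)))"

lemma smooth_family_sqint:
  assumes G: "smooth_family G" and \<alpha>: "\<alpha> \<in> A"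
  shows "(\<lambda>x. G (\<alpha>, x)) \<in> sqint \<Lambda>"
proof -
  have uc: "uniformly_continuous_on \<Theta> (\<lambda>x. G (\<alpha>, x))"
    using G \<alpha> by (simp add: smooth_family_def)
  obtain C where C: "\<And>x. x \<in> \<Theta> \<Longrightarrow> \<bar>G (\<alpha>, x)\<bar> \<le> C"
    using bounded_uniformly_continuous_image[OF uc bounded_domain] unfolding bounded_iff by auto
  show ?thesis
    by (rule finite_measure.sqint_bounded[OF finite_measure_\<Lambda>, of _ C])
      (use C uniformly_continuous_imp_continuous[OF uc] domain_sets
        in \<open>auto intro: continuous_imp_measurable_on_sets_lebesgue\<close>)
qed

text \<open>The function is the member of order zero, and induction over the list of coordinates
  composes the first-order relations. Agreement on the open domain suffices, since derivatives are
  local.\<close>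

lemma smooth_family_Ck:
  assumes G: "smooth_family G" and g: "\<And>y. y \<in> \<Theta> \<Longrightarrow> g y = G (\<lambda>_. 0, y)"
  shows "g \<in> Ck_closure \<Theta> k" and "\<And>\<alpha> y. \<alpha> \<in> A \<Longrightarrow> y \<in> \<Theta> \<Longrightarrow> class_deriv \<alpha> g y = G (\<alpha>, y)"
proof -
  have iter: "iter_deriv_exists_on \<Theta> (map (\<lambda>i. axis i 1) is) g \<and>
      (\<forall>y\<in>\<Theta>. coord_deriv is g y = G (count_list is, y))" if "length is \<le> k" for "is"
    using that
  proof (induction "is")
    case Nil
    then show ?case
      using g by (simp add: fun_eq_iff)
  next
    case (Cons i "is")
    have IH: "iter_deriv_exists_on \<Theta> (map (\<lambda>i. axis i 1) is) g"
        "\<And>y. y \<in> \<Theta> \<Longrightarrow> coord_deriv is g y = G (count_list is, y)"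
      using Cons by auto
    have der: "((\<lambda>t. G (count_list is, y + t *\<^sub>R axis i 1)) has_real_derivative G (count_list (i # is), y)) (at 0)"
      if "y \<in> \<Theta>" for y
      using G that Cons.prems unfolding smooth_family_def by blast
    have "(\<lambda>t::real. coord_deriv is g (y + t *\<^sub>R axis i 1)) differentiable (at 0)" if "y \<in> \<Theta>" for y
      using differentiable_cong_open[where f="coord_deriv is g" and g="\<lambda>y. G (count_list is, y)",
          OF open_domain that IH(2)]
        dir_derivI(2)[where f="\<lambda>y. G (count_list is, y)", OF der[OF that]] by simp
    moreover have "dir_deriv (axis i 1) (coord_deriv is g) y = G (count_list (i # is), y)" if "y \<in> \<Theta>" for y
      using dir_deriv_cong_open[where f="coord_deriv is g" and g="\<lambda>y. G (count_list is, y)",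
          OF open_domain that IH(2)]
        dir_derivI(1)[where f="\<lambda>y. G (count_list is, y)", OF der[OF that]] by simp
    ultimately show ?case
      using IH(1) by (simp del: count_list.simps)
  qed
  show cls: "class_deriv \<alpha> g y = G (\<alpha>, y)" if "\<alpha> \<in> A" "y \<in> \<Theta>" for \<alpha> y
    using iter[of "mi_list \<alpha>"] that
    by (simp add: class_deriv_def length_mi_list mi_upto_def count_list_mi_list_eq)
  have uc: "uniformly_continuous_on \<Theta> (\<lambda>x. G (\<alpha>, x))" if "\<alpha> \<in> A" for \<alpha>
    using G that by (simp add: smooth_family_def)
  have "continuous_on \<Theta> (coord_deriv is g)" if "length is \<le> k" for "is"
    using iter[OF that] uniformly_continuous_imp_continuous[OF uc[OF count_list_in_A[OF that]]]
    by (simp cong: continuous_on_cong)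
  then have "g \<in> Ck \<Theta> k"
    using iter by (simp add: Ck_def)
  moreover have "uniformly_continuous_on \<Theta> (class_deriv \<alpha> g)" if "\<alpha> \<in> A" for \<alpha>
    using uc[OF that] cls[OF that] unfolding uniformly_continuous_on_def by simp
  ultimately show "g \<in> Ck_closure \<Theta> k"
    by (simp add: Ck_closure_def)
qed

lemma smooth_family_Hk:
  assumes G: "smooth_family G" and g: "\<And>y. y \<in> \<Theta> \<Longrightarrow> g y = G (\<lambda>_. 0, y)"
  shows "g \<in> Hk \<Theta> k" and "\<And>\<alpha>. \<alpha> \<in> A \<Longrightarrow> AE y in \<Lambda>. weak_deriv \<Theta> \<alpha> g y = G (\<alpha>, y)"
proof -
  have sq: "f \<in> sqint \<Lambda>" if "\<alpha> \<in> A" "\<And>y. y \<in> \<Theta> \<Longrightarrow> f y = G (\<alpha>, y)" for f \<alpha>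
  proof (rule sqint_cong_AE[OF smooth_family_sqint[OF G that(1)]])
    show "f \<in> borel_measurable \<Lambda>"
      using sqint_measurable[OF smooth_family_sqint[OF G that(1)]] that(2)
        measurable_cong[of \<Lambda> f "\<lambda>y. G (\<alpha>, y)" borel] by simp
    show "AE y in \<Lambda>. G (\<alpha>, y) = f y"
      using that(2) by (intro AE_I2) simp
  qed
  have "g \<in> Ck \<Theta> k"
    using smooth_family_Ck(1)[OF G g] by (simp add: Ck_closure_def)
  then have weak: "has_weak_deriv \<Theta> \<alpha> g (class_deriv \<alpha> g)" if "\<alpha> \<in> A" for \<alpha>
    by (rule Ck_has_weak_deriv[OF open_domain _ that])
  have "class_deriv \<alpha> g \<in> sqint \<Lambda>" if "\<alpha> \<in> A" for \<alpha>
    by (rule sq[OF that smooth_family_Ck(2)[OF G g that]])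
  moreover have "g \<in> sqint \<Lambda>"
    by (rule sq[OF zero_in_A g])
  ultimately show "g \<in> Hk \<Theta> k"
    unfolding Hk_def L2_eq_sqint using weak by blast
  show "AE y in \<Lambda>. weak_deriv \<Theta> \<alpha> g y = G (\<alpha>, y)" if \<alpha>: "\<alpha> \<in> A" for \<alpha>
    using weak_deriv_AE_eq[OF open_domain weak[OF \<alpha>]] AE_space
    by eventually_elim (simp add: smooth_family_Ck(2)[OF G g \<alpha>])
qed

lemma line_in_domain:
  assumes "y \<in> \<Theta>"
  obtains r where "0 < r" "\<And>t::real. \<bar>t\<bar> < r \<Longrightarrow> y + t *\<^sub>R v \<in> \<Theta>"
  using eventually_line_in_open[OF open_domain assms, of v] unfolding eventually_nhds_metric
  by (auto simp: dist_real_def)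

text \<open>The operator smooths any integrable family, even one that is no derivative family. The
  relations come from differentiation under the integral with majorant
  \<open>kbound * \<bar>F q\<bar>\<close>, the uniform continuity from the Lipschitz bound for the
  pseudometric.\<close>

lemma smooth_family_kop:
  assumes F: "integrable M F"
  shows "smooth_family (kop F)"
  unfolding smooth_family_def
proof (intro conjI allI impI ballI)
  fix i :: 'n and "is" :: "'n list" and y
  assume len: "length (i # is) \<le> k" and y: "y \<in> \<Theta>"
  obtain r where r: "0 < r" "\<And>t. \<bar>t\<bar> < r \<Longrightarrow> y + t *\<^sub>R axis i 1 \<in> \<Theta>"
    using line_in_domain[OF y] by blast
  have in_M: "(count_list js, y + t *\<^sub>R axis i 1) \<in> space M" if "\<bar>t\<bar> < r" "length js \<le> k" for t js
    using r(2)[OF that(1)] count_list_in_A[OF that(2)] by (simp add: space_M)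
  have "((\<lambda>t. \<integral>q. K (count_list is, y + t *\<^sub>R axis i 1) q * F q \<partial>M) has_real_derivative
      (\<integral>q. K (count_list (i # is), y + 0 *\<^sub>R axis i 1) q * F q \<partial>M)) (at 0)"
  proof (rule has_real_derivative_integral(1)[OF r(1)])
    show "((\<lambda>t. K (count_list is, y + t *\<^sub>R axis i 1) q * F q) has_real_derivative
        K (count_list (i # is), y + t *\<^sub>R axis i 1) q * F q) (at t)"
      if "\<bar>t\<bar> < r" "q \<in> space M" for t q
      by (rule DERIV_cmult_right[OF K_has_derivative[OF len r(2)[OF that(1)] that(2)]])
    show "\<bar>K (count_list (i # is), y + t *\<^sub>R axis i 1) q * F q\<bar> \<le> kbound * \<bar>F q\<bar>"
      if "\<bar>t\<bar> < r" "q \<in> space M" for t q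
      unfolding abs_mult
      by (rule mult_right_mono[OF abs_le_kbound[OF in_M[OF that(1) len] that(2)] abs_ge_zero])
    show "integrable M (\<lambda>q. kbound * \<bar>F q\<bar>)"
      using F by simp
    show "integrable M (\<lambda>q. K (count_list is, y + t *\<^sub>R axis i 1) q * F q)" if "\<bar>t\<bar> < r" for t
      by (rule integrable_section_mult[OF F in_M[OF that]]) (use len in simp)
  qed
  then show "((\<lambda>t. kop F (count_list is, y + t *\<^sub>R axis i 1)) has_real_derivative
      kop F (count_list (i # is), y)) (at 0)"
    by (simp add: kop_def)
next
  fix \<alpha> :: "'n multi_index" assume \<alpha>: "\<alpha> \<in> A"
  define I where "I = (\<integral>q. \<bar>F q\<bar> \<partial>M)"
  have "0 \<le> I"
    by (simp add: I_def)
  show "uniformly_continuous_on \<Theta> (\<lambda>x. kop F (\<alpha>, x))"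
    unfolding uniformly_continuous_on_def
  proof (intro allI impI)
    fix e :: real assume "0 < e"
    \<comment> \<open>The Lipschitz bound then gives an oscillation of at most \<open>e / 2\<close>;
      the \<open>I + 1\<close> avoids a zero denominator.\<close>
    define \<eta> where "\<eta> = (e / (2 * sqrt kbound * (I + 1)))\<^sup>2"
    have "0 < \<eta>"
      using \<open>0 < e\<close> kbound_pos \<open>0 \<le> I\<close> by (simp add: \<eta>_def)
    have sqrt_\<eta>: "sqrt \<eta> = e / (2 * sqrt kbound * (I + 1))"
      using \<open>0 < e\<close> kbound_pos \<open>0 \<le> I\<close> by (simp add: \<eta>_def real_sqrt_abs)
    have cancel: "e / (2 * s * b) * s * b = e / 2" if "0 < s" "0 < b" for s b
      using that by simp
    have \<eta>: "sqrt \<eta> * sqrt kbound * (I + 1) = e / 2"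
      unfolding sqrt_\<eta> by (rule cancel) (use kbound_pos \<open>0 \<le> I\<close> in auto)
    obtain \<delta> where \<delta>: "0 < \<delta>" "\<forall>x\<in>\<Theta>. \<forall>y\<in>\<Theta>. dist x y < \<delta> \<longrightarrow> kdist2 K (\<alpha>, x) (\<alpha>, y) < \<eta>"
      using kdist2_small[OF \<alpha> \<open>0 < \<eta>\<close>] by blast
    show "\<exists>d>0. \<forall>x\<in>\<Theta>. \<forall>x'\<in>\<Theta>. dist x' x < d \<longrightarrow> dist (kop F (\<alpha>, x')) (kop F (\<alpha>, x)) < e"
    proof (intro exI[of _ \<delta>] conjI ballI impI \<delta>(1))
      fix x x' assume x: "x \<in> \<Theta>" "x' \<in> \<Theta>" "dist x' x < \<delta>"
      have "\<bar>kop F (\<alpha>, x') - kop F (\<alpha>, x)\<bar> \<le> sqrt (kdist2 K (\<alpha>, x') (\<alpha>, x)) * sqrt kbound * I"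
        unfolding I_def using x \<alpha> by (intro kop_diff_le[OF F]) (simp_all add: space_M)
      also have "\<dots> \<le> sqrt \<eta> * sqrt kbound * (I + 1)"
        using \<delta>(2) x kbound_pos \<open>0 < \<eta>\<close> \<open>0 \<le> I\<close> by (intro mult_mono) (auto intro: less_imp_le)
      also have "\<dots> < e"
        using \<eta> \<open>0 < e\<close> by simp
      finally show "dist (kop F (\<alpha>, x')) (kop F (\<alpha>, x)) < e"
        by (simp add: dist_real_def)
    qed
  qed
qed

text \<open>All members converge uniformly, in particular a member together with its derivative, so
  limits and derivatives may be exchanged along each short segment.\<close>

lemma smooth_family_uniform_limit:
  assumes G: "\<And>n. smooth_family (G n)" and lim: "uniform_limit (space M) G g sequentially"
  shows "smooth_family g"
  unfolding smooth_family_def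
proof (intro conjI allI impI ballI)
  have plim: "(\<lambda>n. G n p) \<longlonglongrightarrow> g p" if "p \<in> space M" for p
    by (rule tendsto_uniform_limitI[OF lim that])
  fix i :: 'n and "is" :: "'n list" and y
  assume len: "length (i # is) \<le> k" and y: "y \<in> \<Theta>"
  obtain r where r: "0 < r" "\<And>t. \<bar>t\<bar> < r \<Longrightarrow> y + t *\<^sub>R axis i 1 \<in> \<Theta>"
    using line_in_domain[OF y] by blast
  let ?S = "{-r<..<r}"
  have in_M: "(count_list js, y + t *\<^sub>R axis i 1) \<in> space M" if "t \<in> ?S" "length js \<le> k" for t js
    using r(2)[of t] that count_list_in_A[OF that(2)] by (auto simp: space_M)
  have "\<exists>f. \<forall>t\<in>?S. (\<lambda>n. G n (count_list is, y + t *\<^sub>R axis i 1)) \<longlonglongrightarrow> f t \<and>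
      (f has_derivative (*) (g (count_list (i # is), y + t *\<^sub>R axis i 1))) (at t within ?S)"
  proof (rule has_derivative_sequence[where f'="\<lambda>n t. (*) (G n (count_list (i # is), y + t *\<^sub>R axis i 1))"])
    show "convex ?S"
      by simp
    show "0 \<in> ?S"
      using r(1) by simp
    show "(\<lambda>n. G n (count_list is, y + 0 *\<^sub>R axis i 1)) \<longlonglongrightarrow> g (count_list is, y)"
      using plim[OF in_M[of 0 "is"]] r(1) len by simp
    show "((\<lambda>t. G n (count_list is, y + t *\<^sub>R axis i 1)) has_derivative
        (*) (G n (count_list (i # is), y + t *\<^sub>R axis i 1))) (at t within ?S)" if "t \<in> ?S" for n t
    proof -
      have "y + t *\<^sub>R axis i 1 \<in> \<Theta>"
        using r(2)[of t] that by auto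
      then have "((\<lambda>s. G n (count_list is, y + t *\<^sub>R axis i 1 + s *\<^sub>R axis i 1)) has_real_derivative
          G n (count_list (i # is), y + t *\<^sub>R axis i 1)) (at 0)"
        using G[of n] len unfolding smooth_family_def by blast
      then have "((\<lambda>s. G n (count_list is, y + s *\<^sub>R axis i 1)) has_real_derivative
          G n (count_list (i # is), y + t *\<^sub>R axis i 1)) (at t)"
        using DERIV_shift[of "\<lambda>s. G n (count_list is, y + s *\<^sub>R axis i 1)" _ 0 t]
        by (simp add: scaleR_add_left add_ac)
      then show ?thesis
        unfolding has_field_derivative_def by (rule has_derivative_at_withinI)
    qed
    show "\<forall>\<^sub>F n in sequentially. \<forall>t\<in>?S. \<forall>d. norm (G n (count_list (i # is), y + t *\<^sub>R axis i 1) * d -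
        g (count_list (i # is), y + t *\<^sub>R axis i 1) * d) \<le> e * norm d" if "0 < e" for e
      using uniform_limitD[OF lim that]
    proof eventually_elim
      case (elim n)
      show ?case
      proof (intro ballI allI)
        fix t d assume "t \<in> ?S"
        then have "\<bar>G n (count_list (i # is), y + t *\<^sub>R axis i 1) - g (count_list (i # is), y + t *\<^sub>R axis i 1)\<bar> \<le> e"
          using elim in_M[OF _ len] by (force simp: dist_real_def)
        then show "norm (G n (count_list (i # is), y + t *\<^sub>R axis i 1) * d -
            g (count_list (i # is), y + t *\<^sub>R axis i 1) * d) \<le> e * norm d"
          unfolding left_diff_distrib[symmetric] real_norm_def abs_mult by (rule mult_right_mono) simp
      qed
    qed
  qed
  then obtain f where f: "\<And>t. t \<in> ?S \<Longrightarrow> (\<lambda>n. G n (count_list is, y + t *\<^sub>R axis i 1)) \<longlonglongrightarrow> f t"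
    "\<And>t. t \<in> ?S \<Longrightarrow> (f has_derivative (*) (g (count_list (i # is), y + t *\<^sub>R axis i 1))) (at t within ?S)"
    by blast
  have eq: "f t = g (count_list is, y + t *\<^sub>R axis i 1)" if "t \<in> ?S" for t
    using LIMSEQ_unique[OF f(1)[OF that] plim[OF in_M[OF that]]] len by simp
  have "(f has_derivative (*) (g (count_list (i # is), y))) (at 0)"
    using f(2)[of 0] r(1) by (simp add: at_within_open[of 0 ?S])
  then have "(f has_real_derivative g (count_list (i # is), y)) (at 0)"
    by (simp add: has_field_derivative_def)
  then show "((\<lambda>t. g (count_list is, y + t *\<^sub>R axis i 1)) has_real_derivative g (count_list (i # is), y)) (at 0)"
    by (rule has_field_derivative_transform_within_open[of _ _ _ ?S]) (use eq r(1) in auto)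
next
  fix \<alpha> :: "'n multi_index" assume \<alpha>: "\<alpha> \<in> A"
  show "uniformly_continuous_on \<Theta> (\<lambda>x. g (\<alpha>, x))"
    unfolding uniformly_continuous_on_def
  proof (intro allI impI)
    fix e :: real assume "0 < e"
    then have "0 < e / 3"
      by simp
    from uniform_limitD[OF lim this] obtain n where n: "\<forall>p\<in>space M. dist (G n p) (g p) < e / 3"
      unfolding eventually_sequentially by blast
    have "uniformly_continuous_on \<Theta> (\<lambda>x. G n (\<alpha>, x))"
      using G \<alpha> by (simp add: smooth_family_def)
    then obtain d where d: "0 < d" "\<And>x x'. x \<in> \<Theta> \<Longrightarrow> x' \<in> \<Theta> \<Longrightarrow> dist x' x < d \<Longrightarrow>
        dist (G n (\<alpha>, x')) (G n (\<alpha>, x)) < e / 3"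
      unfolding uniformly_continuous_on_def using \<open>0 < e / 3\<close> by meson
    show "\<exists>d>0. \<forall>x\<in>\<Theta>. \<forall>x'\<in>\<Theta>. dist x' x < d \<longrightarrow> dist (g (\<alpha>, x')) (g (\<alpha>, x)) < e"
    proof (intro exI[of _ d] conjI ballI impI d(1))
      fix x x' assume x: "x \<in> \<Theta>" "x' \<in> \<Theta>" "dist x' x < d"
      have "dist (G n (\<alpha>, x)) (g (\<alpha>, x)) < e / 3" "dist (G n (\<alpha>, x')) (g (\<alpha>, x')) < e / 3"
        using n x \<alpha> by (simp_all add: space_M)
      with d(2)[OF x] show "dist (g (\<alpha>, x')) (g (\<alpha>, x)) < e"
        unfolding dist_real_def by linarith
    qed
  qed
qed

section \<open>The kernel operator on the Sobolev space\<close>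

definition derivs :: "(real^'n \<Rightarrow> real) \<Rightarrow> 'n multi_index \<times> (real^'n) \<Rightarrow> real" where
  "derivs f p = weak_deriv \<Theta> (fst p) f (snd p)"

lemma derivs_slice_sqint: "f \<in> Hk \<Theta> k \<Longrightarrow> \<alpha> \<in> A \<Longrightarrow> (\<lambda>x. derivs f (\<alpha>, x)) \<in> sqint \<Lambda>"
  using Hk_weak_deriv(2)[OF open_domain] by (simp add: derivs_def)

lemma derivs_slice_integrable: "f \<in> Hk \<Theta> k \<Longrightarrow> \<alpha> \<in> A \<Longrightarrow> integrable \<Lambda> (\<lambda>x. derivs f (\<alpha>, x))"
  by (rule finite_measure.sqint_integrable[OF finite_measure_\<Lambda> derivs_slice_sqint])

lemma derivs_sqint: "f \<in> Hk \<Theta> k \<Longrightarrow> derivs f \<in> sqint M"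
  by (rule sqint_M[OF derivs_slice_sqint])

lemma derivs_integrable: "f \<in> Hk \<Theta> k \<Longrightarrow> integrable M (derivs f)"
  by (rule sqint_integrable[OF derivs_sqint])

lemma kernel_op_eq_kop:
  assumes f: "f \<in> Hk \<Theta> k" and y: "y \<in> \<Theta>"
  shows "kernel_op \<Theta> k h f y = kop (derivs f) (\<lambda>_. 0, y)"
proof -
  have p: "(\<lambda>_. 0, y) \<in> space M"
    using y zero_in_A by (simp add: space_M)
  have "kernel_op \<Theta> k h f y = (\<integral>x. (\<Sum>\<alpha>\<in>A. K (\<lambda>_. 0, y) (\<alpha>, x) * derivs f (\<alpha>, x)) \<partial>\<Lambda>)"
    unfolding kernel_op_def
  proof (intro Bochner_Integration.integral_cong refl sum.cong)
    fix x and \<alpha> :: "'n multi_index" assume x: "x \<in> space \<Lambda>" and \<alpha>: "\<alpha> \<in> A"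
    \<comment> \<open>\<open>kernel_op\<close> integrates over the first variable of
      \<open>h\<close>, \<open>kop\<close> over the second argument of \<open>K\<close>; the
      symmetry of \<open>K\<close> reconciles them.\<close>
    have "K (\<alpha>, x) (\<lambda>_. 0, y) = K (\<lambda>_. 0, y) (\<alpha>, x)"
      by (rule psd_onD_sym[OF psd_K]) (use x \<alpha> y zero_in_A in auto)
    then show "kernel_deriv \<alpha> (\<lambda>_. 0) h (x, y) * weak_deriv \<Theta> \<alpha> f x =
        K (\<lambda>_. 0, y) (\<alpha>, x) * derivs f (\<alpha>, x)"
      by (simp add: K_def derivs_def)
  qed
  also have "\<dots> = (\<Sum>\<alpha>\<in>A. \<integral>x. K (\<lambda>_. 0, y) (\<alpha>, x) * derivs f (\<alpha>, x) \<partial>\<Lambda>)"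
    by (intro Bochner_Integration.integral_sum kop_eq_sum(2) derivs_slice_integrable f p)
  also have "\<dots> = kop (derivs f) (\<lambda>_. 0, y)"
    by (rule kop_eq_sum(1)[OF derivs_slice_integrable[OF f] p, symmetric])
  finally show ?thesis .
qed

lemma inner_Hk_eq:
  assumes "f \<in> Hk \<Theta> k" "g \<in> Hk \<Theta> k"
  shows "inner_Hk \<Theta> k f g = (\<integral>p. derivs f p * derivs g p \<partial>M)"
  using integrable_M(2)[of "\<lambda>p. derivs f p * derivs g p"]
    sqint_integrable_mult[OF derivs_slice_sqint[OF assms(1)] derivs_slice_sqint[OF assms(2)]]
  by (simp add: inner_Hk_def inner_L2_def derivs_def)

lemma smooth_family_kernel_op: "f \<in> Hk \<Theta> k \<Longrightarrow> smooth_family (kop (derivs f))"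
  by (rule smooth_family_kop[OF derivs_integrable])

text \<open>A sequence bounded in H^k has derivative families bounded in L^1, whose images under
  \<open>kop\<close> converge uniformly along a subsequence. Uniform boundedness on a domain of
  finite measure then gives convergence of each derivative in L^2.\<close>

theorem compact_operator_kernel_op:
  "compact_operator_on \<Theta> (H0k \<Theta> k) (norm_Hk \<Theta> k) (kernel_op \<Theta> k h)"
  unfolding compact_operator_on_def
proof (intro conjI ballI allI impI)
  fix f assume "f \<in> H0k \<Theta> k"
  then have f: "f \<in> Hk \<Theta> k"
    by (simp add: H0k_def)
  note sf = smooth_family_kernel_op[OF f] kernel_op_eq_kop[OF f]
  show "kernel_op \<Theta> k h f \<in> H0k \<Theta> k"
    using smooth_family_Ck(1)[OF sf] smooth_family_Hk(1)[OF sf] by (simp add: H0k_def Ck_closure_def)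
next
  fix f g :: "real^'n \<Rightarrow> real" and a b y
  assume "f \<in> H0k \<Theta> k" "g \<in> H0k \<Theta> k" and y: "y \<in> \<Theta>"
  then have f: "f \<in> Hk \<Theta> k" and g: "g \<in> Hk \<Theta> k"
    by (simp_all add: H0k_def)
  let ?l = "\<lambda>x. a * f x + b * g x"
  have l: "?l \<in> Hk \<Theta> k"
    by (rule Hk_lincomb[OF open_domain f g])
  have p: "(\<lambda>_. 0, y) \<in> space M"
    using y zero_in_A by (simp add: space_M)
  have "kop (derivs ?l) (\<lambda>_. 0, y) = kop (\<lambda>q. a * derivs f q + b * derivs g q) (\<lambda>_. 0, y)"
  proof (rule kop_cong_slices[OF derivs_slice_integrable[OF l] _ _ p])
    fix \<alpha> :: "'n multi_index" assume \<alpha>: "\<alpha> \<in> A"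
    show "integrable \<Lambda> (\<lambda>x. a * derivs f (\<alpha>, x) + b * derivs g (\<alpha>, x))"
      using derivs_slice_integrable[OF f \<alpha>] derivs_slice_integrable[OF g \<alpha>] by simp
    show "AE x in \<Lambda>. derivs ?l (\<alpha>, x) = a * derivs f (\<alpha>, x) + b * derivs g (\<alpha>, x)"
      using weak_deriv_lincomb[OF open_domain f g \<alpha>] by (simp add: derivs_def)
  qed
  then show "kernel_op \<Theta> k h ?l y = a * kernel_op \<Theta> k h f y + b * kernel_op \<Theta> k h g y"
    by (simp add: kernel_op_eq_kop f g l y kop_lincomb[OF derivs_integrable[OF f] derivs_integrable[OF g] p])
next
  fix f :: "nat \<Rightarrow> real^'n \<Rightarrow> real"
  assume "(\<forall>n. f n \<in> H0k \<Theta> k) \<and> (\<exists>B. \<forall>n. norm_Hk \<Theta> k (f n) \<le> B)"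
  then obtain B where f: "\<And>n. f n \<in> Hk \<Theta> k" and B: "\<And>n. norm_Hk \<Theta> k (f n) \<le> B"
    by (auto simp: H0k_def)
  define C where "C = measure M (space M) + B\<^sup>2"
  have L1: "(\<integral>p. \<bar>derivs (f n) p\<bar> \<partial>M) \<le> C" for n
  proof -
    have "0 \<le> inner_Hk \<Theta> k (f n) (f n)"
      by (simp add: inner_Hk_eq[OF f f])
    then have "inner_Hk \<Theta> k (f n) (f n) \<le> B\<^sup>2"
      using power_mono[OF B[of n], of 2] by (simp add: norm_Hk_def)
    then have "(\<integral>p. (derivs (f n) p)\<^sup>2 \<partial>M) \<le> B\<^sup>2"
      by (simp add: inner_Hk_eq[OF f f] power2_eq_square)
    then show ?thesis
      using sqint_L1_le[OF derivs_sqint[OF f[of n]]] by (simp add: C_def)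
  qed
  obtain r g where r: "strict_mono r" and lim: "uniform_limit (space M) (\<lambda>n. kop (derivs (f (r n)))) g sequentially"
    by (rule kop_convergent_subsequence[of "\<lambda>n. derivs (f n)" C]) (use f derivs_integrable L1 in auto)
  \<comment> \<open>A limit of C^k functions in the H^k norm need not be C^k; here the uniform
    convergence of all derivatives keeps the limit in the space.\<close>
  have sg: "smooth_family g"
    by (rule smooth_family_uniform_limit[OF smooth_family_kernel_op[OF f] lim])
  define u where "u y = g (\<lambda>_. 0, y)" for y
  have u: "u \<in> Ck_closure \<Theta> k" "u \<in> Hk \<Theta> k"
      "\<And>\<alpha>. \<alpha> \<in> A \<Longrightarrow> AE y in \<Lambda>. weak_deriv \<Theta> \<alpha> u y = g (\<alpha>, y)"
    using smooth_family_Ck(1)[OF sg u_def] smooth_family_Hk[OF sg u_def] by auto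
  have plim: "(\<lambda>n. kop (derivs (f (r n))) p) \<longlonglongrightarrow> g p" if "p \<in> space M" for p
    by (rule tendsto_uniform_limitI[OF lim that])
  have bound: "\<bar>kop (derivs (f n)) p\<bar> \<le> kbound * C" if "p \<in> space M" for n p
    by (rule order_trans[OF abs_kop_le[OF derivs_integrable[OF f] that] mult_left_mono[OF L1]])
      (use kbound_pos in simp)
  have g_bound: "\<bar>g p\<bar> \<le> kbound * C" if "p \<in> space M" for p
    by (rule LIMSEQ_le_const2[OF tendsto_rabs[OF plim[OF that]]]) (use bound[OF that] in blast)
  have norm_lim: "(\<lambda>n. \<integral>x. (kop (derivs (f (r n))) (\<alpha>, x) - g (\<alpha>, x))\<^sup>2 \<partial>\<Lambda>) \<longlonglongrightarrow> 0" if \<alpha>: "\<alpha> \<in> A" for \<alpha>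
  proof -
    have "(\<lambda>n. \<integral>x. (kop (derivs (f (r n))) (\<alpha>, x) - g (\<alpha>, x))\<^sup>2 \<partial>\<Lambda>) \<longlonglongrightarrow> (\<integral>x. 0 \<partial>\<Lambda>)"
    proof (rule integral_dominated_convergence)
      show "AE x in \<Lambda>. (\<lambda>n. (kop (derivs (f (r n))) (\<alpha>, x) - g (\<alpha>, x))\<^sup>2) \<longlonglongrightarrow> 0"
      proof (rule AE_I2)
        fix x assume "x \<in> space \<Lambda>"
        then have "(\<lambda>n. kop (derivs (f (r n))) (\<alpha>, x) - g (\<alpha>, x)) \<longlonglongrightarrow> 0"
          using \<alpha> by (intro LIM_zero plim) (simp add: space_M)
        then show "(\<lambda>n. (kop (derivs (f (r n))) (\<alpha>, x) - g (\<alpha>, x))\<^sup>2) \<longlonglongrightarrow> 0"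
          by simp
      qed
      show "AE x in \<Lambda>. norm ((kop (derivs (f (r n))) (\<alpha>, x) - g (\<alpha>, x))\<^sup>2) \<le> (2 * (kbound * C))\<^sup>2" for n
      proof (rule AE_I2)
        fix x assume "x \<in> space \<Lambda>"
        then have "(\<alpha>, x) \<in> space M"
          using \<alpha> by (simp add: space_M)
        then have "\<bar>kop (derivs (f (r n))) (\<alpha>, x) - g (\<alpha>, x)\<bar> \<le> 2 * (kbound * C)"
          using bound[of "(\<alpha>, x)" "r n"] g_bound[of "(\<alpha>, x)"] by linarith
        from power_mono[OF this abs_ge_zero, of 2]
        show "norm ((kop (derivs (f (r n))) (\<alpha>, x) - g (\<alpha>, x))\<^sup>2) \<le> (2 * (kbound * C))\<^sup>2"
          by simp
      qed
      show "integrable \<Lambda> (\<lambda>x. (2 * (kbound * C))\<^sup>2)"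
        by (rule finite_measure.integrable_const[OF finite_measure_\<Lambda>])
      show "(\<lambda>x. (kop (derivs (f (r n))) (\<alpha>, x) - g (\<alpha>, x))\<^sup>2) \<in> borel_measurable \<Lambda>" for n
        using sqint_measurable[OF smooth_family_sqint[OF smooth_family_kernel_op[OF f] \<alpha>], of "r n"]
          sqint_measurable[OF smooth_family_sqint[OF sg \<alpha>]] by simp
    qed simp
    then show ?thesis
      by simp
  qed
  have "inner_Hk \<Theta> k (\<lambda>x. kernel_op \<Theta> k h (f (r n)) x - u x) (\<lambda>x. kernel_op \<Theta> k h (f (r n)) x - u x) =
      (\<Sum>\<alpha>\<in>A. \<integral>x. (kop (derivs (f (r n))) (\<alpha>, x) - g (\<alpha>, x))\<^sup>2 \<partial>\<Lambda>)" for n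
    unfolding inner_Hk_def inner_L2_def
  proof (intro sum.cong refl integral_cong_AE)
    fix \<alpha> :: "'n multi_index" assume \<alpha>: "\<alpha> \<in> A"
    note sf = smooth_family_kernel_op[OF f] kernel_op_eq_kop[OF f]
    let ?T = "kernel_op \<Theta> k h (f (r n))"
    have T: "?T \<in> Hk \<Theta> k"
      by (rule smooth_family_Hk(1)[OF sf])
    have D: "(\<lambda>x. ?T x - u x) \<in> Hk \<Theta> k"
      using Hk_lincomb[OF open_domain T u(2), of 1 "-1"] by simp
    show "AE x in \<Lambda>. weak_deriv \<Theta> \<alpha> (\<lambda>x. ?T x - u x) x * weak_deriv \<Theta> \<alpha> (\<lambda>x. ?T x - u x) x =
        (kop (derivs (f (r n))) (\<alpha>, x) - g (\<alpha>, x))\<^sup>2"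
    proof -
      have "AE x in \<Lambda>. weak_deriv \<Theta> \<alpha> ?T x = kop (derivs (f (r n))) (\<alpha>, x)"
        by (rule smooth_family_Hk(2)[OF sf \<alpha>])
      with weak_deriv_lincomb[OF open_domain T u(2) \<alpha>, of 1 "-1"] u(3)[OF \<alpha>]
      show ?thesis
        by eventually_elim (simp add: power2_eq_square)
    qed
    show "(\<lambda>x. weak_deriv \<Theta> \<alpha> (\<lambda>x. ?T x - u x) x * weak_deriv \<Theta> \<alpha> (\<lambda>x. ?T x - u x) x) \<in> borel_measurable \<Lambda>"
      using sqint_measurable[OF Hk_weak_deriv(2)[OF open_domain D \<alpha>]] by simp
    show "(\<lambda>x. (kop (derivs (f (r n))) (\<alpha>, x) - g (\<alpha>, x))\<^sup>2) \<in> borel_measurable \<Lambda>"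
      using sqint_measurable[OF smooth_family_sqint[OF smooth_family_kernel_op[OF f] \<alpha>], of "r n"]
        sqint_measurable[OF smooth_family_sqint[OF sg \<alpha>]] by simp
  qed
  moreover have "(\<lambda>n. sqrt (\<Sum>\<alpha>\<in>A. \<integral>x. (kop (derivs (f (r n))) (\<alpha>, x) - g (\<alpha>, x))\<^sup>2 \<partial>\<Lambda>)) \<longlonglongrightarrow> sqrt (\<Sum>\<alpha>\<in>A. 0)"
    by (intro tendsto_real_sqrt tendsto_sum norm_lim)
  ultimately have "(\<lambda>n. norm_Hk \<Theta> k (\<lambda>x. kernel_op \<Theta> k h (f (r n)) x - u x)) \<longlonglongrightarrow> 0"
    by (simp add: norm_Hk_def)
  moreover have "u \<in> H0k \<Theta> k"
    using u by (simp add: H0k_def Ck_closure_def)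
  ultimately show "\<exists>r g. strict_mono r \<and> g \<in> H0k \<Theta> k \<and>
      (\<lambda>n. norm_Hk \<Theta> k (\<lambda>x. kernel_op \<Theta> k h (f (r n)) x - g x)) \<longlonglongrightarrow> 0"
    using r by blast
qed

lemma integral_mult_cong_slices:
  assumes "\<And>\<alpha>. \<alpha> \<in> A \<Longrightarrow> (\<lambda>x. f (\<alpha>, x)) \<in> sqint \<Lambda>" "\<And>\<alpha>. \<alpha> \<in> A \<Longrightarrow> (\<lambda>x. f' (\<alpha>, x)) \<in> sqint \<Lambda>"
    and "\<And>\<alpha>. \<alpha> \<in> A \<Longrightarrow> (\<lambda>x. g (\<alpha>, x)) \<in> sqint \<Lambda>" "\<And>\<alpha>. \<alpha> \<in> A \<Longrightarrow> (\<lambda>x. g' (\<alpha>, x)) \<in> sqint \<Lambda>"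
    and ae: "\<And>\<alpha>. \<alpha> \<in> A \<Longrightarrow> AE x in \<Lambda>. f (\<alpha>, x) = f' (\<alpha>, x)" "\<And>\<alpha>. \<alpha> \<in> A \<Longrightarrow> AE x in \<Lambda>. g (\<alpha>, x) = g' (\<alpha>, x)"
  shows "(\<integral>p. f p * g p \<partial>M) = (\<integral>p. f' p * g' p \<partial>M)"
proof -
  have "(\<integral>x. f (\<alpha>, x) * g (\<alpha>, x) \<partial>\<Lambda>) = (\<integral>x. f' (\<alpha>, x) * g' (\<alpha>, x) \<partial>\<Lambda>)" if \<alpha>: "\<alpha> \<in> A" for \<alpha>
  proof (rule integral_cong_AE)
    show "(\<lambda>x. f (\<alpha>, x) * g (\<alpha>, x)) \<in> borel_measurable \<Lambda>" "(\<lambda>x. f' (\<alpha>, x) * g' (\<alpha>, x)) \<in> borel_measurable \<Lambda>"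
      by (intro borel_measurable_times sqint_measurable assms \<alpha>)+
    show "AE x in \<Lambda>. f (\<alpha>, x) * g (\<alpha>, x) = f' (\<alpha>, x) * g' (\<alpha>, x)"
      using ae(1)[OF \<alpha>] ae(2)[OF \<alpha>] by eventually_elim simp
  qed
  moreover have "(\<integral>p. f p * g p \<partial>M) = (\<Sum>\<alpha>\<in>A. \<integral>x. f (\<alpha>, x) * g (\<alpha>, x) \<partial>\<Lambda>)"
    by (rule integrable_M(2)) (intro sqint_integrable_mult assms)
  moreover have "(\<integral>p. f' p * g' p \<partial>M) = (\<Sum>\<alpha>\<in>A. \<integral>x. f' (\<alpha>, x) * g' (\<alpha>, x) \<partial>\<Lambda>)"
    by (rule integrable_M(2)) (intro sqint_integrable_mult assms)
  ultimately show ?thesis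
    by simp
qed

lemma kop_cmult: "kop (\<lambda>q. c * f q) p = c * kop f p"
  by (simp add: kop_def mult.left_commute)

lemma weak_deriv_cong_AE:
  assumes u: "u \<in> Hk \<Theta> k" and v: "v \<in> Hk \<Theta> k" and ae: "AE x in \<Lambda>. u x = v x" and \<alpha>: "\<alpha> \<in> A"
  shows "AE x in \<Lambda>. weak_deriv \<Theta> \<alpha> v x = weak_deriv \<Theta> \<alpha> u x"
proof (rule weak_deriv_AE_eq[OF open_domain has_weak_deriv_cong_AE[OF open_domain _ _ ae]])
  show "has_weak_deriv \<Theta> \<alpha> u (weak_deriv \<Theta> \<alpha> u)"
    by (rule Hk_weak_deriv(1)[OF open_domain u \<alpha>])
  show "v \<in> borel_measurable \<Lambda>"
    using v by (simp add: Hk_def L2_def)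
qed

text \<open>The given \<open>e j\<close> are determined only almost everywhere, while the abstract
  expansion needs families defined at every point. The families \<open>E j\<close> agree with the
  weak derivatives of \<open>e j\<close> almost everywhere, satisfy the eigenvalue equation at every
  point, and consist of the classical derivatives of \<open>u j\<close>.\<close>

theorem uniform_Mercer_expansion:
  assumes es: "eigensystem \<Theta> k h J lam e"
  shows "\<exists>u. (\<forall>j\<in>J. u j \<in> Ck_closure \<Theta> k \<and> (AE x in lebesgue_on \<Theta>. u j x = e j x)) \<and>
    (\<forall>\<alpha>\<in>mi_upto k. \<forall>\<beta>\<in>mi_upto k. \<forall>\<epsilon>>0. \<exists>N. \<forall>m\<ge>N. \<forall>x\<in>\<Theta>. \<forall>y\<in>\<Theta>.
      \<bar>kernel_deriv \<alpha> \<beta> h (x, y) -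
        (\<Sum>j\<in>J \<inter> {..m}. lam j * class_deriv \<alpha> (u j) x * class_deriv \<beta> (u j) y)\<bar> \<le> \<epsilon>)"
proof -
  have lam: "lam j \<noteq> 0" and e: "e j \<in> Hk \<Theta> k"
    and eig: "AE x in \<Lambda>. kernel_op \<Theta> k h (e j) x = lam j * e j x" if "j \<in> J" for j
    using es that by (auto simp: eigensystem_def eigenfunction_def)
  have orth: "inner_Hk \<Theta> k (e i) (e j) = (if i = j then 1 else 0)" if "i \<in> J" "j \<in> J" for i j
    using es that by (simp add: eigensystem_def)
  \<comment> \<open>Division by the eigenvalue makes \<open>kop (F j)\<close> reproduce the
    derivative family of \<open>e j\<close> almost everywhere.\<close>
  define F where "F j q = (1 / lam j) * derivs (e j) q" for j q
  define E where "E j = kop (F j)" for j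
  define u where "u j y = E j (\<lambda>_. 0, y)" for j y
  have F_int: "integrable M (F j)" if "j \<in> J" for j
    using derivs_integrable[OF e[OF that]] by (simp add: F_def[abs_def])
  have sf: "smooth_family (E j)" if "j \<in> J" for j
    unfolding E_def by (rule smooth_family_kop[OF F_int[OF that]])
  have u_Hk: "u j \<in> Hk \<Theta> k" if "j \<in> J" for j
    by (rule smooth_family_Hk(1)[OF sf[OF that] u_def])
  have kop_derivs: "kop (derivs (e j)) p = lam j * E j p" if "j \<in> J" for j p
    unfolding E_def F_def[abs_def] kop_cmult using lam[OF that] by simp
  have u_eq: "AE x in \<Lambda>. u j x = e j x" if j: "j \<in> J" for j
    using eig[OF j] AE_space
  proof eventually_elim
    case (elim x)
    then have "lam j * u j x = lam j * e j x"
      using kernel_op_eq_kop[OF e[OF j], of x] by (auto simp: kop_derivs[OF j] u_def)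
    then show ?case
      using lam[OF j] by simp
  qed
  have derivs_eq: "AE x in \<Lambda>. E j (\<alpha>, x) = derivs (e j) (\<alpha>, x)" if j: "j \<in> J" and \<alpha>: "\<alpha> \<in> A" for j \<alpha>
  proof -
    have "AE x in \<Lambda>. weak_deriv \<Theta> \<alpha> (u j) x = E j (\<alpha>, x)"
      by (rule smooth_family_Hk(2)[OF sf[OF j] u_def \<alpha>])
    moreover have "AE x in \<Lambda>. weak_deriv \<Theta> \<alpha> (e j) x = weak_deriv \<Theta> \<alpha> (u j) x"
      by (rule weak_deriv_cong_AE[OF u_Hk[OF j] e[OF j] u_eq[OF j] \<alpha>])
    ultimately show ?thesis
      by eventually_elim (simp add: derivs_def)
  qed
  have E_slice: "(\<lambda>x. E j (\<alpha>, x)) \<in> sqint \<Lambda>" if "j \<in> J" "\<alpha> \<in> A" for j \<alpha>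
    by (rule smooth_family_sqint[OF sf[OF that(1)] that(2)])
  note slice_int = finite_measure.sqint_integrable[OF finite_measure_\<Lambda>]
  have E_sqint: "E j \<in> sqint M" if "j \<in> J" for j
    by (rule sqint_M[OF E_slice[OF that]])
  have E_eig: "kop (E j) p = lam j * E j p" if j: "j \<in> J" and p: "p \<in> space M" for j p
  proof -
    have "kop (E j) p = kop (derivs (e j)) p"
      by (rule kop_cong_slices[OF slice_int[OF E_slice[OF j]] derivs_slice_integrable[OF e[OF j]] derivs_eq[OF j] p])
    then show ?thesis
      by (simp add: kop_derivs[OF j])
  qed
  have E_orth: "(\<integral>p. E i p * E j p \<partial>M) = (if i = j then 1 else 0)" if "i \<in> J" "j \<in> J" for i j
  proof -
    have "(\<integral>p. E i p * E j p \<partial>M) = (\<integral>p. derivs (e i) p * derivs (e j) p \<partial>M)"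
      by (rule integral_mult_cong_slices[OF E_slice[OF that(1)] derivs_slice_sqint[OF e[OF that(1)]]
            E_slice[OF that(2)] derivs_slice_sqint[OF e[OF that(2)]] derivs_eq[OF that(1)] derivs_eq[OF that(2)]])
    then show ?thesis
      using orth[OF that] by (simp add: inner_Hk_eq[OF e[OF that(1)] e[OF that(2)]])
  qed
  have E_complete: "(\<integral>p. (f p)\<^sup>2 \<partial>M) = 0"
    if "\<mu> \<noteq> 0" and f: "f \<in> sqint M" and f_eig: "\<forall>p\<in>space M. kop f p = \<mu> * f p"
      and f_orth: "\<forall>j\<in>J. (\<integral>p. f p * E j p \<partial>M) = 0" for \<mu> f
  proof -
    \<comment> \<open>Since \<open>\<mu> \<noteq> 0\<close>, an eigenfunction of the integral
      operator is itself an image of \<open>kop\<close>. Hence it is the derivative family of a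
      function \<open>v\<close>, which is an eigenfunction of the Sobolev operator and therefore a
      finite combination of the \<open>e j\<close> to the eigenvalue \<open>\<mu>\<close>.\<close>
    define G where "G = kop (\<lambda>q. (1 / \<mu>) * f q)"
    have G_eq: "G p = f p" if "p \<in> space M" for p
      unfolding G_def kop_cmult using f_eig that \<open>\<mu> \<noteq> 0\<close> by simp
    have G: "smooth_family G"
      unfolding G_def using sqint_integrable[OF f] by (intro smooth_family_kop) simp
    note G_slice = smooth_family_sqint[OF G]
    define v where "v y = G (\<lambda>_. 0, y)" for y
    have v: "v \<in> Hk \<Theta> k"
      by (rule smooth_family_Hk(1)[OF G v_def])
    have v_derivs: "AE x in \<Lambda>. derivs v (\<alpha>, x) = G (\<alpha>, x)" if \<alpha>: "\<alpha> \<in> A" for \<alpha>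
    proof -
      have "AE x in \<Lambda>. weak_deriv \<Theta> \<alpha> v x = G (\<alpha>, x)"
        by (rule smooth_family_Hk(2)[OF G v_def \<alpha>])
      then show ?thesis
        by (simp add: derivs_def)
    qed
    have "kernel_op \<Theta> k h v y = \<mu> * v y" if y: "y \<in> \<Theta>" for y
    proof -
      have p: "(\<lambda>_. 0, y) \<in> space M"
        using y zero_in_A by (simp add: space_M)
      have "kernel_op \<Theta> k h v y = kop (derivs v) (\<lambda>_. 0, y)"
        by (rule kernel_op_eq_kop[OF v y])
      also have "\<dots> = kop G (\<lambda>_. 0, y)"
        by (rule kop_cong_slices[OF derivs_slice_integrable[OF v] slice_int[OF G_slice] v_derivs p])
      also have "\<dots> = kop f (\<lambda>_. 0, y)"
        unfolding kop_def by (intro Bochner_Integration.integral_cong refl) (simp add: G_eq)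
      also have "\<dots> = \<mu> * v y"
        using f_eig p by (simp add: v_def G_eq)
      finally show ?thesis .
    qed
    then have "eigenfunction \<Theta> k h \<mu> v"
      unfolding eigenfunction_def using v by (intro conjI AE_I2) auto
    then obtain c where fin: "finite {j\<in>J. lam j = \<mu>}"
      and c: "AE x in \<Lambda>. v x = (\<Sum>j\<in>{j\<in>J. lam j = \<mu>}. c j * e j x)"
      using es \<open>\<mu> \<noteq> 0\<close> unfolding eigensystem_def by blast
    define I where "I = {j\<in>J. lam j = \<mu>}"
    have I: "finite I" "I \<subseteq> J"
      using fin by (auto simp: I_def)
    have sum: "(\<lambda>x. \<Sum>j\<in>I. c j * e j x) \<in> Hk \<Theta> k \<and> (\<forall>\<alpha>\<in>A. AE x in \<Lambda>.
        weak_deriv \<Theta> \<alpha> (\<lambda>x. \<Sum>j\<in>I. c j * e j x) x = (\<Sum>j\<in>I. c j * weak_deriv \<Theta> \<alpha> (e j) x))"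
      by (rule Hk_sum[OF open_domain I(1)]) (use e I(2) in auto)
    have G_sum: "AE x in \<Lambda>. G (\<alpha>, x) = (\<Sum>j\<in>I. c j * E j (\<alpha>, x))" if \<alpha>: "\<alpha> \<in> A" for \<alpha>
    proof -
      have "AE x in \<Lambda>. \<forall>j\<in>I. E j (\<alpha>, x) = derivs (e j) (\<alpha>, x)"
        using I derivs_eq[OF _ \<alpha>] by (intro AE_finite_allI) auto
      moreover have "AE x in \<Lambda>. weak_deriv \<Theta> \<alpha> (\<lambda>x. \<Sum>j\<in>I. c j * e j x) x = weak_deriv \<Theta> \<alpha> v x"
        using c by (intro weak_deriv_cong_AE[OF v _ _ \<alpha>]) (simp_all add: sum I_def[symmetric])
      moreover have "AE x in \<Lambda>. weak_deriv \<Theta> \<alpha> (\<lambda>x. \<Sum>j\<in>I. c j * e j x) x =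
          (\<Sum>j\<in>I. c j * weak_deriv \<Theta> \<alpha> (e j) x)"
        using sum \<alpha> by blast
      ultimately show ?thesis
        using v_derivs[OF \<alpha>] by eventually_elim (simp add: derivs_def)
    qed
    have sum_slice: "(\<lambda>x. \<Sum>j\<in>I. c j * E j (\<alpha>, x)) \<in> sqint \<Lambda>" if "\<alpha> \<in> A" for \<alpha>
      using I(2) by (intro sqint_sum E_slice that) auto
    \<comment> \<open>One factor is expanded in the \<open>E j\<close>, to which the other factor is
      orthogonal.\<close>
    have "(\<integral>p. (f p)\<^sup>2 \<partial>M) = (\<integral>p. G p * G p \<partial>M)"
      by (intro Bochner_Integration.integral_cong refl) (simp add: G_eq power2_eq_square)
    also have "\<dots> = (\<integral>p. G p * (\<Sum>j\<in>I. c j * E j p) \<partial>M)"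
      by (rule integral_mult_cong_slices[OF G_slice G_slice G_slice sum_slice _ G_sum]) simp_all
    also have "\<dots> = (\<integral>p. (\<Sum>j\<in>I. c j * (f p * E j p)) \<partial>M)"
      by (intro Bochner_Integration.integral_cong refl) (simp add: G_eq sum_distrib_left mult_ac)
    also have "\<dots> = (\<Sum>j\<in>I. c j * (\<integral>p. f p * E j p \<partial>M))"
    proof -
      have "integrable M (\<lambda>p. f p * E j p)" if "j \<in> I" for j
        using I(2) that by (intro sqint_integrable_mult f E_sqint) auto
      then show ?thesis
        by (subst Bochner_Integration.integral_sum) auto
    qed
    also have "\<dots> = 0"
      using f_orth I(2) by (intro sum.neutral) auto
    finally show ?thesis .
  qed
  have expansion: "\<exists>N. \<forall>m\<ge>N. \<forall>p\<in>space M. \<forall>q\<in>space M.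
      \<bar>K p q - (\<Sum>j\<in>J \<inter> {..m}. lam j * E j p * E j q)\<bar> \<le> \<epsilon>" if "0 < \<epsilon>" for \<epsilon>
    by (rule uniform_eigenfunction_expansion[OF E_sqint E_eig lam E_orth E_complete kernel_ball_pos_measure that])
  have class_u: "class_deriv \<alpha> (u j) x = E j (\<alpha>, x)" if "j \<in> J" "\<alpha> \<in> A" "x \<in> \<Theta>" for j \<alpha> x
    by (rule smooth_family_Ck(2)[OF sf[OF that(1)] u_def that(2,3)])
  show ?thesis
  proof (intro exI[of _ u] conjI ballI allI impI)
    show "u j \<in> Ck_closure \<Theta> k" if "j \<in> J" for j
      by (rule smooth_family_Ck(1)[OF sf[OF that] u_def])
    show "AE x in \<Lambda>. u j x = e j x" if "j \<in> J" for j
      by (rule u_eq[OF that])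
    fix \<alpha> \<beta> :: "'n multi_index" and \<epsilon> :: real
    assume \<alpha>: "\<alpha> \<in> A" and \<beta>: "\<beta> \<in> A" and "0 < \<epsilon>"
    from expansion[OF this(3)] obtain N where N: "\<And>m p q. N \<le> m \<Longrightarrow> p \<in> space M \<Longrightarrow> q \<in> space M \<Longrightarrow>
        \<bar>K p q - (\<Sum>j\<in>J \<inter> {..m}. lam j * E j p * E j q)\<bar> \<le> \<epsilon>"
      by blast
    have "\<bar>kernel_deriv \<alpha> \<beta> h (x, y) -
        (\<Sum>j\<in>J \<inter> {..m}. lam j * class_deriv \<alpha> (u j) x * class_deriv \<beta> (u j) y)\<bar> \<le> \<epsilon>"
      if "N \<le> m" "x \<in> \<Theta>" "y \<in> \<Theta>" for m x y
    proof -
      have "(\<Sum>j\<in>J \<inter> {..m}. lam j * class_deriv \<alpha> (u j) x * class_deriv \<beta> (u j) y) =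
          (\<Sum>j\<in>J \<inter> {..m}. lam j * E j (\<alpha>, x) * E j (\<beta>, y))"
        using that \<alpha> \<beta> by (intro sum.cong refl) (simp add: class_u)
      then show ?thesis
        using N[of m "(\<alpha>, x)" "(\<beta>, y)"] that \<alpha> \<beta> by (simp add: space_M K_def)
    qed
    then show "\<exists>N. \<forall>m\<ge>N. \<forall>x\<in>\<Theta>. \<forall>y\<in>\<Theta>. \<bar>kernel_deriv \<alpha> \<beta> h (x, y) -
        (\<Sum>j\<in>J \<inter> {..m}. lam j * class_deriv \<alpha> (u j) x * class_deriv \<beta> (u j) y)\<bar> \<le> \<epsilon>"
      by blast
  qed
qed

end

text \<open>Values of the extension, inside and on the boundary, become limits along sequences in
  \<open>S\<close>; in this form estimates on the domain pass to its closure.\<close>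

lemma cont_ext_tendsto:
  fixes f :: "'a::metric_space \<Rightarrow> real"
  assumes uc: "uniformly_continuous_on S f" and X: "\<And>n. X n \<in> S" "X \<longlonglongrightarrow> x"
  shows "(\<lambda>n. f (X n)) \<longlonglongrightarrow> cont_ext S f x"
proof (cases "x \<in> S")
  case True
  then show ?thesis
    using continuous_on_tendsto_compose[OF uniformly_continuous_imp_continuous[OF uc] X(2) True] X(1)
    by (simp add: cont_ext_def)
next
  case False
  have "x \<in> closure S"
    unfolding closure_sequential using X by blast
  then obtain l where l: "(f \<longlongrightarrow> l) (at x within S)"
    using uniformly_continuous_on_extension_at_closure[OF uc] by blast
  \<comment> \<open>\<open>Lim\<close> is determined by convergence only for a proper filter; a
    point of the closure outside \<open>S\<close> is a limit point of \<open>S\<close>.\<close>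
  have "at x within S \<noteq> bot"
    using \<open>x \<in> closure S\<close> False by (simp add: closure_def trivial_limit_within)
  then have "cont_ext S f x = l"
    using False tendsto_Lim[OF _ l] by (simp add: cont_ext_def)
  moreover have "filterlim X (at x within S) sequentially"
    unfolding filterlim_at using X False by (auto intro!: always_eventually)
  ultimately show ?thesis
    using filterlim_compose[OF l] by simp
qed

text \<open>Suprema in \<open>ennreal\<close> are meaningful for unbounded and for empty sets; this
  reduces their convergence to real bounds. Below a positive threshold lies \<open>r / 2\<close> if
  it is the real \<open>r\<close>, and 1 if it is infinite.\<close>

lemma tendsto_0_ennrealI:
  fixes f :: "nat \<Rightarrow> ennreal"
  assumes "\<And>\<epsilon>. 0 < \<epsilon> \<Longrightarrow> \<exists>N. \<forall>m\<ge>N. f m \<le> ennreal \<epsilon>"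
  shows "f \<longlonglongrightarrow> 0"
proof (rule order_tendstoI)
  fix a :: ennreal assume "0 < a"
  obtain \<epsilon> where \<epsilon>: "0 < \<epsilon>" "ennreal \<epsilon> < a"
  proof (cases a)
    case (real r)
    then show ?thesis
      using \<open>0 < a\<close> by (intro that[of "r / 2"]) (auto simp: ennreal_less_iff)
  next
    case top
    then show ?thesis
      by (intro that[of 1]) auto
  qed
  obtain N where "\<And>m. N \<le> m \<Longrightarrow> f m \<le> ennreal \<epsilon>"
    using assms[OF \<epsilon>(1)] by blast
  then show "\<forall>\<^sub>F m in sequentially. f m < a"
    unfolding eventually_sequentially using \<epsilon>(2) le_less_trans by blast
qed simp

text \<open>Members of \<open>Hk\<close> stand for classes up to null sets, so regularity is a
  statement about representatives \<open>u j\<close>; one choice serves all \<open>\<alpha>\<close>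
  and \<open>\<beta>\<close>. Intersecting \<open>J\<close> with \<open>{..m}\<close> covers finite
  and infinite eigensystems alike.\<close>

theorem theorem3p6:
  fixes \<Theta> :: "(real^'n::finite) set"
    and k :: nat
    and h :: "(real^'n) \<times> (real^'n) \<Rightarrow> real"
  assumes "open \<Theta>" and "bounded \<Theta>"
    and "h \<in> Ckk_closure \<Theta> k"
    and "positive_definite_kernel \<Theta> h"
  shows "compact_operator_on \<Theta> (H0k \<Theta> k) (norm_Hk \<Theta> k) (kernel_op \<Theta> k h) \<and>
    (\<forall>J lam e. eigensystem \<Theta> k h J lam e \<longrightarrow>
      (\<exists>u. (\<forall>j\<in>J. u j \<in> Ck_closure \<Theta> k \<and> (AE x in lebesgue_on \<Theta>. u j x = e j x)) \<and>
        (\<forall>\<alpha>\<in>mi_upto k. \<forall>\<beta>\<in>mi_upto k.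
          (\<lambda>m. SUP (x, y)\<in>closure \<Theta> \<times> closure \<Theta>.
             ennreal \<bar>cont_ext (\<Theta> \<times> \<Theta>) (kernel_deriv \<alpha> \<beta> h) (x, y) -
               (\<Sum>j\<in>J \<inter> {..m}. lam j * cont_ext \<Theta> (class_deriv \<alpha> (u j)) x
                  * cont_ext \<Theta> (class_deriv \<beta> (u j)) y)\<bar>) \<longlonglongrightarrow> 0)))"
proof (intro conjI allI impI)
  interpret sobolev_kernel \<Theta> k h
    by unfold_locales (rule assms)+
  show "compact_operator_on \<Theta> (H0k \<Theta> k) (norm_Hk \<Theta> k) (kernel_op \<Theta> k h)"
    by (rule compact_operator_kernel_op)
  fix J lam e assume "eigensystem \<Theta> k h J lam e"
  from uniform_Mercer_expansion[OF this] obtain u where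
    u: "\<forall>j\<in>J. u j \<in> Ck_closure \<Theta> k \<and> (AE x in lebesgue_on \<Theta>. u j x = e j x)"
    and expansion: "\<forall>\<alpha>\<in>mi_upto k. \<forall>\<beta>\<in>mi_upto k. \<forall>\<epsilon>>0. \<exists>N. \<forall>m\<ge>N. \<forall>x\<in>\<Theta>. \<forall>y\<in>\<Theta>.
      \<bar>kernel_deriv \<alpha> \<beta> h (x, y) -
        (\<Sum>j\<in>J \<inter> {..m}. lam j * class_deriv \<alpha> (u j) x * class_deriv \<beta> (u j) y)\<bar> \<le> \<epsilon>"
    by blast
  show "\<exists>u. (\<forall>j\<in>J. u j \<in> Ck_closure \<Theta> k \<and> (AE x in lebesgue_on \<Theta>. u j x = e j x)) \<and>
        (\<forall>\<alpha>\<in>mi_upto k. \<forall>\<beta>\<in>mi_upto k.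
          (\<lambda>m. SUP (x, y)\<in>closure \<Theta> \<times> closure \<Theta>.
             ennreal \<bar>cont_ext (\<Theta> \<times> \<Theta>) (kernel_deriv \<alpha> \<beta> h) (x, y) -
               (\<Sum>j\<in>J \<inter> {..m}. lam j * cont_ext \<Theta> (class_deriv \<alpha> (u j)) x
                  * cont_ext \<Theta> (class_deriv \<beta> (u j)) y)\<bar>) \<longlonglongrightarrow> 0)"
  proof (intro exI[of _ u] conjI u ballI tendsto_0_ennrealI)
    fix \<alpha> \<beta> :: "'n multi_index" and \<epsilon> :: real
    assume \<alpha>: "\<alpha> \<in> mi_upto k" and \<beta>: "\<beta> \<in> mi_upto k" and "0 < \<epsilon>"
    then obtain N where N: "\<And>m x y. N \<le> m \<Longrightarrow> x \<in> \<Theta> \<Longrightarrow> y \<in> \<Theta> \<Longrightarrow> \<bar>kernel_deriv \<alpha> \<beta> h (x, y) -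
        (\<Sum>j\<in>J \<inter> {..m}. lam j * class_deriv \<alpha> (u j) x * class_deriv \<beta> (u j) y)\<bar> \<le> \<epsilon>"
      using expansion by meson
    have uc_h: "uniformly_continuous_on (\<Theta> \<times> \<Theta>) (kernel_deriv \<alpha> \<beta> h)"
      using K_uniformly_continuous[OF \<alpha> \<beta>] by (simp add: K_def case_prod_unfold)
    have uc_u: "uniformly_continuous_on \<Theta> (class_deriv \<gamma> (u j))" if "j \<in> J" "\<gamma> \<in> mi_upto k" for j \<gamma>
      using u that by (auto simp: Ck_closure_def)
    have bound: "\<bar>cont_ext (\<Theta> \<times> \<Theta>) (kernel_deriv \<alpha> \<beta> h) (x, y) -
        (\<Sum>j\<in>J \<inter> {..m}. lam j * cont_ext \<Theta> (class_deriv \<alpha> (u j)) x * cont_ext \<Theta> (class_deriv \<beta> (u j)) y)\<bar> \<le> \<epsilon>"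
      if m: "N \<le> m" and xy: "x \<in> closure \<Theta>" "y \<in> closure \<Theta>" for m x y
    proof -
      \<comment> \<open>For fixed \<open>m\<close> the sum is finite, so the bound on the domain
        passes to the closure along approximating sequences, with the same \<open>N\<close>.\<close>
      obtain X where X: "\<And>n. X n \<in> \<Theta>" "X \<longlonglongrightarrow> x"
        using xy(1) unfolding closure_sequential by blast
      obtain Y where Y: "\<And>n. Y n \<in> \<Theta>" "Y \<longlonglongrightarrow> y"
        using xy(2) unfolding closure_sequential by blast
      have "(\<lambda>n. kernel_deriv \<alpha> \<beta> h (X n, Y n)) \<longlonglongrightarrow> cont_ext (\<Theta> \<times> \<Theta>) (kernel_deriv \<alpha> \<beta> h) (x, y)"
        by (rule cont_ext_tendsto[OF uc_h]) (use X Y in \<open>auto intro: tendsto_Pair\<close>)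
      then have "(\<lambda>n. \<bar>kernel_deriv \<alpha> \<beta> h (X n, Y n) -
          (\<Sum>j\<in>J \<inter> {..m}. lam j * class_deriv \<alpha> (u j) (X n) * class_deriv \<beta> (u j) (Y n))\<bar>) \<longlonglongrightarrow>
          \<bar>cont_ext (\<Theta> \<times> \<Theta>) (kernel_deriv \<alpha> \<beta> h) (x, y) -
          (\<Sum>j\<in>J \<inter> {..m}. lam j * cont_ext \<Theta> (class_deriv \<alpha> (u j)) x * cont_ext \<Theta> (class_deriv \<beta> (u j)) y)\<bar>"
        by (intro tendsto_rabs tendsto_diff tendsto_sum tendsto_mult tendsto_const
            cont_ext_tendsto[OF uc_u[OF _ \<alpha>]] cont_ext_tendsto[OF uc_u[OF _ \<beta>]] X Y) auto
      then show ?thesis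
        by (rule LIMSEQ_le_const2) (use N[OF m X(1) Y(1)] in blast)
    qed
    show "\<exists>N. \<forall>m\<ge>N. (SUP (x, y)\<in>closure \<Theta> \<times> closure \<Theta>.
             ennreal \<bar>cont_ext (\<Theta> \<times> \<Theta>) (kernel_deriv \<alpha> \<beta> h) (x, y) -
               (\<Sum>j\<in>J \<inter> {..m}. lam j * cont_ext \<Theta> (class_deriv \<alpha> (u j)) x
                  * cont_ext \<Theta> (class_deriv \<beta> (u j)) y)\<bar>) \<le> ennreal \<epsilon>"
    proof (intro exI[of _ N] allI impI SUP_least)
      fix m p assume "N \<le> m" and "p \<in> closure \<Theta> \<times> closure \<Theta>"
      then show "(case p of (x, y) \<Rightarrow> ennreal \<bar>cont_ext (\<Theta> \<times> \<Theta>) (kernel_deriv \<alpha> \<beta> h) (x, y) -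
               (\<Sum>j\<in>J \<inter> {..m}. lam j * cont_ext \<Theta> (class_deriv \<alpha> (u j)) x
                  * cont_ext \<Theta> (class_deriv \<beta> (u j)) y)\<bar>) \<le> ennreal \<epsilon>"
        using bound by (auto intro!: ennreal_leI)
    qed
  qed
qed

end
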